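(* Let $\mathfrak A$ be a Banach algebra and $\phi$ a continuous $\mathfrak A$-valued measure of finite variation on an interval $I$. If $\phi$ is $M$-controlled, then $\log\exp_{\mathrm R}(\phi)$ exists, $\sum_{n=1}^\infty|\mu_{n,\mathrm R}(\phi)|<+\infty$, moreover $\sum_{n=1}^\infty\max_{\lambda\in[0,1]}|\mu^{(\lambda)}_{n,\mathrm R}(\phi)|<+\infty$, and $$\log\exp_{\mathrm R}(\phi)=\int_{\lambda=0}^1\sum_{k=1}^\infty\mu^{(\lambda)}_{k,\mathrm R}(\phi)\,\mathrm d\lambda=\sum_{k=1}^\infty\mu_{k,\mathrm R}(\phi).$$
   Context: Banach algebras are unital, real or complex; for real ones, spectra and expressions with complex scalars are taken in the complexification with norm $|x|=\inf\{\sum_i|t_i|\,|x_i|: x=\sum_i t_ix_i,\ x_i\in\mathfrak A,\ t_i\in\mathbb C\}$. An $\mathfrak A$-valued measure on a bounded interval $I$ is a $\sigma$-additive $\mathfrak A$-valued function on the subintervals of $I$ (degenerate ones included); its variation is $\int|\phi|=\sup\sum_s|\phi(J_s)|$ over finite families of disjoint subintervals; continuous means $\phi(\{x\})=0$ for all $x$. $\exp_{\mathrm R}(\phi)=1+\sum_{k\ge1}\int_{t_1\le\dots\le t_k\in I}\phi(t_1)\cdots\phi(t_k)$. For $\sigma\in\Sigma_k$, $\mathrm{asc}(\sigma)$, $\mathrm{des}(\sigma)$ are the numbers of $i$ with $\sigma(i)<\sigma(i+1)$, resp. $\sigma(i)>\sigma(i+1)$. $\mu_k^{(\lambda)}(X_1,\dots,X_k)=\sum_{\sigma\in\Sigma_k}\lambda^{\mathrm{asc}(\sigma)}(\lambda-1)^{\mathrm{des}(\sigma)}X_{\sigma(1)}\cdots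 X_{\sigma(k)}$; $\mu_k(X_1,\dots,X_k)=\sum_{\sigma\in\Sigma_k}(-1)^{\mathrm{des}(\sigma)}\frac{\mathrm{asc}(\sigma)!\,\mathrm{des}(\sigma)!}{k!}X_{\sigma(1)}\cdots X_{\sigma(k)}$; $\mu_{k,\mathrm R}(\phi)=\int_{t_1\le\dots\le t_k\in I}\mu_k(\phi(t_1),\dots,\phi(t_k))$ and $\mu^{(\lambda)}_{k,\mathrm R}(\phi)=\int_{t_1\le\dots\le t_k\in I}\mu^{(\lambda)}_k(\phi(t_1),\dots,\phi(t_k))$. $\log A$ exists iff the spectrum of $A$ is disjoint from $(-\infty,0]$, and then $\log A=\int_0^1 (A-1)(\lambda+(1-\lambda)A)^{-1}\,\mathrm d\lambda$. $\phi$ is $M$-controlled if $\log\exp_{\mathrm R}(t\cdot\phi)$ exists for every complex $t$ with $|t|\le1$. *)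

theory Defs
  imports "HOL-Analysis.Analysis" "HOL-Combinatorics.Permutations"
begin

section \<open>Complex Banach algebras and complexification\<close>

class complex_banach_algebra_1 = real_normed_algebra_1 + banach +
  fixes scaleC :: "complex \<Rightarrow> 'a \<Rightarrow> 'a"  (infixr \<open>*\<^sub>C\<close> 75)
  assumes scaleC_add_right: "c *\<^sub>C (x + y) = c *\<^sub>C x + c *\<^sub>C y"
    and scaleC_add_left: "(c + d) *\<^sub>C x = c *\<^sub>C x + d *\<^sub>C x"
    and scaleC_scaleC: "c *\<^sub>C (d *\<^sub>C x) = (c * d) *\<^sub>C x"
    and scaleC_of_real: "of_real r *\<^sub>C x = r *\<^sub>R x"
    and mult_scaleC_left: "(c *\<^sub>C x) * y = c *\<^sub>C (x * y)"
    and mult_scaleC_right: "x * (c *\<^sub>C y) = c *\<^sub>C (x * y)"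
    and norm_scaleC: "norm (c *\<^sub>C x) = cmod c * norm x"

text \<open>The pair \<open>Cpl x y\<close> stands for \<open>x + i y\<close>.\<close>

datatype 'a complexification = Cpl (cRe: 'a) (cIm: 'a)

lemma complexification_eq_iff: "z = w \<longleftrightarrow> cRe z = cRe w \<and> cIm z = cIm w"
  by (cases z; cases w) auto

definition complexify :: "'a::zero \<Rightarrow> 'a complexification"
  where "complexify x = Cpl x 0"

lemma complexify_sel [simp]: "cRe (complexify x) = x" "cIm (complexify x) = 0"
  by (simp_all add: complexify_def)

definition cpl_scale :: "complex \<Rightarrow> 'a::real_vector complexification \<Rightarrow> 'a complexification"
  where "cpl_scale c z = Cpl (Re c *\<^sub>R cRe z - Im c *\<^sub>R cIm z) (Re c *\<^sub>R cIm z + Im c *\<^sub>R cRe z)"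

lemma cpl_scale_sel [simp]:
  "cRe (cpl_scale c z) = Re c *\<^sub>R cRe z - Im c *\<^sub>R cIm z"
  "cIm (cpl_scale c z) = Re c *\<^sub>R cIm z + Im c *\<^sub>R cRe z"
  by (simp_all add: cpl_scale_def)

instantiation complexification :: (real_vector) real_vector
begin

definition "0 = Cpl 0 0"
definition "z + w = Cpl (cRe z + cRe w) (cIm z + cIm w)"
definition "- z = Cpl (- cRe z) (- cIm z)"
definition "z - w = Cpl (cRe z - cRe w) (cIm z - cIm w)"
definition "r *\<^sub>R z = Cpl (r *\<^sub>R cRe z) (r *\<^sub>R cIm z)"

lemma complexification_vector_sel [simp]:
  "cRe 0 = 0" "cIm 0 = 0"
  "cRe (z + w) = cRe z + cRe w" "cIm (z + w) = cIm z + cIm w"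
  "cRe (- z) = - cRe z" "cIm (- z) = - cIm z"
  "cRe (z - w) = cRe z - cRe w" "cIm (z - w) = cIm z - cIm w"
  "cRe (r *\<^sub>R z) = r *\<^sub>R cRe z" "cIm (r *\<^sub>R z) = r *\<^sub>R cIm z"
  by (simp_all add: zero_complexification_def plus_complexification_def
      uminus_complexification_def minus_complexification_def scaleR_complexification_def)

instance
  by intro_classes (simp_all add: complexification_eq_iff algebra_simps)

end

instantiation complexification :: (real_algebra_1) real_algebra_1
begin

definition "1 = Cpl 1 0"
definition "z * w = Cpl (cRe z * cRe w - cIm z * cIm w) (cRe z * cIm w + cIm z * cRe w)"

lemma complexification_algebra_sel [simp]:
  "cRe 1 = 1" "cIm 1 = 0"
  "cRe (z * w) = cRe z * cRe w - cIm z * cIm w"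
  "cIm (z * w) = cRe z * cIm w + cIm z * cRe w"
  by (simp_all add: one_complexification_def times_complexification_def)

instance
  by intro_classes (simp_all add: complexification_eq_iff algebra_simps)

end

definition cpl_combination :: "(complex \<times> 'a::real_vector) list \<Rightarrow> 'a complexification"
  where "cpl_combination l = (\<Sum>(t, x)\<leftarrow>l. cpl_scale t (complexify x))"

definition cpl_weight :: "(complex \<times> 'a::real_normed_vector) list \<Rightarrow> real"
  where "cpl_weight l = (\<Sum>(t, x)\<leftarrow>l. cmod t * norm x)"

definition cpl_norm :: "'a::real_normed_vector complexification \<Rightarrow> real"
  where "cpl_norm z = Inf {cpl_weight l | l. z = cpl_combination l}"

lemma cpl_combination_simps [simp]:
  "cpl_combination [] = 0"
  "cpl_combination ((t, x) # l) = cpl_scale t (complexify x) + cpl_combination l"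
  "cpl_combination (l @ m) = cpl_combination l + cpl_combination m"
  by (simp_all add: cpl_combination_def)

lemma cpl_weight_simps [simp]:
  "cpl_weight [] = 0"
  "cpl_weight ((t, x) # l) = cmod t * norm x + cpl_weight l"
  "cpl_weight (l @ m) = cpl_weight l + cpl_weight m"
  by (simp_all add: cpl_weight_def)

lemma cpl_weight_nonneg: "0 \<le> cpl_weight l"
  by (induction l) auto

lemma norm_sel_combination_le:
  "norm (cRe (cpl_combination l)) \<le> cpl_weight l"
  "norm (cIm (cpl_combination l)) \<le> cpl_weight l"
proof (induction l)
  case (Cons p l)
  obtain t x where p: "p = (t, x)" by (cases p)
  { case 1
    have "norm (Re t *\<^sub>R x) \<le> cmod t * norm x"
      by (simp add: abs_Re_le_cmod mult_right_mono)
    then show ?case using Cons.IH(1) norm_triangle_ineq[of "Re t *\<^sub>R x" "cRe (cpl_combination l)"]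
      by (simp add: p) }
  { case 2
    have "norm (Im t *\<^sub>R x) \<le> cmod t * norm x"
      by (simp add: abs_Im_le_cmod mult_right_mono)
    then show ?case using Cons.IH(2) norm_triangle_ineq[of "Im t *\<^sub>R x" "cIm (cpl_combination l)"]
      by (simp add: p) }
qed simp_all

lemma cpl_combination_ex: "z = cpl_combination [(1, cRe z), (\<i>, cIm z)]"
  by (simp add: complexification_eq_iff)

lemma cpl_norm_le: "z = cpl_combination l \<Longrightarrow> cpl_norm z \<le> cpl_weight l"
  unfolding cpl_norm_def
  by (rule cInf_lower) (auto intro!: bdd_belowI[of _ 0] cpl_weight_nonneg)

lemma cpl_norm_ge: "(\<And>l. z = cpl_combination l \<Longrightarrow> r \<le> cpl_weight l) \<Longrightarrow> r \<le> cpl_norm z"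
  unfolding cpl_norm_def
  by (rule cInf_greatest) (use cpl_combination_ex[of z] in blast)+

lemma cpl_norm_less_ex: 
  assumes "cpl_norm z < r" obtains l where "z = cpl_combination l" "cpl_weight l < r"
  using assms cpl_norm_ge[of z r] by (meson not_less)

lemma norm_cRe_le: "norm (cRe z) \<le> cpl_norm z" and norm_cIm_le: "norm (cIm z) \<le> cpl_norm z"
  by (rule cpl_norm_ge; use norm_sel_combination_le in auto)+

lemma cpl_norm_le_parts: "cpl_norm z \<le> norm (cRe z) + norm (cIm z)"
  using cpl_norm_le[OF cpl_combination_ex[of z]] by simp

lemma cpl_norm_nonneg: "0 \<le> cpl_norm z"
  using norm_cRe_le[of z] norm_ge_zero order_trans by blast

lemma cpl_norm_eq_0: "cpl_norm z = 0 \<longleftrightarrow> z = 0"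
  using norm_cRe_le[of z] norm_cIm_le[of z] cpl_norm_le_parts[of z] cpl_norm_nonneg[of z]
  by (auto simp: complexification_eq_iff)

lemma cpl_norm_triangle: "cpl_norm (z + w) \<le> cpl_norm z + cpl_norm w"
proof (rule field_le_epsilon)
  fix e :: real assume e: "e > 0"
  obtain l where l: "z = cpl_combination l" "cpl_weight l < cpl_norm z + e/2"
    using cpl_norm_less_ex[of z "cpl_norm z + e/2"] e by auto
  obtain m where m: "w = cpl_combination m" "cpl_weight m < cpl_norm w + e/2"
    using cpl_norm_less_ex[of w "cpl_norm w + e/2"] e by auto
  have "z + w = cpl_combination (l @ m)" using l m by simp
  then have "cpl_norm (z + w) \<le> cpl_weight (l @ m)" by (rule cpl_norm_le)
  also have "\<dots> \<le> cpl_norm z + cpl_norm w + e" using l m by simp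
  finally show "cpl_norm (z + w) \<le> cpl_norm z + cpl_norm w + e" .
qed

lemma cpl_scale_add: "cpl_scale c (z + w) = cpl_scale c z + cpl_scale c w"
  by (simp add: complexification_eq_iff algebra_simps)

lemma cpl_scale_scale: "cpl_scale c (cpl_scale d z) = cpl_scale (c * d) z"
  by (simp add: complexification_eq_iff algebra_simps)

lemma cpl_scale_1: "cpl_scale 1 z = z"
  by (simp add: complexification_eq_iff)

lemma cpl_combination_scale:
  "cpl_combination (map (\<lambda>(t, x). (c * t, x)) l) = cpl_scale c (cpl_combination l)"
proof (induction l)
  case (Cons p l)
  then show ?case by (cases p) (simp add: cpl_scale_add cpl_scale_scale)
qed (simp add: complexification_eq_iff)

lemma cpl_weight_scale: "cpl_weight (map (\<lambda>(t, x). (c * t, x)) l) = cmod c * cpl_weight l"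
  by (induction l) (auto simp: norm_mult algebra_simps)

lemma cpl_norm_scale_le: "cpl_norm (cpl_scale c z) \<le> cmod c * cpl_norm z"
proof (cases "c = 0")
  case True
  then have "cpl_scale c z = 0" by (simp add: complexification_eq_iff)
  then show ?thesis using True cpl_norm_eq_0[of "cpl_scale c z"] by simp
next
  case False
  have "cpl_norm (cpl_scale c z) / cmod c \<le> cpl_norm z"
  proof (rule cpl_norm_ge)
    fix l assume "z = cpl_combination l"
    then have "cpl_norm (cpl_scale c z) \<le> cmod c * cpl_weight l"
      using cpl_norm_le[of "cpl_scale c z" "map (\<lambda>(t, x). (c * t, x)) l"]
      by (simp add: cpl_combination_scale cpl_weight_scale)
    then show "cpl_norm (cpl_scale c z) / cmod c \<le> cpl_weight l"
      using False by (simp add: field_simps)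
  qed
  then show ?thesis using False by (simp add: field_simps)
qed

lemma cpl_norm_scale: "cpl_norm (cpl_scale c z) = cmod c * cpl_norm z"
proof (cases "c = 0")
  case True
  then show ?thesis using cpl_norm_scale_le[of c z] cpl_norm_nonneg[of "cpl_scale c z"] by simp
next
  case False
  have "cpl_norm z = cpl_norm (cpl_scale (inverse c) (cpl_scale c z))"
    using False by (simp add: cpl_scale_scale cpl_scale_1)
  also have "\<dots> \<le> cmod (inverse c) * cpl_norm (cpl_scale c z)" by (rule cpl_norm_scale_le)
  finally have "cmod c * cpl_norm z \<le> cpl_norm (cpl_scale c z)"
    using False by (simp add: norm_inverse norm_divide field_simps)
  then show ?thesis using cpl_norm_scale_le[of c z] by simp
qed

lemma cpl_scale_of_real: "cpl_scale (of_real r) z = r *\<^sub>R z"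
  by (simp add: complexification_eq_iff)

lemma cpl_norm_complexify [simp]: "cpl_norm (complexify x) = norm x"
  using norm_cRe_le[of "complexify x"] cpl_norm_le_parts[of "complexify x"] by simp

lemma cpl_combination_mult1:
  fixes l :: "(complex \<times> 'a::real_algebra_1) list"
  shows "cpl_combination (map (\<lambda>(t, y). (c * t, x * y)) l)
    = cpl_scale c (complexify x) * cpl_combination l"
proof (induction l)
  case (Cons p l)
  then show ?case
    by (cases p) (simp add: complexification_eq_iff algebra_simps)
qed (simp add: complexification_eq_iff)

lemma cpl_weight_mult1:
  fixes l :: "(complex \<times> 'a::real_normed_algebra_1) list"
  shows "cpl_weight (map (\<lambda>(t, y). (c * t, x * y)) l) \<le> (cmod c * norm x) * cpl_weight l"
proof (induction l)
  case (Cons p l)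
  obtain t y where p: "p = (t, y)" by (cases p)
  have "cmod c * cmod t * norm (x * y) \<le> cmod c * cmod t * (norm x * norm y)"
    by (intro mult_left_mono norm_mult_ineq) auto
  then show ?case using Cons by (simp add: p norm_mult algebra_simps)
qed simp

lemma cpl_combination_mult:
  fixes l m :: "(complex \<times> 'a::real_normed_algebra_1) list"
  shows "\<exists>n. cpl_combination n = cpl_combination l * cpl_combination m
    \<and> cpl_weight n \<le> cpl_weight l * cpl_weight m"
proof (induction l)
  case Nil
  show ?case by (rule exI[of _ "[]"]) simp
next
  case (Cons p l)
  obtain c x where p: "p = (c, x)" by (cases p)
  from Cons obtain n where n: "cpl_combination n = cpl_combination l * cpl_combination m"
    "cpl_weight n \<le> cpl_weight l * cpl_weight m" by blast
  show ?case
    by (rule exI[of _ "map (\<lambda>(t, y). (c * t, x * y)) m @ n"])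
      (use n cpl_weight_mult1[of c x m] in \<open>simp add: p cpl_combination_mult1 distrib_right\<close>)
qed

lemma cpl_norm_mult:
  fixes z w :: "'a::real_normed_algebra_1 complexification"
  shows "cpl_norm (z * w) \<le> cpl_norm z * cpl_norm w"
proof -
  have *: "cpl_norm (z * w) \<le> cpl_weight l * cpl_weight m"
    if zw: "z = cpl_combination l" "w = cpl_combination m" for l m
  proof -
    obtain n where "cpl_combination n = z * w" "cpl_weight n \<le> cpl_weight l * cpl_weight m"
      using cpl_combination_mult[of l m] zw by blast
    then show ?thesis using cpl_norm_le[of "z * w" n] by simp
  qed
  have "cpl_norm (z * w) \<le> (cpl_norm z + e) * (cpl_norm w + e)" if e: "e > 0" for e
  proof -
    obtain l where l: "z = cpl_combination l" "cpl_weight l < cpl_norm z + e"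
      using cpl_norm_less_ex[of z "cpl_norm z + e"] e by auto
    obtain m where m: "w = cpl_combination m" "cpl_weight m < cpl_norm w + e"
      using cpl_norm_less_ex[of w "cpl_norm w + e"] e by auto
    have "cpl_weight l * cpl_weight m \<le> (cpl_norm z + e) * (cpl_norm w + e)"
      by (intro mult_mono) (use l m cpl_weight_nonneg[of l] cpl_weight_nonneg[of m] in auto)
    then show ?thesis using *[OF l(1) m(1)] by linarith
  qed
  then have "\<forall>\<^sub>F e in at_right 0. cpl_norm (z * w) \<le> (cpl_norm z + e) * (cpl_norm w + e)"
    by (simp add: eventually_at_right_less eventually_mono[OF eventually_at_right_less])
  moreover have "((\<lambda>e. (cpl_norm z + e) * (cpl_norm w + e)) \<longlongrightarrow> (cpl_norm z + 0) * (cpl_norm w + 0)) (at_right 0)"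
    by (intro tendsto_intros)
  ultimately show ?thesis
    using tendsto_lowerbound[of _ _ "at_right (0::real)" "cpl_norm (z * w)"] by simp
qed

instantiation complexification :: (real_normed_vector) real_normed_vector
begin

definition "norm = (cpl_norm :: 'a complexification \<Rightarrow> real)"
definition "dist z w = norm (z - w)" for z w :: "'a complexification"
definition "sgn z = inverse (norm z) *\<^sub>R z" for z :: "'a complexification"
definition "uniformity =
  (INF e\<in>{0 <..}. principal {(z :: 'a complexification, w). dist z w < e})"
definition "open U \<longleftrightarrow> (\<forall>z\<in>U. \<forall>\<^sub>F (z', w) in uniformity. z' = z \<longrightarrow> w \<in> U)"
  for U :: "'a complexification set"

instance
proof
  fix r :: real and z w :: "'a complexification"
  show "norm (r *\<^sub>R z) = \<bar>r\<bar> * norm z"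
    using cpl_norm_scale[of "of_real r" z]
    by (simp add: norm_complexification_def cpl_scale_of_real)
qed (simp_all add: norm_complexification_def dist_complexification_def sgn_complexification_def
      uniformity_complexification_def open_complexification_def cpl_norm_eq_0 cpl_norm_triangle)

end

instance complexification :: (banach) banach
proof
  fix X :: "nat \<Rightarrow> 'a complexification"
  assume X: "Cauchy X"
  have le: "dist (cRe z) (cRe w) \<le> dist z w" "dist (cIm z) (cIm w) \<le> dist z w"
    for z w :: "'a complexification"
    using norm_cRe_le[of "z - w"] norm_cIm_le[of "z - w"]
    by (simp_all add: dist_norm norm_complexification_def)
  have "Cauchy (\<lambda>n. cRe (X n))" "Cauchy (\<lambda>n. cIm (X n))"
    using X le unfolding Cauchy_def by (meson le_less_trans)+
  then obtain a b where ab: "(\<lambda>n. cRe (X n)) \<longlonglongrightarrow> a" "(\<lambda>n. cIm (X n)) \<longlonglongrightarrow> b"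
    by (meson Cauchy_convergent convergent_def)
  have "X \<longlonglongrightarrow> Cpl a b"
  proof (rule Lim_transform_bound[THEN LIM_zero_cancel])
    show "\<forall>\<^sub>F n in sequentially. norm (X n - Cpl a b) \<le> norm (norm (cRe (X n) - a) + norm (cIm (X n) - b))"
      using cpl_norm_le_parts[of "X n - Cpl a b" for n]
      by (simp add: norm_complexification_def)
    show "(\<lambda>n. norm (cRe (X n) - a) + norm (cIm (X n) - b)) \<longlonglongrightarrow> 0"
      using tendsto_add[OF tendsto_norm_zero[OF LIM_zero[OF ab(1)]] tendsto_norm_zero[OF LIM_zero[OF ab(2)]]]
      by simp
  qed
  then show "convergent X" by (auto simp: convergent_def)
qed

instance complexification :: (real_normed_algebra_1) real_normed_algebra_1
proof
  fix z w :: "'a complexification"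
  show "norm (z * w) \<le> norm z * norm w"
    by (simp add: norm_complexification_def cpl_norm_mult)
  have "(1 :: 'a complexification) = complexify 1"
    by (simp add: complexification_eq_iff)
  then show "norm (1 :: 'a complexification) = 1"
    using cpl_norm_complexify[of "1 :: 'a"] by (simp add: norm_complexification_def)
qed

instantiation complexification :: ("{real_normed_algebra_1, banach}") complex_banach_algebra_1
begin

definition "scaleC = (cpl_scale :: complex \<Rightarrow> 'a complexification \<Rightarrow> 'a complexification)"

instance
  by intro_classes
    (simp_all add: scaleC_complexification_def norm_complexification_def cpl_norm_scale
      cpl_scale_of_real,
     simp_all add: complexification_eq_iff algebra_simps)

end

section \<open>Spectrum and logarithm\<close>

definition is_inverse :: "'a::monoid_mult \<Rightarrow> 'a \<Rightarrow> bool"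
  where "is_inverse x y \<longleftrightarrow> x * y = 1 \<and> y * x = 1"

definition alg_inverse :: "'a::monoid_mult \<Rightarrow> 'a"
  where "alg_inverse x = (THE y. is_inverse x y)"

definition spectrum :: "'a::complex_banach_algebra_1 \<Rightarrow> complex set"
  where "spectrum A = {z. \<nexists>B. is_inverse (A - z *\<^sub>C 1) B}"

definition log_exists :: "'a::complex_banach_algebra_1 \<Rightarrow> bool"
  where "log_exists A \<longleftrightarrow> spectrum A \<inter> \<real>\<^sub>\<le>\<^sub>0 = {}"

text \<open>Only real scalars occur here, so for real algebras there is no need to complexify.\<close>

definition alg_log :: "'a::{real_normed_algebra_1, banach} \<Rightarrow> 'a"
  where "alg_log A =
    integral {0..1} (\<lambda>l. (A - 1) * alg_inverse (l *\<^sub>R 1 + (1 - l) *\<^sub>R A))"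

section \<open>Interval measures and ordered integrals\<close>

definition subintervals :: "real set \<Rightarrow> real set set"
  where "subintervals I = {J. is_interval J \<and> J \<subseteq> I}"

text \<open>Since the empty set is an interval, \<open>\<phi> {} = 0\<close> and finite additivity are implied.\<close>

definition is_interval_measure :: "real set \<Rightarrow> (real set \<Rightarrow> 'a::real_normed_vector) \<Rightarrow> bool"
  where "is_interval_measure I \<phi> \<longleftrightarrow>
    (\<forall>J :: nat \<Rightarrow> real set. range J \<subseteq> subintervals I \<and> disjoint_family J
        \<and> is_interval (\<Union>n. J n)
      \<longrightarrow> (\<lambda>n. \<phi> (J n)) sums \<phi> (\<Union>n. J n))"

definition continuous_measure :: "real set \<Rightarrow> (real set \<Rightarrow> 'a::zero) \<Rightarrow> bool"
  where "continuous_measure I \<phi> \<longleftrightarrow> (\<forall>x\<in>I. \<phi> {x} = 0)"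

definition variation :: "real set \<Rightarrow> (real set \<Rightarrow> 'a::real_normed_vector) \<Rightarrow> ennreal"
  where "variation I \<phi> =
    (SUP F \<in> {F. finite F \<and> F \<subseteq> subintervals I \<and> disjoint F}. \<Sum>J\<in>F. ennreal (norm (\<phi> J)))"

text \<open>Finite partitions of \<open>I\<close> into intervals, directed by refinement.\<close>

definition interval_partitions :: "real set \<Rightarrow> real set set set"
  where "interval_partitions I = {P. finite P \<and> partition_on I P \<and> P \<subseteq> subintervals I}"

definition refinement_filter :: "real set \<Rightarrow> real set set filter"
  where "refinement_filter I =
    (INF P \<in> interval_partitions I. principal {Q \<in> interval_partitions I. refines I Q P})"

text \<open>
  For members \<open>J\<close>, \<open>K\<close> of an interval partition this says that \<open>J = K\<close> or that \<open>J\<close> lies to the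
  left of \<open>K\<close>.
\<close>

definition interval_le :: "real set \<Rightarrow> real set \<Rightarrow> bool"
  where "interval_le J K \<longleftrightarrow> (\<exists>s\<in>J. \<exists>t\<in>K. s \<le> t)"

text \<open>
  The integral of \<open>F (\<phi>(t\<^sub>1), \<dots>, \<phi>(t\<^sub>k))\<close> over \<open>t\<^sub>1 \<le> \<dots> \<le> t\<^sub>k\<close> in \<open>I\<close>, for a \<open>k\<close>-linear \<open>F\<close> (whose
  arguments are given as a list of length \<open>k\<close>): the limit along refinement of the sums over those
  boxes \<open>J\<^sub>1 \<times> \<dots> \<times> J\<^sub>k\<close> of a partition that meet the simplex. For \<open>\<phi>\<close> of finite variation the limit
  exists: degenerate intervals may be split off, so that an atom at \<open>x\<close> eventually contributes
  through \<open>{x}\<close> only, and the total variation over the remaining diagonal boxes tends to 0.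
\<close>

definition ordered_sum ::
    "('a::comm_monoid_add list \<Rightarrow> 'a) \<Rightarrow> nat \<Rightarrow> (real set \<Rightarrow> 'a) \<Rightarrow> real set set \<Rightarrow> 'a"
  where "ordered_sum F k \<phi> P =
    (\<Sum>Js | set Js \<subseteq> P \<and> length Js = k \<and> sorted_wrt interval_le Js. F (map \<phi> Js))"

definition ordered_integral ::
    "real set \<Rightarrow> ('a::{comm_monoid_add, t2_space} list \<Rightarrow> 'a) \<Rightarrow> nat \<Rightarrow> (real set \<Rightarrow> 'a) \<Rightarrow> 'a"
  where "ordered_integral I F k \<phi> = Lim (refinement_filter I) (ordered_sum F k \<phi>)"

definition exp_R :: "real set \<Rightarrow> (real set \<Rightarrow> 'a::{real_normed_algebra_1, banach}) \<Rightarrow> 'a"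
  where "exp_R I \<phi> = 1 + (\<Sum>k. ordered_integral I prod_list (Suc k) \<phi>)"

definition M_controlled :: "real set \<Rightarrow> (real set \<Rightarrow> 'a::complex_banach_algebra_1) \<Rightarrow> bool"
  where "M_controlled I \<phi> \<longleftrightarrow>
    (\<forall>t::complex. cmod t \<le> 1 \<longrightarrow> log_exists (exp_R I (\<lambda>J. t *\<^sub>C \<phi> J)))"

section \<open>Magnus polynomials\<close>

text \<open>Permutations act on \<open>{0, \<dots>, k - 1}\<close>; the variables are the entries of a list of length \<open>k\<close>.\<close>

definition asc :: "nat \<Rightarrow> (nat \<Rightarrow> nat) \<Rightarrow> nat"
  where "asc k \<sigma> = card {i. Suc i < k \<and> \<sigma> i < \<sigma> (Suc i)}"

definition des :: "nat \<Rightarrow> (nat \<Rightarrow> nat) \<Rightarrow> nat"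
  where "des k \<sigma> = card {i. Suc i < k \<and> \<sigma> i > \<sigma> (Suc i)}"

definition perm_prod :: "'a::monoid_mult list \<Rightarrow> (nat \<Rightarrow> nat) \<Rightarrow> 'a"
  where "perm_prod Xs \<sigma> = prod_list (map (\<lambda>i. Xs ! \<sigma> i) [0..<length Xs])"

definition mu_lam :: "real \<Rightarrow> 'a::real_algebra_1 list \<Rightarrow> 'a"
  where "mu_lam l Xs = (let k = length Xs in
    \<Sum>\<sigma> | \<sigma> permutes {..<k}. (l ^ asc k \<sigma> * (l - 1) ^ des k \<sigma>) *\<^sub>R perm_prod Xs \<sigma>)"

definition mu :: "'a::real_algebra_1 list \<Rightarrow> 'a"
  where "mu Xs = (let k = length Xs in
    \<Sum>\<sigma> | \<sigma> permutes {..<k}.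
      ((-1) ^ des k \<sigma> * (fact (asc k \<sigma>) * fact (des k \<sigma>) / fact k)) *\<^sub>R perm_prod Xs \<sigma>)"

definition mu_lam_R ::
    "real \<Rightarrow> nat \<Rightarrow> real set \<Rightarrow> (real set \<Rightarrow> 'a::{real_normed_algebra_1, banach}) \<Rightarrow> 'a"
  where "mu_lam_R l k I \<phi> = ordered_integral I (mu_lam l) k \<phi>"

definition mu_R :: "nat \<Rightarrow> real set \<Rightarrow> (real set \<Rightarrow> 'a::{real_normed_algebra_1, banach}) \<Rightarrow> 'a"
  where "mu_R k I \<phi> = ordered_integral I mu k \<phi>"

end

(*
For a partition P of I into blocks J_1 < ... < J_n put E = prod (1 + t phi(J_i)) - 1, the generating
function of strictly increasing words in the blocks. In E (1 + (1 - l) E)^{-1} = sum_j (l - 1)^{j-1} E^j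
a word arises once for every way of cutting it into nonempty increasing factors: each non-ascent must
be cut, each ascent may be, so its coefficient is l^asc (l - 1)^nonasc. For words without repeated
letters this is the weight in mu^(l). As phi is continuous, the words with a repeated letter (and
those with two letters in one block of a coarser partition) contribute nothing in the limit.
Hence the mu^(l)_{k,R}(phi) are the Taylor coefficients of (A(t) - 1) (l + (1 - l) A(t))^{-1} with
A(t) = exp_R(t phi) entire. If phi is M-controlled, then by compactness this function is holomorphic
on a disc of radius > 1 for all l in [0, 1] at once, and Cauchy's estimates give a geometric bound on
the coefficients that is uniform in l. One may thus set t = 1 and integrate over l termwise, where
the beta integral turns mu^(l) into mu. Real algebras are reduced to their complexification.
*)

theory Submission
  imports Defs
begin

section \<open>Sums over words\<close>


text \<open>The obstacle is a mismatch of radii. Counting words bounds the k-th coefficient by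
  \<open>V ^ k\<close>, hence gives a power series only for small t, while the control hypothesis
  speaks of the closed unit disc. The coefficients are therefore read off on a small circle and
  estimated on one of radius > 1. For the passage between circles put t = exp z: circles become
  vertical segments of length 2 pi, and periodicity makes the mean over such a segment independent
  of the radius. The generating function M enters as M (1 + (1 - l) E) = E. Compared degree by
  degree this is a finite recursion, \<open>magnus_coeff\<close>, through which limits over
  partitions, scaling by t and complexification pass without any question of convergence. The limits
  are uniform in l, so the beta integral can be applied on each partition before the limit is taken.
  All errors come from words in which two letters fall into one class. One count, of order k^2
  \<epsilon> V^k, covers repeated blocks and blocks inside one coarser block alike.\<close>

definition words :: "nat \<Rightarrow> 'b set \<Rightarrow> 'b list set"
  where "words k S = {w. set w \<subseteq> S \<and> length w = k}"

text \<open>The homogeneous noncommutative polynomial with coefficients \<open>g\<close>, evaluated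
  at \<open>f\<close>. Only \<open>g\<close> changes between iterated integrals, Magnus sums and
  pullbacks along a refinement.\<close>

definition word_sum :: "('b list \<Rightarrow> real) \<Rightarrow> nat \<Rightarrow> ('b \<Rightarrow> 'a::real_algebra_1) \<Rightarrow> 'b set \<Rightarrow> 'a"
  where "word_sum g k f S = (\<Sum>w\<in>words k S. g w *\<^sub>R prod_list (map f w))"

lemma finite_words [simp]: "finite S \<Longrightarrow> finite (words k S)"
  unfolding words_def by (rule finite_lists_length_eq)

lemma words_0 [simp]: "words 0 S = {[]}"
  by (auto simp: words_def)

lemma sum_words_Suc:
  "(\<Sum>w\<in>words (Suc k) S. h w) = (\<Sum>x\<in>S. \<Sum>w\<in>words k S. h (x # w))"
proof -
  have "(\<Sum>x\<in>S. \<Sum>w\<in>words k S. h (x # w)) = (\<Sum>(x, w)\<in>S \<times> words k S. h (x # w))"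
    by (rule sum.cartesian_product)
  also have "\<dots> = (\<Sum>w\<in>words (Suc k) S. h w)"
    by (rule sum.reindex_bij_witness[where i = "\<lambda>w. (hd w, tl w)" and j = "\<lambda>(x, w). x # w"])
      (auto simp: words_def length_Suc_conv)
  finally show ?thesis by simp
qed

lemma sum_words_append:
  "(\<Sum>w\<in>words (m + n) S. h (take m w) (drop m w)) = (\<Sum>u\<in>words m S. \<Sum>v\<in>words n S. h u v)"
proof -
  have "(\<Sum>u\<in>words m S. \<Sum>v\<in>words n S. h u v) = (\<Sum>(u, v)\<in>words m S \<times> words n S. h u v)"
    by (rule sum.cartesian_product)
  also have "\<dots> = (\<Sum>w\<in>words (m + n) S. h (take m w) (drop m w))"
    by (rule sum.reindex_bij_witness[where i = "\<lambda>w. (take m w, drop m w)" and j = "\<lambda>(u, v). u @ v"])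
      (auto simp: words_def dest: in_set_takeD in_set_dropD)
  finally show ?thesis by simp
qed

lemma sum_words_prod_list:
  fixes u :: "'b \<Rightarrow> real"
  shows "(\<Sum>w\<in>words k S. prod_list (map u w)) = sum u S ^ k"
  by (induction k) (simp_all add: sum_words_Suc flip: sum_distrib_left sum_distrib_right)

lemma prod_list_map_nonneg:
  fixes u :: "'b \<Rightarrow> real"
  shows "(\<And>x. 0 \<le> u x) \<Longrightarrow> 0 \<le> prod_list (map u w)"
  by (induction w) auto

lemma norm_prod_list_map_le:
  fixes f :: "'b \<Rightarrow> 'a::real_normed_algebra_1"
  shows "norm (prod_list (map f w)) \<le> prod_list (map (\<lambda>x. norm (f x)) w)"
proof (induction w)
  case (Cons x w)
  then show ?case
    using mult_left_mono[OF Cons.IH norm_ge_zero[of "f x"]]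
      norm_mult_ineq[of "f x" "prod_list (map f w)"] by simp
qed simp

lemma sum_filter_of_bool:
  fixes h :: "'b \<Rightarrow> 'a::semiring_1"
  assumes "finite A"
  shows "sum h {x \<in> A. R x} = (\<Sum>x\<in>A. of_bool (R x) * h x)"
  using sum.inter_filter[OF assms, of h R] by (simp add: of_bool_def if_distrib[of "\<lambda>x. x * _"] cong: if_cong)

text \<open>\<open>\<pi>\<close> will be either the identity, for repeated letters, or the map from
  a block to the coarser block around it. \<open>1 \<le> V\<close> pads short words to a common
  power of \<open>V\<close>.\<close>

context
  fixes S :: "'b set" and u :: "'b \<Rightarrow> real" and \<pi> :: "'b \<Rightarrow> 'c" and V \<epsilon> :: real
  assumes S: "finite S" and u: "\<And>x. 0 \<le> u x" and V: "sum u S \<le> V" "1 \<le> V"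
    and cls: "\<And>x. x \<in> S \<Longrightarrow> sum u {y \<in> S. \<pi> y = \<pi> x} \<le> \<epsilon>" and \<epsilon>: "0 \<le> \<epsilon>"
begin

text \<open>Union bound over the k positions at which the class of \<open>x\<close> can occur: each
  costs a factor \<open>\<epsilon>\<close> in place of a factor \<open>V\<close>.\<close>

lemma sum_hitting_words_le:
  assumes x: "x \<in> S"
  shows "(\<Sum>w\<in>{w\<in>words k S. \<pi> x \<in> \<pi> ` set w}. prod_list (map u w)) \<le> k * \<epsilon> * V ^ k"
proof (induction k)
  case (Suc k)
  let ?B = "\<lambda>k. \<Sum>w\<in>words k S. of_bool (\<pi> x \<in> \<pi> ` set w) * prod_list (map u w)"
  have B: "?B k \<le> k * \<epsilon> * V ^ k"
    using Suc S by (simp add: sum_filter_of_bool)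
  have Vk: "sum u S ^ k \<le> V ^ k" using V u by (intro power_mono) (auto intro: sum_nonneg)
  have "?B (Suc k) = (\<Sum>y\<in>S. \<Sum>w\<in>words k S. of_bool (\<pi> x \<in> \<pi> ` set (y # w)) * (u y * prod_list (map u w)))"
    by (simp add: sum_words_Suc)
  also have "\<dots> \<le> (\<Sum>y\<in>S. \<Sum>w\<in>words k S. (of_bool (\<pi> y = \<pi> x) * u y) * prod_list (map u w)
      + u y * (of_bool (\<pi> x \<in> \<pi> ` set w) * prod_list (map u w)))"
    by (intro sum_mono) (auto simp: u prod_list_map_nonneg of_bool_def)
  also have "\<dots> = (\<Sum>y\<in>S. of_bool (\<pi> y = \<pi> x) * u y) * sum u S ^ k + sum u S * ?B k"
    by (simp add: sum.distrib flip: sum_distrib_left sum_distrib_right sum_words_prod_list)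
  also have "(\<Sum>y\<in>S. of_bool (\<pi> y = \<pi> x) * u y) = sum u {y \<in> S. \<pi> y = \<pi> x}"
    using S by (simp add: sum_filter_of_bool)
  also have "\<dots> * sum u S ^ k + sum u S * ?B k \<le> \<epsilon> * V ^ k + V * (k * \<epsilon> * V ^ k)"
    by (intro add_mono mult_mono Vk B cls x V \<epsilon>)
      (use V u in \<open>auto intro!: sum_nonneg mult_nonneg_nonneg prod_list_map_nonneg zero_le_power\<close>)
  \<comment> \<open>\<open>1 \<le> V\<close> supplies the factor \<open>V\<close> that the letter in
    the class of \<open>x\<close> did not spend.\<close>
  also have "\<dots> \<le> V * (\<epsilon> * V ^ k) + V * (k * \<epsilon> * V ^ k)"
    using mult_right_mono[OF V(2), of "\<epsilon> * V ^ k"] V \<epsilon> by simp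
  also have "\<dots> = Suc k * \<epsilon> * V ^ Suc k" by (simp add: algebra_simps)
  finally show ?case
    using S by (simp add: sum_filter_of_bool)
qed simp

text \<open>Either the first letter meets the class of a later one, which is the previous bound, or
  the collision lies in the tail. The count closes by k + k^2 \<le> (k + 1)^2.\<close>

lemma sum_colliding_words_le:
  "(\<Sum>w\<in>{w\<in>words k S. \<not> distinct (map \<pi> w)}. prod_list (map u w)) \<le> k^2 * \<epsilon> * V ^ k"
proof (induction k)
  case (Suc k)
  let ?H = "\<lambda>x. \<Sum>w\<in>words k S. of_bool (\<pi> x \<in> \<pi> ` set w) * prod_list (map u w)"
  let ?B = "\<lambda>k. \<Sum>w\<in>words k S. of_bool (\<not> distinct (map \<pi> w)) * prod_list (map u w)"
  have B: "?B k \<le> k^2 * \<epsilon> * V ^ k"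
    using Suc S by (simp add: sum_filter_of_bool)
  have H: "?H x \<le> k * \<epsilon> * V ^ k" if "x \<in> S" for x
    using sum_hitting_words_le[OF that, of k] S
    by (simp add: sum_filter_of_bool)
  have "?B (Suc k) = (\<Sum>y\<in>S. \<Sum>w\<in>words k S. of_bool (\<not> distinct (map \<pi> (y # w))) * (u y * prod_list (map u w)))"
    by (simp add: sum_words_Suc)
  also have "\<dots> \<le> (\<Sum>y\<in>S. \<Sum>w\<in>words k S. u y * (of_bool (\<pi> y \<in> \<pi> ` set w) * prod_list (map u w))
      + u y * (of_bool (\<not> distinct (map \<pi> w)) * prod_list (map u w)))"
    by (intro sum_mono) (auto simp: u prod_list_map_nonneg of_bool_def)
  also have "\<dots> = (\<Sum>y\<in>S. u y * (?H y + ?B k))"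
    by (simp add: sum.distrib distrib_left flip: sum_distrib_left)
  also have "\<dots> \<le> (\<Sum>y\<in>S. u y * (k * \<epsilon> * V ^ k + k^2 * \<epsilon> * V ^ k))"
    by (intro sum_mono mult_left_mono add_mono H B u)
  also have "\<dots> = sum u S * (k * \<epsilon> * V ^ k + k^2 * \<epsilon> * V ^ k)"
    by (simp flip: sum_distrib_right)
  also have "\<dots> \<le> V * (k * \<epsilon> * V ^ k + k^2 * \<epsilon> * V ^ k)"
    using V \<epsilon> by (intro mult_right_mono) auto
  also have "\<dots> = (k + k^2) * (\<epsilon> * V ^ Suc k)" by (simp add: algebra_simps)
  also have "\<dots> \<le> (Suc k)^2 * (\<epsilon> * V ^ Suc k)"
    using V \<epsilon> by (intro mult_right_mono) (auto simp: power2_eq_square algebra_simps)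
  finally show ?case
    using S by (simp add: sum_filter_of_bool)
qed simp

end

text \<open>Multilinear expansion: each coarse letter is the sum of the fine letters over it, and a
  fine word inherits the coefficient of its image. The induction needs \<open>g\<close> arbitrary,
  as peeling off \<open>J\<close> replaces \<open>g\<close> by its shift.\<close>

lemma word_sum_refine:
  assumes "finite Q" "finite P" "\<And>K. K \<in> Q \<Longrightarrow> \<pi> K \<in> P"
    and f: "\<And>J. J \<in> P \<Longrightarrow> f J = (\<Sum>K | K \<in> Q \<and> \<pi> K = J. f K)"
  shows "word_sum g k f P = word_sum (\<lambda>w. g (map \<pi> w)) k f Q"
  unfolding word_sum_def
proof (induction k arbitrary: g)
  case (Suc k)
  have "(\<Sum>w\<in>words (Suc k) P. g w *\<^sub>R prod_list (map f w))
      = (\<Sum>J\<in>P. f J * (\<Sum>w\<in>words k P. g (J # w) *\<^sub>R prod_list (map f w)))"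
    by (simp add: sum_words_Suc sum_distrib_left)
  also have "\<dots> = (\<Sum>J\<in>P. (\<Sum>K | K \<in> Q \<and> \<pi> K = J. f K) *
      (\<Sum>w\<in>words k Q. g (J # map \<pi> w) *\<^sub>R prod_list (map f w)))"
    using Suc by (intro sum.cong) (simp_all add: f)
  also have "\<dots> = (\<Sum>J\<in>P. \<Sum>K | K \<in> Q \<and> \<pi> K = J.
      f K * (\<Sum>w\<in>words k Q. g (\<pi> K # map \<pi> w) *\<^sub>R prod_list (map f w)))"
    by (intro sum.cong) (simp_all add: sum_distrib_right)
  also have "\<dots> = (\<Sum>K\<in>Q. f K * (\<Sum>w\<in>words k Q. g (\<pi> K # map \<pi> w) *\<^sub>R prod_list (map f w)))"
    by (rule sum.group) (use assms in auto)
  finally show ?case by (simp add: sum_words_Suc sum_distrib_left)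
qed simp

section \<open>Descent weights and permutations\<close>


definition ascending :: "('b \<Rightarrow> real) \<Rightarrow> 'b list \<Rightarrow> bool"
  where "ascending p = sorted_wrt (\<lambda>x y. p x < p y)"

text \<open>Equal neighbours count as a descent, that is, as a forced cut; without repetitions this
  is the weight in \<open>mu_lam\<close>.\<close>

fun descent_weight :: "('b \<Rightarrow> real) \<Rightarrow> real \<Rightarrow> 'b list \<Rightarrow> real" where
  "descent_weight p l (x # y # w) = (if p x < p y then l else l - 1) * descent_weight p l (y # w)"
| "descent_weight p l w = 1"

lemma abs_descent_weight_le: "l \<in> {0..1} \<Longrightarrow> \<bar>descent_weight p l w\<bar> \<le> 1"
proof (induction p l w rule: descent_weight.induct)
  case (1 p l x y w)
  then have "\<bar>if p x < p y then l else l - 1\<bar> * \<bar>descent_weight p l (y # w)\<bar> \<le> 1 * 1"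
    by (intro mult_mono) auto
  then show ?case by (simp add: abs_mult)
qed auto

lemma ascending_Cons2: "ascending p (x # y # w) \<longleftrightarrow> p x < p y \<and> ascending p (y # w)"
  by (auto simp: ascending_def)

lemma ascending_imp_distinct: "ascending p w \<Longrightarrow> distinct w"
  by (induction w) (auto simp: ascending_def)

text \<open>
  With \<open>E\<close> the generating series of ascending words, cutting a word into nonempty ascending
  factors shows that \<open>E (1 + (1 - l) E)\<^sup>-\<^sup>1\<close> is the generating series of all words with weight
  \<^const>\<open>descent_weight\<close>.
\<close>

lemma descent_weight_cut:
  assumes "w \<noteq> []"
  shows "descent_weight p l w
      + (1 - l) * (\<Sum>i\<in>{1..<length w}. descent_weight p l (take i w) * of_bool (ascending p (drop i w)))
    = of_bool (ascending p w)"
  using assms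
proof (induction p l w rule: descent_weight.induct)
  case (1 p l x y w)
  let ?c = "if p x < p y then l else l - 1"
  let ?T = "\<lambda>v i. descent_weight p l (take i v) * of_bool (ascending p (drop i v))"
  have take: "descent_weight p l (x # take i (y # w)) = ?c * descent_weight p l (take i (y # w))"
    if "1 \<le> i" for i
    using that by (cases i) auto
  have "(\<Sum>i\<in>{1..<length (x # y # w)}. ?T (x # y # w) i)
      = (\<Sum>i\<in>{0..<length (y # w)}. ?T (x # y # w) (Suc i))"
    unfolding One_nat_def length_Cons[of x] by (rule sum.shift_bounds_Suc_ivl)
  \<comment> \<open>The term split off is the cut right after \<open>x\<close>: a single letter has
    weight 1, and no factor for the pair \<open>x\<close>, \<open>y\<close> arises.\<close>
  also have "\<dots> = of_bool (ascending p (y # w)) + (\<Sum>i\<in>{1..<length (y # w)}. ?T (x # y # w) (Suc i))"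
    by (subst sum.atLeast_Suc_lessThan) auto
  also have "(\<Sum>i\<in>{1..<length (y # w)}. ?T (x # y # w) (Suc i)) = ?c * (\<Sum>i\<in>{1..<length (y # w)}. ?T (y # w) i)"
    unfolding sum_distrib_left by (intro sum.cong refl) (simp add: take mult.assoc)
  finally have "descent_weight p l (x # y # w) + (1 - l) * (\<Sum>i\<in>{1..<length (x # y # w)}. ?T (x # y # w) i)
      = ?c * (descent_weight p l (y # w) + (1 - l) * (\<Sum>i\<in>{1..<length (y # w)}. ?T (y # w) i))
        + (1 - l) * of_bool (ascending p (y # w))"
    by (simp add: algebra_simps)
  \<comment> \<open>If \<open>p x < p y\<close>, the coefficients l and 1 - l add up to 1; otherwise
    l - 1 and 1 - l cancel.\<close>
  then show ?case using 1 by (simp add: ascending_Cons2)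
qed (auto simp: ascending_def)

abbreviation inc_sum :: "('b \<Rightarrow> real) \<Rightarrow> nat \<Rightarrow> ('b \<Rightarrow> 'a::real_algebra_1) \<Rightarrow> 'b set \<Rightarrow> 'a"
  where "inc_sum p \<equiv> word_sum (\<lambda>w. of_bool (ascending p w))"

text \<open>The cutting identity summed over all words of length n: a cut at i turns a word into a
  pair, hence the sum into a product. It is the degree n part of M + (1 - l) M E = E, with the last
  ascending factor split off.\<close>

lemma word_sum_descent_weight:
  assumes "finite S" "1 \<le> n"
  shows "word_sum (descent_weight p l) n f S
    = inc_sum p n f S
      - (1 - l) *\<^sub>R (\<Sum>i\<in>{1..<n}. word_sum (descent_weight p l) i f S * inc_sum p (n - i) f S)"
proof -
  let ?D = "descent_weight p l" and ?I = "\<lambda>w. of_bool (ascending p w)"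
  have prod: "word_sum ?D i f S * inc_sum p (n - i) f S
      = (\<Sum>w\<in>words n S. (?D (take i w) * ?I (drop i w)) *\<^sub>R prod_list (map f w))"
    if i: "i \<in> {1..<n}" for i
  proof -
    have "word_sum ?D i f S * inc_sum p (n - i) f S
        = (\<Sum>u\<in>words i S. \<Sum>v\<in>words (n - i) S. (?D u * ?I v) *\<^sub>R (prod_list (map f u) * prod_list (map f v)))"
      by (simp add: word_sum_def sum_product mult.commute)
    also have "\<dots> = (\<Sum>w\<in>words (i + (n - i)) S. (?D (take i w) * ?I (drop i w)) *\<^sub>R
        (prod_list (map f (take i w)) * prod_list (map f (drop i w))))"
      by (rule sum_words_append[symmetric,
            where h = "\<lambda>u v. (?D u * ?I v) *\<^sub>R (prod_list (map f u) * prod_list (map f v))"])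
    also have "\<dots> = (\<Sum>w\<in>words n S. (?D (take i w) * ?I (drop i w)) *\<^sub>R prod_list (map f w))"
      using i by (simp flip: prod_list.append map_append)
    finally show ?thesis .
  qed
  have "word_sum ?D n f S + (1 - l) *\<^sub>R (\<Sum>i\<in>{1..<n}. word_sum ?D i f S * inc_sum p (n - i) f S)
      = (\<Sum>w\<in>words n S. ?D w *\<^sub>R prod_list (map f w))
        + (1 - l) *\<^sub>R (\<Sum>i\<in>{1..<n}. \<Sum>w\<in>words n S. (?D (take i w) * ?I (drop i w)) *\<^sub>R prod_list (map f w))"
    by (subst sum.cong[OF refl prod]) (simp_all add: word_sum_def)
  also have "\<dots> = (\<Sum>w\<in>words n S. (?D w + (1 - l) * (\<Sum>i\<in>{1..<n}. ?D (take i w) * ?I (drop i w))) *\<^sub>R prod_list (map f w))"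
    by (subst sum.swap) (simp add: sum.distrib scaleR_left.add scaleR_sum_right scaleR_sum_left sum_distrib_left
        del: sum_mult_of_bool_eq sum_of_bool_mult_eq)
  also have "\<dots> = inc_sum p n f S"
    unfolding word_sum_def
  proof (intro sum.cong refl arg_cong2[where f = scaleR])
    fix w assume "w \<in> words n S"
    then have "length w = n" "w \<noteq> []" using assms by (auto simp: words_def)
    then show "?D w + (1 - l) * (\<Sum>i\<in>{1..<n}. ?D (take i w) * ?I (drop i w)) = ?I w"
      using descent_weight_cut[of w p l] by simp
  qed
  finally show ?thesis by (simp add: algebra_simps)
qed

text \<open>Sorting by \<open>p\<close> recovers the ascending word, and the permutation is then
  determined because the letters are distinct.\<close>

lemma bij_betw_permute_ascending:
  assumes p: "inj_on p S"
  shows "bij_betw (\<lambda>(v, \<sigma>). permute_list \<sigma> v)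
    ({v \<in> words k S. ascending p v} \<times> {\<sigma>. \<sigma> permutes {..<k}}) {w \<in> words k S. distinct w}"
    (is "bij_betw ?h (?A \<times> ?B) ?C")
proof (intro bij_betw_imageI inj_onI)
  fix a b assume "a \<in> ?A \<times> ?B" "b \<in> ?A \<times> ?B" and eq: "?h a = ?h b"
  then obtain v \<sigma> w \<tau> where a: "a = (v, \<sigma>)" "b = (w, \<tau>)" and v: "v \<in> ?A" "w \<in> ?A"
    and s: "\<sigma> permutes {..<k}" "\<tau> permutes {..<k}" by auto
  have len: "length v = k" "length w = k" and d: "distinct v"
    using v ascending_imp_distinct by (auto simp: words_def)
  have eq': "permute_list \<sigma> v = permute_list \<tau> w" using eq a by simp
  have "mset v = mset w"
    using eq' s len by (metis mset_permute_list)
  moreover have "sorted (map p v)" "sorted (map p w)"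
    using v by (auto simp: ascending_def sorted_map intro: sorted_wrt_mono_rel[rotated])
  moreover have "inj_on p (set v)" using v p by (auto simp: words_def intro: inj_on_subset)
  ultimately have vw: "v = w"
    by (metis properties_for_sort_key sort_key_inj_key_eq)
  have "\<sigma> i = \<tau> i" for i
  proof (cases "i < k")
    case True
    then have "\<sigma> i < k" "\<tau> i < k" using s permutes_in_image by fastforce+
    moreover have "v ! \<sigma> i = v ! \<tau> i"
      using arg_cong[OF eq', of "\<lambda>x. x ! i"] True len vw s by (simp add: permute_list_nth)
    ultimately show ?thesis using d len by (simp add: nth_eq_iff_index_eq)
  next
    case False
    then show ?thesis using s by (simp add: permutes_not_in)
  qed
  then show "a = b" using a vw by auto
next
  show "?h ` (?A \<times> ?B) = ?C"
  proof (intro equalityI subsetI)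
    fix w assume "w \<in> ?h ` (?A \<times> ?B)"
    then show "w \<in> ?C"
      by (auto simp: words_def intro: ascending_imp_distinct)
  next
    fix w assume w: "w \<in> ?C"
    define v where "v = sort_key p w"
    have "sorted (map p v)" "mset v = mset w" by (simp_all add: v_def)
    moreover have "distinct (map p v)"
      using w p by (auto simp: v_def words_def distinct_map intro: inj_on_subset)
    ultimately have "sorted_wrt (<) (map p v)" by (simp only: strict_sorted_iff)
    then have "ascending p v" by (simp add: ascending_def sorted_wrt_map)
    moreover have "v \<in> words k S"
      using w \<open>mset v = mset w\<close> by (simp add: words_def v_def)
    moreover obtain \<sigma> where "\<sigma> permutes {..<length v}" "permute_list \<sigma> v = w"
      using mset_eq_permutation[OF \<open>mset v = mset w\<close>[symmetric]] by blast
    ultimately show "w \<in> ?h ` (?A \<times> ?B)"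
      by (intro image_eqI[of _ _ "(v, \<sigma>)"]) (auto simp: words_def)
  qed
qed

lemma sum_distinct_words:
  assumes "inj_on p S"
  shows "(\<Sum>w\<in>{w \<in> words k S. distinct w}. h w)
    = (\<Sum>v\<in>{v \<in> words k S. ascending p v}. \<Sum>\<sigma> | \<sigma> permutes {..<k}. h (permute_list \<sigma> v))"
  using sum.reindex_bij_betw[OF bij_betw_permute_ascending[OF assms, of k], of h]
  by (simp add: sum.cartesian_product case_prod_unfold)

lemma prod_list_permute:
  fixes u :: "'b \<Rightarrow> real"
  assumes "\<sigma> permutes {..<length v}"
  shows "prod_list (map u (permute_list \<sigma> v)) = prod_list (map u v)"
  using assms by (metis mset_map mset_permute_list prod_mset_prod_list)

text \<open>Each ascending word has k! rearrangements of equal weight, all of them different words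
  over \<open>S\<close>. This is the source of the factor 1 / k! that makes the exponential entire
  in t.\<close>

lemma fact_sum_ascending_le:
  fixes u :: "'b \<Rightarrow> real"
  assumes S: "finite S" and "inj_on p S" "\<And>x. 0 \<le> u x"
  shows "fact k * (\<Sum>v\<in>{v \<in> words k S. ascending p v}. prod_list (map u v)) \<le> sum u S ^ k"
proof -
  have "(\<Sum>v\<in>{v \<in> words k S. ascending p v}. \<Sum>\<sigma> | \<sigma> permutes {..<k}. prod_list (map u (permute_list \<sigma> v)))
      = (\<Sum>v\<in>{v \<in> words k S. ascending p v}. fact k * prod_list (map u v))"
    by (intro sum.cong) (auto simp: words_def prod_list_permute card_permutations)
  then have "fact k * (\<Sum>v\<in>{v \<in> words k S. ascending p v}. prod_list (map u v))
      = (\<Sum>w\<in>{w \<in> words k S. distinct w}. prod_list (map u w))"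
    by (simp add: sum_distinct_words[OF assms(2)] sum_distrib_left)
  also have "\<dots> \<le> (\<Sum>w\<in>words k S. prod_list (map u w))"
    by (intro sum_mono2) (use S assms in \<open>auto intro: prod_list_map_nonneg\<close>)
  finally show ?thesis by (simp add: sum_words_prod_list)
qed

section \<open>Descents of words and of permutations\<close>

lemma descent_weight_conv_prod:
  "descent_weight p l w = (\<Prod>i | Suc i < length w. if p (w ! i) < p (w ! Suc i) then l else l - 1)"
proof (induction p l w rule: descent_weight.induct)
  case (1 p l x y w)
  have "{i. Suc i < length (x # y # w)} = insert 0 (Suc ` {i. Suc i < length (y # w)})"
    by (auto simp: image_iff) (metis less_Suc_eq_0_disj not0_implies_Suc)
  then show ?case by (simp add: 1 prod.reindex)
qed auto

text \<open>Along an ascending word, letters and indices are ordered alike, so the rearranged word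
  ascends where \<open>\<sigma>\<close> does; a non-ascent of \<open>\<sigma>\<close> is a descent
  by injectivity.\<close>

lemma descent_weight_permute:
  assumes v: "ascending p v" "length v = k" and \<sigma>: "\<sigma> permutes {..<k}"
  shows "descent_weight p l (permute_list \<sigma> v) = l ^ asc k \<sigma> * (l - 1) ^ des k \<sigma>"
proof -
  have less: "p (v ! i) < p (v ! j) \<longleftrightarrow> i < j" if "i < k" "j < k" for i j
    using v that sorted_wrt_nth_less[of "\<lambda>x y. p x < p y" v i j]
      sorted_wrt_nth_less[of "\<lambda>x y. p x < p y" v j i]
    by (cases i j rule: linorder_cases) (auto simp: ascending_def)
  have in_k: "\<sigma> i < k" if "i < k" for i using \<sigma> that permutes_in_image by fastforce
  have "descent_weight p l (permute_list \<sigma> v)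
      = (\<Prod>i | Suc i < k. if \<sigma> i < \<sigma> (Suc i) then l else l - 1)"
    unfolding descent_weight_conv_prod
    by (intro prod.cong) (use v \<sigma> in \<open>auto simp: permute_list_nth less in_k\<close>)
  also have "\<dots> = l ^ card ({i. Suc i < k} \<inter> {i. \<sigma> i < \<sigma> (Suc i)})
      * (l - 1) ^ card ({i. Suc i < k} \<inter> - {i. \<sigma> i < \<sigma> (Suc i)})"
    by (subst prod.If_cases) (auto intro: finite_subset[of _ "{..<k}"])
  also have "{i. Suc i < k} \<inter> {i. \<sigma> i < \<sigma> (Suc i)} = {i. Suc i < k \<and> \<sigma> i < \<sigma> (Suc i)}"
    by auto
  also have "{i. Suc i < k} \<inter> - {i. \<sigma> i < \<sigma> (Suc i)} = {i. Suc i < k \<and> \<sigma> i > \<sigma> (Suc i)}"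
    using permutes_inj[OF \<sigma>] by (auto simp: inj_def not_less order.order_iff_strict) (metis n_not_Suc_n)
  finally show ?thesis by (simp add: asc_def des_def)
qed

lemma mu_lam_ascending:
  assumes v: "ascending p v"
  shows "mu_lam l (map f v) = (\<Sum>\<sigma> | \<sigma> permutes {..<length v}.
    descent_weight p l (permute_list \<sigma> v) *\<^sub>R prod_list (map f (permute_list \<sigma> v)))"
  unfolding mu_lam_def Let_def length_map
proof (intro sum.cong refl arg_cong2[where f = scaleR])
  fix \<sigma> assume s: "\<sigma> \<in> {\<sigma>. \<sigma> permutes {..<length v}}"
  then show "l ^ asc (length v) \<sigma> * (l - 1) ^ des (length v) \<sigma> = descent_weight p l (permute_list \<sigma> v)"
    using descent_weight_permute[OF v refl] by simp
  have "map (\<lambda>i. map f v ! \<sigma> i) [0..<length v] = map f (permute_list \<sigma> v)"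
    using s permutes_in_image[of \<sigma> "{..<length v}"] by (auto simp: permute_list_def)
  then show "perm_prod (map f v) \<sigma> = prod_list (map f (permute_list \<sigma> v))"
    by (simp add: perm_prod_def)
qed

text \<open>The k! terms of \<open>mu_lam\<close> at an ascending word are its rearrangements, so
  the polynomials disappear in favour of one sum over words without repetition.\<close>

lemma sum_mu_lam_ascending:
  assumes "inj_on p S"
  shows "(\<Sum>v\<in>{v \<in> words k S. ascending p v}. mu_lam l (map f v))
    = (\<Sum>w\<in>{w \<in> words k S. distinct w}. descent_weight p l w *\<^sub>R prod_list (map f w))"
  unfolding sum_distinct_words[OF assms]
  by (intro sum.cong) (auto simp: mu_lam_ascending words_def)

text \<open>For l in [0, 1] every coefficient has absolute value at most 1, leaving one term per
  permutation. The factorial is harmless, as k stays fixed while the partitions get finer.\<close>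

lemma norm_mu_lam_le:
  fixes f :: "'b \<Rightarrow> 'a::real_normed_algebra_1"
  assumes l: "l \<in> {0..1}"
  shows "norm (mu_lam l (map f v)) \<le> fact (length v) * prod_list (map (\<lambda>x. norm (f x)) v)"
proof -
  let ?k = "length v"
  have "norm (mu_lam l (map f v)) \<le> (\<Sum>\<sigma> | \<sigma> permutes {..<?k}. prod_list (map (\<lambda>x. norm (f x)) v))"
    unfolding mu_lam_def Let_def length_map
  proof (intro sum_norm_le)
    fix \<sigma> assume s: "\<sigma> \<in> {\<sigma>. \<sigma> permutes {..<?k}}"
    have "map (\<lambda>i. map f v ! \<sigma> i) [0..<?k] = map f (permute_list \<sigma> v)"
      using s permutes_in_image[of \<sigma> "{..<?k}"] by (auto simp: permute_list_def)
    then have "norm (perm_prod (map f v) \<sigma>) \<le> prod_list (map (\<lambda>x. norm (f x)) v)"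
      using norm_prod_list_map_le[of f "permute_list \<sigma> v"] s
      by (simp add: perm_prod_def prod_list_permute)
    moreover have "\<bar>l ^ asc ?k \<sigma> * (l - 1) ^ des ?k \<sigma>\<bar> \<le> 1 * 1"
      unfolding abs_mult power_abs using l by (intro mult_mono power_le_one) auto
    ultimately show "norm ((l ^ asc ?k \<sigma> * (l - 1) ^ des ?k \<sigma>) *\<^sub>R perm_prod (map f v) \<sigma>)
        \<le> prod_list (map (\<lambda>x. norm (f x)) v)"
      using mult_mono[of "\<bar>l ^ asc ?k \<sigma> * (l - 1) ^ des ?k \<sigma>\<bar>" 1 "norm (perm_prod (map f v) \<sigma>)"
          "prod_list (map (\<lambda>x. norm (f x)) v)"] by simp
  qed
  then show ?thesis by (simp add: card_permutations)
qed

section \<open>Variation of interval measures\<close>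


definition interval_families :: "real set \<Rightarrow> real set set set"
  where "interval_families A = {F. finite F \<and> F \<subseteq> subintervals A \<and> disjoint F}"

text \<open>A real bound on the variation, stated for an arbitrary set so that it restricts to
  blocks and to neighbourhoods of a point.\<close>

definition variation_le :: "(real set \<Rightarrow> 'a::real_normed_vector) \<Rightarrow> real set \<Rightarrow> real \<Rightarrow> bool"
  where "variation_le \<phi> A c \<longleftrightarrow> (\<forall>F\<in>interval_families A. (\<Sum>J\<in>F. norm (\<phi> J)) \<le> c)"

lemma variation_leD: "variation_le \<phi> A c \<Longrightarrow> F \<in> interval_families A \<Longrightarrow> (\<Sum>J\<in>F. norm (\<phi> J)) \<le> c"
  by (simp add: variation_le_def)

lemma variation_le_subset: "variation_le \<phi> A c \<Longrightarrow> B \<subseteq> A \<Longrightarrow> variation_le \<phi> B c"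
  unfolding variation_le_def interval_families_def subintervals_def by blast

lemma finite_variationE:
  assumes "variation I \<phi> < \<infinity>"
  obtains V where "1 \<le> V" "variation_le \<phi> I V"
proof -
  obtain V where V: "variation I \<phi> = ennreal V" "0 \<le> V"
    using assms by (cases "variation I \<phi>") auto
  have "(\<Sum>J\<in>F. norm (\<phi> J)) \<le> V" if F: "F \<in> interval_families I" for F
  proof -
    have "ennreal (\<Sum>J\<in>F. norm (\<phi> J)) = (\<Sum>J\<in>F. ennreal (norm (\<phi> J)))"
      by (simp add: sum_ennreal)
    also have "\<dots> \<le> variation I \<phi>"
      unfolding variation_def using F by (intro SUP_upper) (simp add: interval_families_def)
    finally show ?thesis using V by simp
  qed
  \<comment> \<open>\<open>max 1 V\<close> because the word counts compare different powers of
    \<open>V\<close>.\<close>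
  then have "variation_le \<phi> I (max 1 V)" by (force simp: variation_le_def)
  then show ?thesis by (intro that[of "max 1 V"]) auto
qed

text \<open>The constant sequence of empty sets turns additivity into a convergent constant
  series.\<close>

lemma interval_measure_empty:
  assumes "is_interval_measure I \<phi>"
  shows "\<phi> {} = 0"
proof -
  have "(\<lambda>n::nat. \<phi> {}) sums \<phi> (\<Union>n::nat. {})"
    using assms unfolding is_interval_measure_def
    by (elim allE[of _ "\<lambda>_. {}"]) (auto simp: subintervals_def disjoint_family_on_def)
  then show ?thesis by (metis sums_summable summable_const_iff)
qed

text \<open>Countable additivity for the family padded with empty sets.\<close>

lemma interval_measure_finite_additive:
  assumes \<phi>: "is_interval_measure I \<phi>" and F: "finite F" "F \<subseteq> subintervals I" "disjoint F"
    and U: "is_interval (\<Union>F)"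
  shows "\<phi> (\<Union>F) = (\<Sum>J\<in>F. \<phi> J)"
proof -
  obtain h where h: "bij_betw h {0..<card F} F"
    using ex_bij_betw_nat_finite[OF F(1)] by blast
  define J where "J = (\<lambda>i. if i < card F then h i else {})"
  have hF: "h i \<in> F" if "i < card F" for i using h that by (auto simp: bij_betw_def)
  have "disjoint_family J"
    unfolding disjoint_family_on_def
  proof (intro ballI impI)
    fix i j :: nat assume "i \<noteq> j"
    then have "h i \<noteq> h j" if "i < card F" "j < card F"
      using h that by (auto simp: bij_betw_def dest: inj_onD)
    then show "J i \<inter> J j = {}" using hF F(3) by (auto simp: J_def dest: disjointD)
  qed
  moreover have "range J \<subseteq> subintervals I"
    using hF F(2) by (auto simp: J_def subintervals_def)
  moreover have un: "(\<Union>n. J n) = \<Union>F"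
  proof (intro equalityI subsetI)
    fix x assume "x \<in> \<Union>F"
    then obtain A where "x \<in> A" "A \<in> h ` {0..<card F}" using h by (auto simp: bij_betw_def)
    then obtain i where "i < card F" "x \<in> h i" by auto
    then show "x \<in> (\<Union>n. J n)" by (auto simp: J_def intro!: exI[of _ i])
  qed (use hF in \<open>auto simp: J_def split: if_splits\<close>)
  ultimately have "(\<lambda>n. \<phi> (J n)) sums \<phi> (\<Union>F)"
    using \<phi> U unfolding is_interval_measure_def by metis
  moreover have "(\<lambda>n. \<phi> (J n)) sums (\<Sum>n\<in>{0..<card F}. \<phi> (J n))"
    by (rule sums_finite) (auto simp: J_def interval_measure_empty[OF \<phi>])
  moreover have "(\<Sum>n\<in>{0..<card F}. \<phi> (J n)) = (\<Sum>J\<in>F. \<phi> J)"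
    using sum.reindex_bij_betw[OF h, of \<phi>] by (simp add: J_def)
  ultimately show ?thesis using sums_unique2 by metis
qed

text \<open>Continuity from below. As \<open>\<phi>\<close> is additive on intervals only, the
  increments of the exhausting sets must be intervals too; the assumption on \<open>J - D n\<close>
  ensures this.\<close>

lemma interval_measure_tendsto:
  assumes \<phi>: "is_interval_measure I \<phi>" and J: "J \<in> subintervals I"
    and D: "incseq D" "\<And>n. is_interval (D n)" "\<And>n. is_interval (J - D n)" "J \<subseteq> (\<Union>n. D n)"
  shows "(\<lambda>n. \<phi> (J \<inter> D n)) \<longlonglongrightarrow> \<phi> J"
proof -
  define E where "E = (\<lambda>n. J \<inter> D n)"
  have mono: "mono E" using D(1) by (auto simp: E_def mono_def)
  have iE: "is_interval (E n)" for n
    using J D(2) by (auto simp: E_def subintervals_def intro: is_interval_Int)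
  have dis: "disjointed E (Suc n) = E (Suc n) \<inter> (J - D n)" for n
    using disjointed_mono[OF mono] by (auto simp: E_def)
  have sub: "disjointed E n \<in> subintervals I" for n
  proof (cases n)
    case 0
    then show ?thesis using J iE by (auto simp: subintervals_def E_def)
  next
    case (Suc m)
    then show ?thesis using J iE[of n] D(3)[of m] by (auto simp: subintervals_def dis is_interval_Int)
  qed
  have UE: "(\<Union>n. E n) = J" using D(4) by (auto simp: E_def)
  have "(\<lambda>n. \<phi> (disjointed E n)) sums \<phi> (\<Union>n. disjointed E n)"
    using \<phi> sub J unfolding is_interval_measure_def
    by (elim allE[of _ "disjointed E"]) (auto simp: disjoint_family_disjointed UN_disjointed_eq UE subintervals_def)
  then have "(\<lambda>n. \<Sum>i\<le>n. \<phi> (disjointed E i)) \<longlonglongrightarrow> \<phi> J"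
    by (simp add: sums_def_le UN_disjointed_eq UE)
  moreover have "(\<Sum>i\<le>n. \<phi> (disjointed E i)) = \<phi> (E n)" for n
  proof (induction n)
    case (Suc n)
    have U: "\<Union>{E n, disjointed E (Suc n)} = E (Suc n)"
      using monoD[OF mono, of n "Suc n"] disjointed_mono[OF mono] by auto
    have "\<phi> (E (Suc n)) = (\<Sum>J\<in>{E n, disjointed E (Suc n)}. \<phi> J)"
    proof (subst U[symmetric], rule interval_measure_finite_additive[OF \<phi>])
      have "E n \<inter> disjointed E (Suc n) = {}" unfolding dis by (auto simp: E_def)
      then show "disjoint {E n, disjointed E (Suc n)}" by (auto simp: disjoint_def)
      have "E n \<subseteq> J" by (auto simp: E_def)
      then show "{E n, disjointed E (Suc n)} \<subseteq> subintervals I"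
        using J iE sub[of "Suc n"] by (auto simp: subintervals_def)
    qed (unfold U, use iE in simp_all)
    \<comment> \<open>The two-element set collapses when the pieces coincide; being disjoint, they
      are then empty.\<close>
    also have "\<dots> = \<phi> (E n) + \<phi> (disjointed E (Suc n))"
    proof (cases "E n = disjointed E (Suc n)")
      case True
      have "E n \<inter> disjointed E (Suc n) = {}" unfolding dis by (auto simp: E_def)
      then have "E n = {}" using True by simp
      then show ?thesis using True interval_measure_empty[OF \<phi>] by simp
    qed auto
    finally show ?case using Suc by simp
  qed (simp add: disjointed_0)
  ultimately show ?thesis by (simp add: E_def)
qed

text \<open>
  A near-optimal family of intervals in \<open>D\<close> stays near-optimal when intersected with \<open>E n\<close>, so
  hardly any variation is left for \<open>D - E n\<close>.
\<close>

lemma ex_variation_tail_le: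
  assumes \<phi>: "is_interval_measure I \<phi>" and V: "variation_le \<phi> I V" and "0 < \<epsilon>"
    and D: "is_interval D" "D \<subseteq> I" "incseq E" "\<And>n. is_interval (E n)" "\<And>n. is_interval (D - E n)"
      "D = (\<Union>n. E n)"
  shows "\<exists>n. variation_le \<phi> (D - E n) \<epsilon>"
proof -
  let ?s = "\<lambda>F. \<Sum>J\<in>F. norm (\<phi> J)"
  have ne: "interval_families D \<noteq> {}" by (auto simp: interval_families_def intro!: exI[of _ "{}"])
  have bdd: "bdd_above (?s ` interval_families D)"
    using variation_leD[OF variation_le_subset[OF V D(2)]] by (intro bdd_aboveI2)
  obtain F where F: "F \<in> interval_families D" and less: "Sup (?s ` interval_families D) - \<epsilon> < ?s F"
    using less_cSup_iff[of "?s ` interval_families D" "Sup (?s ` interval_families D) - \<epsilon>"] ne bdd \<open>0 < \<epsilon>\<close>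
    by auto
  have "(\<lambda>n. \<phi> (J \<inter> E n)) \<longlonglongrightarrow> \<phi> J" if "J \<in> F" for J
  proof (rule interval_measure_tendsto[OF \<phi>])
    have J: "J \<subseteq> D" "is_interval J" using that F by (auto simp: interval_families_def subintervals_def)
    then show "J \<in> subintervals I" "J \<subseteq> (\<Union>n. E n)" using D by (auto simp: subintervals_def)
    have "J - E n = J \<inter> (D - E n)" for n using J by auto
    then show "is_interval (J - E n)" for n using J D(5) by (simp add: is_interval_Int)
  qed (use D in auto)
  then have "(\<lambda>n. \<Sum>J\<in>F. norm (\<phi> (J \<inter> E n))) \<longlonglongrightarrow> ?s F"
    by (intro tendsto_sum tendsto_norm)
  from order_tendstoD(1)[OF this less]
  obtain n where n: "Sup (?s ` interval_families D) - \<epsilon> < (\<Sum>J\<in>F. norm (\<phi> (J \<inter> E n)))"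
    unfolding eventually_sequentially by blast
  have "?s G \<le> \<epsilon>" if G: "G \<in> interval_families (D - E n)" for G
  proof -
    let ?F = "(\<lambda>J. J \<inter> E n) ` F"
    have FE: "?F \<union> G \<in> interval_families D"
    proof -
      have dF: "disjoint F" using F by (simp add: interval_families_def)
      have "disjoint ?F"
      proof (rule disjointI, clarify)
        fix J K x assume "J \<in> F" "K \<in> F" "J \<inter> E n \<noteq> K \<inter> E n"
        then show "J \<inter> E n \<inter> (K \<inter> E n) = {}" using disjointD[OF dF, of J K] by auto
      qed
      then have "disjoint (?F \<union> G)"
        using G by (intro disjoint_union) (auto simp: interval_families_def subintervals_def)
      then show ?thesis
        using F G D(4)[of n] by (auto simp: interval_families_def subintervals_def is_interval_Int)
    qed
    \<comment> \<open>The only set that can lie in both families is the empty one, which carries no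
      mass.\<close>
    have "?s (?F \<union> G) = ?s ?F + ?s G"
    proof (rule sum.union_inter_neutral)
      have "J = {}" if "J \<in> ?F \<inter> G" for J
        using that F G by (auto simp: interval_families_def subintervals_def)
      then show "\<forall>J\<in>?F \<inter> G. norm (\<phi> J) = 0"
        using interval_measure_empty[OF \<phi>] by (metis norm_zero)
    qed (use F G in \<open>auto simp: interval_families_def\<close>)
    \<comment> \<open>Different members can have the same trace on \<open>E n\<close> only if that
      trace is empty.\<close>
    moreover have "?s ?F = (\<Sum>J\<in>F. norm (\<phi> (J \<inter> E n)))"
    proof (subst sum.reindex_nontrivial)
      fix J K assume "J \<in> F" "K \<in> F" "J \<noteq> K" "J \<inter> E n = K \<inter> E n"
      moreover have "J \<inter> K = {}"
        using F \<open>J \<in> F\<close> \<open>K \<in> F\<close> \<open>J \<noteq> K\<close> by (auto simp: interval_families_def dest: disjointD)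
      ultimately have "J \<inter> E n = {}" by auto
      then show "norm (\<phi> (J \<inter> E n)) = 0" using interval_measure_empty[OF \<phi>] by simp
    qed (use F in \<open>auto simp: interval_families_def\<close>)
    moreover have "?s (?F \<union> G) \<le> Sup (?s ` interval_families D)"
      by (intro cSup_upper bdd imageI FE)
    ultimately show ?thesis using n by linarith
  qed
  then show ?thesis by (auto simp: variation_le_def)
qed

text \<open>Each side of x is exhausted by the points at distance at least 1 / (n + 1) from x, so
  the tail estimate applies to it. The point x is left out, since an atom there would not become
  small.\<close>

lemma variation_le_near_point:
  assumes I: "is_interval I" and \<phi>: "is_interval_measure I \<phi>" and V: "variation_le \<phi> I V" and \<epsilon>: "0 < \<epsilon>"
  shows "\<exists>d>0. variation_le \<phi> (I \<inter> {x - d<..<x}) \<epsilon> \<and> variation_le \<phi> (I \<inter> {x<..<x + d}) \<epsilon>"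
proof -
  define r where "r = (\<lambda>n::nat. inverse (real (Suc n)))"
  have r: "decseq r" "\<And>n. 0 < r n" "\<And>y. 0 < y \<Longrightarrow> \<exists>n. r n < y"
    using reals_Archimedean by (auto simp: r_def decseq_def simp del: of_nat_Suc)
  have "\<exists>n. variation_le \<phi> (I \<inter> {..<x} - I \<inter> {..x - r n}) \<epsilon>"
  proof (rule ex_variation_tail_le[OF \<phi> V \<epsilon>])
    show "incseq (\<lambda>n. I \<inter> {..x - r n})"
      using r(1) by (force simp: incseq_def decseq_def)
    have "I \<inter> {..<x} - I \<inter> {..x - r n} = I \<inter> {x - r n<..<x}" for n by auto
    then show "is_interval (I \<inter> {..<x} - I \<inter> {..x - r n})" for n
      using I by (simp add: is_interval_Int)
    show "I \<inter> {..<x} = (\<Union>n. I \<inter> {..x - r n})"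
    proof (intro equalityI subsetI)
      fix y assume "y \<in> I \<inter> {..<x}"
      moreover from this obtain n where "r n < x - y" using r(3)[of "x - y"] by auto
      ultimately show "y \<in> (\<Union>n. I \<inter> {..x - r n})" by (auto intro!: exI[of _ n])
    next
      fix y assume "y \<in> (\<Union>n. I \<inter> {..x - r n})"
      then obtain n where "y \<in> I" "y \<le> x - r n" by auto
      then show "y \<in> I \<inter> {..<x}" using r(2)[of n] by auto
    qed
  qed (use I in \<open>auto intro: is_interval_Int\<close>)
  then obtain m where m: "variation_le \<phi> (I \<inter> {..<x} - I \<inter> {..x - r m}) \<epsilon>" ..
  have "\<exists>n. variation_le \<phi> (I \<inter> {x<..} - I \<inter> {x + r n..}) \<epsilon>"
  proof (rule ex_variation_tail_le[OF \<phi> V \<epsilon>])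
    show "incseq (\<lambda>n. I \<inter> {x + r n..})"
      using r(1) by (force simp: incseq_def decseq_def)
    have "I \<inter> {x<..} - I \<inter> {x + r n..} = I \<inter> {x<..<x + r n}" for n by auto
    then show "is_interval (I \<inter> {x<..} - I \<inter> {x + r n..})" for n
      using I by (simp add: is_interval_Int)
    show "I \<inter> {x<..} = (\<Union>n. I \<inter> {x + r n..})"
    proof (intro equalityI subsetI)
      fix y assume "y \<in> I \<inter> {x<..}"
      moreover from this obtain n where "r n < y - x" using r(3)[of "y - x"] by auto
      ultimately show "y \<in> (\<Union>n. I \<inter> {x + r n..})" by (auto intro!: exI[of _ n])
    next
      fix y assume "y \<in> (\<Union>n. I \<inter> {x + r n..})"
      then obtain n where "y \<in> I" "x + r n \<le> y" by auto
      then show "y \<in> I \<inter> {x<..}" using r(2)[of n] by auto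
    qed
  qed (use I in \<open>auto intro: is_interval_Int\<close>)
  then obtain n where n: "variation_le \<phi> (I \<inter> {x<..} - I \<inter> {x + r n..}) \<epsilon>" ..
  show ?thesis
    by (intro exI[of _ "min (r m) (r n)"] conjI variation_le_subset[OF m] variation_le_subset[OF n])
      (use r(2) in auto)
qed

text \<open>Continuity of \<open>\<phi>\<close> enters here: it closes the gap between the two
  one-sided neighbourhoods.\<close>

lemma variation_le_singleton:
  assumes "is_interval_measure I \<phi>" "continuous_measure I \<phi>" "0 \<le> \<epsilon>"
  shows "variation_le \<phi> (I \<inter> {x}) \<epsilon>"
  unfolding variation_le_def
proof
  fix F assume F: "F \<in> interval_families (I \<inter> {x})"
  have "\<phi> J = 0" if "J \<in> F" for J
  proof -
    have "J = {} \<or> J = {x} \<and> x \<in> I" using F that by (auto simp: interval_families_def subintervals_def)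
    then show ?thesis using assms interval_measure_empty by (auto simp: continuous_measure_def)
  qed
  then show "(\<Sum>J\<in>F. norm (\<phi> J)) \<le> \<epsilon>" using assms by simp
qed

text \<open>Bisection: fine partitions of adjacent pieces can be joined, and near each x the two
  one-sided neighbourhoods and the point itself form one. Half-open pieces join without
  overlap.\<close>

lemma ex_fine_partition:
  assumes I: "is_interval I" "bounded I"
    and \<phi>: "is_interval_measure I \<phi>" "continuous_measure I \<phi>" and V: "variation_le \<phi> I V" and \<epsilon>: "0 < \<epsilon>"
  shows "\<exists>P\<in>interval_partitions I. \<forall>J\<in>P. variation_le \<phi> J \<epsilon>"
proof -
  define R where "R = (\<lambda>a b. \<exists>P\<in>interval_partitions (I \<inter> {a..<b}). \<forall>J\<in>P. variation_le \<phi> J \<epsilon>)"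
  obtain B where B: "\<And>x. x \<in> I \<Longrightarrow> \<bar>x\<bar> \<le> B" and "0 < B"
    using \<open>bounded I\<close> by (auto simp: bounded_pos)
  have "R (- B) (B + 1)"
  proof (rule Bolzano)
    fix a b c assume R: "R a b" "R b c" and le: "a \<le> b" "b \<le> c"
    then obtain P Q where P: "P \<in> interval_partitions (I \<inter> {a..<b})" "\<forall>J\<in>P. variation_le \<phi> J \<epsilon>"
      and Q: "Q \<in> interval_partitions (I \<inter> {b..<c})" "\<forall>J\<in>Q. variation_le \<phi> J \<epsilon>"
      by (auto simp: R_def)
    have PQ: "J \<inter> K = {}" if "J \<in> P" "K \<in> Q" for J K
      using that P Q by (force simp: interval_partitions_def subintervals_def)
    have "\<Union>(P \<union> Q) = I \<inter> {a..<b} \<union> I \<inter> {b..<c}"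
      using P Q by (simp add: interval_partitions_def partition_on_def)
    also have "\<dots> = I \<inter> {a..<c}" using le by auto
    finally have U: "\<Union>(P \<union> Q) = I \<inter> {a..<c}" .
    have "disjoint (P \<union> Q)"
      using P(1) Q(1) PQ by (intro disjoint_union) (auto simp: interval_partitions_def partition_on_def)
    moreover have "P \<union> Q \<subseteq> subintervals (I \<inter> {a..<c})"
    proof
      fix J assume "J \<in> P \<union> Q"
      then have "is_interval J" "J \<subseteq> \<Union>(P \<union> Q)"
        using P(1) Q(1) by (auto simp: interval_partitions_def subintervals_def)
      then show "J \<in> subintervals (I \<inter> {a..<c})" unfolding U by (simp add: subintervals_def)
    qed
    ultimately have "P \<union> Q \<in> interval_partitions (I \<inter> {a..<c})"
      using P(1) Q(1) U by (auto simp: interval_partitions_def partition_on_def)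
    moreover have "\<forall>J\<in>P \<union> Q. variation_le \<phi> J \<epsilon>" using P(2) Q(2) by blast
    ultimately show "R a c" unfolding R_def by blast
  next
    fix x
    obtain d where d: "d > 0" "variation_le \<phi> (I \<inter> {x - d<..<x}) \<epsilon>" "variation_le \<phi> (I \<inter> {x<..<x + d}) \<epsilon>"
      using variation_le_near_point[OF I(1) \<phi>(1) V \<epsilon>, of x] by blast
    have "R a b" if ab: "a \<le> x" "x \<le> b" "b - a < d" for a b
    proof -
      let ?A = "I \<inter> {a..<x}" and ?B = "I \<inter> {x} \<inter> {a..<b}" and ?C = "I \<inter> {x<..<b}"
      have "variation_le \<phi> ?A \<epsilon>" "variation_le \<phi> ?B \<epsilon>" "variation_le \<phi> ?C \<epsilon>"
        using variation_le_singleton[OF \<phi>, of \<epsilon> x] \<epsilon> ab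
        by (auto intro: variation_le_subset[OF d(2)] variation_le_subset[OF d(3)] variation_le_subset)
      moreover have "is_interval {x}" by (simp add: is_interval_1)
      with I have "is_interval ?A" "is_interval ?B" "is_interval ?C"
        by (auto intro!: is_interval_Int)
      \<comment> \<open>Empty pieces are removed because a partition has no empty block.\<close>
      moreover have "\<Union>({?A, ?B, ?C} - {{}}) = I \<inter> {a..<b}"
      proof -
        have "\<Union>({?A, ?B, ?C} - {{}}) = \<Union>{?A, ?B, ?C}" by blast
        also have "\<dots> = ?A \<union> (?B \<union> ?C)" by simp
        also have "\<dots> = I \<inter> {a..<b}" using ab by auto
        finally show ?thesis .
      qed
      moreover have "disjoint ({?A, ?B, ?C} - {{}})"
      proof -
        have *: "disjoint {A, B, C}" if "A \<inter> B = {}" "A \<inter> C = {}" "B \<inter> C = {}" for A B C :: "real set"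
          using that by (auto simp: pairwise_insert disjnt_def Int_commute)
        have "?A \<inter> ?B = {}" "?A \<inter> ?C = {}" "?B \<inter> ?C = {}" by auto
        then have "disjoint {?A, ?B, ?C}" by (rule *)
        then show ?thesis by (rule pairwise_subset) auto
      qed
      moreover have "{?A, ?B, ?C} \<subseteq> Pow (I \<inter> {a..<b})" using ab by auto
      ultimately have "{?A, ?B, ?C} - {{}} \<in> interval_partitions (I \<inter> {a..<b})"
        "\<forall>J\<in>{?A, ?B, ?C} - {{}}. variation_le \<phi> J \<epsilon>"
        unfolding interval_partitions_def partition_on_def subintervals_def by auto
      then show ?thesis unfolding R_def by blast
    qed
    then show "\<exists>d>0. \<forall>a b. a \<le> x \<and> x \<le> b \<and> b - a < d \<longrightarrow> R a b" using d(1) by blast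
  qed (use \<open>0 < B\<close> in simp)
  \<comment> \<open>The right end of a half-open piece is excluded, hence
    \<open>B + 1\<close>.\<close>
  moreover have "I \<inter> {- B..<B + 1} = I" using B by fastforce
  ultimately show ?thesis by (simp add: R_def)
qed

section \<open>Partitions and refinement\<close>


lemma interval_partitionsD:
  assumes "P \<in> interval_partitions I"
  shows "finite P" "partition_on I P" "\<And>J. J \<in> P \<Longrightarrow> is_interval J" "\<And>J. J \<in> P \<Longrightarrow> J \<noteq> {}"
    "\<And>J. J \<in> P \<Longrightarrow> J \<subseteq> I" "\<And>J K. J \<in> P \<Longrightarrow> K \<in> P \<Longrightarrow> J \<noteq> K \<Longrightarrow> J \<inter> K = {}"
  using assms by (auto simp: interval_partitions_def partition_on_def subintervals_def disjoint_def)

lemma interval_partitions_subset_families: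
  "P \<in> interval_partitions I \<Longrightarrow> Q \<subseteq> P \<Longrightarrow> Q \<in> interval_families I"
  by (auto simp: interval_partitions_def interval_families_def partition_on_def
      intro: finite_subset pairwise_subset)

lemma ex_common_interval_refinement:
  assumes P: "P \<in> interval_partitions I" and Q: "Q \<in> interval_partitions I"
  shows "\<exists>R\<in>interval_partitions I. refines I R P \<and> refines I R Q"
proof
  let ?R = "common_refinement {P, Q}"
  have part: "\<And>S. S \<in> {P, Q} \<Longrightarrow> partition_on I S" using P Q interval_partitionsD by auto
  then show "refines I ?R P \<and> refines I ?R Q" by (auto intro: refines_common_refinement)
  have sub: "?R \<subseteq> (\<lambda>(J, K). J \<inter> K) ` (P \<times> Q)"
  proof
    fix X assume "X \<in> ?R"
    then obtain f where f: "f \<in> (\<Pi> S\<in>{P, Q}. S)" "X = \<Inter> (f ` {P, Q})"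
      unfolding common_refinement by blast
    then show "X \<in> (\<lambda>(J, K). J \<inter> K) ` (P \<times> Q)"
      by (intro image_eqI[of _ _ "(f P, f Q)"]) auto
  qed
  show "?R \<in> interval_partitions I"
  proof -
    have "finite ?R"
      by (rule finite_subset[OF sub]) (use interval_partitionsD(1)[OF P] interval_partitionsD(1)[OF Q] in simp)
    moreover have "?R \<subseteq> subintervals I"
    proof
      fix X assume "X \<in> ?R"
      then obtain J K where "J \<in> P" "K \<in> Q" "X = J \<inter> K" using sub by auto
      then show "X \<in> subintervals I"
        using interval_partitionsD(3,5)[OF P, of J] interval_partitionsD(3)[OF Q, of K]
        by (auto simp: subintervals_def is_interval_Int)
    qed
    moreover have "partition_on I ?R" by (rule partition_on_common_refinement[OF part]) auto
    ultimately show ?thesis by (simp add: interval_partitions_def)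
  qed
qed

lemma interval_partitions_nonempty:
  assumes "is_interval I"
  shows "interval_partitions I \<noteq> {}"
proof (cases "I = {}")
  case True
  then show ?thesis by (auto simp: interval_partitions_def partition_on_empty)
next
  case False
  then have "{I} \<in> interval_partitions I"
    using assms by (auto simp: interval_partitions_def subintervals_def partition_on_space)
  then show ?thesis by blast
qed

text \<open>Common refinements make the principal filters a base, so a single partition witnesses an
  eventual property.\<close>

lemma eventually_refinement_filter:
  assumes "is_interval I"
  shows "eventually R (refinement_filter I)
    \<longleftrightarrow> (\<exists>P\<in>interval_partitions I. \<forall>Q\<in>interval_partitions I. refines I Q P \<longrightarrow> R Q)"
  unfolding refinement_filter_def
proof (subst eventually_INF_base)
  fix P Q assume "P \<in> interval_partitions I" "Q \<in> interval_partitions I"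
  then obtain S where "S \<in> interval_partitions I" "refines I S P" "refines I S Q"
    using ex_common_interval_refinement by blast
  then show "\<exists>S\<in>interval_partitions I. principal {Q \<in> interval_partitions I. refines I Q S}
      \<le> inf (principal {S \<in> interval_partitions I. refines I S P})
         (principal {S \<in> interval_partitions I. refines I S Q})"
    by (intro bexI[of _ S]) (auto intro: refines_trans)
qed (use interval_partitions_nonempty[OF assms] in \<open>auto simp: eventually_principal\<close>)

lemma refinement_filter_neq_bot:
  assumes "is_interval I"
  shows "refinement_filter I \<noteq> bot"
proof
  assume "refinement_filter I = bot"
  then have "eventually (\<lambda>_. False) (refinement_filter I)" by simp
  then show False
    unfolding eventually_refinement_filter[OF assms] by (meson interval_partitionsD(2) refines_refl)
qed

text \<open>Any sample point will do: by \<open>interval_less_cong\<close> the order of disjoint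
  blocks does not depend on it. It serves as the position \<open>p\<close> for words of
  blocks.\<close>

definition block_point :: "real set \<Rightarrow> real"
  where "block_point J = (SOME x. x \<in> J)"

lemma block_point_in: "J \<noteq> {} \<Longrightarrow> block_point J \<in> J"
  unfolding block_point_def by (rule someI_ex) auto

text \<open>If the order changed with the points, convexity would put a point of one interval into
  the other.\<close>

lemma interval_less_cong:
  fixes J K :: "real set"
  assumes "is_interval J" "is_interval K" "J \<inter> K = {}" "x \<in> J" "y \<in> K" "x' \<in> J" "y' \<in> K"
  shows "x < y \<longleftrightarrow> x' < y'"
proof -
  have *: "x' < y'" if "x \<in> J" "y \<in> K" "x' \<in> J" "y' \<in> K" "x < y" for x y x' y'
  proof (rule ccontr)
    assume "\<not> x' < y'"
    then have "y' \<le> x'" by simp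
    consider "y' \<le> x" | "x < y'" by linarith
    then show False
    proof cases
      case 1
      then have "x \<in> K" using mem_is_interval_1_I[OF assms(2) that(4) that(2)] that by simp
      then show False using that assms(3) by blast
    next
      case 2
      then have "y' \<in> J" using mem_is_interval_1_I[OF assms(1) that(1) that(3)] \<open>y' \<le> x'\<close> by simp
      then show False using that assms(3) by blast
    qed
  qed
  show ?thesis using *[of x y x' y'] *[of x' y' x y] assms by blast
qed

lemma inj_on_block_point:
  assumes P: "P \<in> interval_partitions I"
  shows "inj_on block_point P"
proof (rule inj_onI)
  fix J K assume JK: "J \<in> P" "K \<in> P" "block_point J = block_point K"
  then have "block_point J \<in> J \<inter> K"
    using interval_partitionsD(4)[OF P] block_point_in by (metis IntI)
  then show "J = K" using interval_partitionsD(6)[OF P JK(1,2)] by blast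
qed

lemma interval_le_iff_block_point:
  assumes P: "P \<in> interval_partitions I" and JK: "J \<in> P" "K \<in> P"
  shows "interval_le J K \<longleftrightarrow> block_point J \<le> block_point K"
proof (cases "J = K")
  case True
  then show ?thesis
    using block_point_in[OF interval_partitionsD(4)[OF P JK(1)]] by (auto simp: interval_le_def)
next
  case False
  note in_JK = block_point_in[OF interval_partitionsD(4)[OF P JK(1)]]
    block_point_in[OF interval_partitionsD(4)[OF P JK(2)]]
  have disj: "J \<inter> K = {}" using interval_partitionsD(6)[OF P JK False] .
  have "(\<exists>s\<in>J. \<exists>t\<in>K. s \<le> t) \<longleftrightarrow> (\<exists>s\<in>J. \<exists>t\<in>K. s < t)"
    using disj by (metis disjoint_iff less_eq_real_def)
  also have "\<dots> \<longleftrightarrow> block_point J < block_point K"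
    using interval_less_cong[OF interval_partitionsD(3)[OF P JK(1)] interval_partitionsD(3)[OF P JK(2)] disj
        _ _ in_JK] in_JK by blast
  also have "\<dots> \<longleftrightarrow> block_point J \<le> block_point K"
    using inj_onD[OF inj_on_block_point[OF P] _ JK] False by (metis less_le)
  finally show ?thesis by (simp add: interval_le_def)
qed

text \<open>Different blocks have different sample points, so strictness of the order encodes
  distinctness.\<close>

lemma sorted_interval_le_distinct_iff:
  assumes P: "P \<in> interval_partitions I" and v: "set v \<subseteq> P"
  shows "sorted_wrt interval_le v \<and> distinct v \<longleftrightarrow> ascending block_point v"
proof -
  have "sorted_wrt interval_le v \<longleftrightarrow> sorted (map block_point v)"
    unfolding sorted_map
    using v by (intro iffI; elim sorted_wrt_mono_rel[rotated])
      (auto simp: interval_le_iff_block_point[OF P] subset_iff)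
  moreover have "distinct v \<longleftrightarrow> distinct (map block_point v)"
    using inj_on_subset[OF inj_on_block_point[OF P] v] by (simp add: distinct_map)
  ultimately show ?thesis
    unfolding ascending_def using strict_sorted_iff[of "map block_point v"] by (simp add: sorted_wrt_map)
qed

text \<open>Weakly ordered tuples differ from ascending words only by tuples with a repeated block.
  The classes of the collision count are single blocks (\<open>id\<close>), small by
  fineness.\<close>

lemma norm_ordered_sum_diff_le:
  fixes \<phi> :: "real set \<Rightarrow> 'a::real_normed_algebra_1"
  assumes P: "P \<in> interval_partitions I" and V: "variation_le \<phi> I V" "1 \<le> V"
    and fine: "\<forall>J\<in>P. variation_le \<phi> J \<epsilon>" and "0 \<le> \<epsilon>" "0 \<le> C"
    and F: "\<And>v. length v = k \<Longrightarrow> norm (F (map \<phi> v)) \<le> C * prod_list (map (\<lambda>J. norm (\<phi> J)) v)"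
  shows "norm (ordered_sum F k \<phi> P - (\<Sum>v\<in>{v \<in> words k P. ascending block_point v}. F (map \<phi> v)))
    \<le> C * ((real k)^2 * \<epsilon> * V ^ k)"
proof -
  let ?O = "{v \<in> words k P. sorted_wrt interval_le v}" and ?A = "{v \<in> words k P. ascending block_point v}"
  let ?u = "\<lambda>J. norm (\<phi> J)"
  note fin = interval_partitionsD(1)[OF P]
  have A: "?A = ?O \<inter> {v. distinct v}"
    using sorted_interval_le_distinct_iff[OF P] by (auto simp: words_def)
  have "ordered_sum F k \<phi> P = (\<Sum>v\<in>?O. F (map \<phi> v))"
    unfolding ordered_sum_def by (intro sum.cong) (auto simp: words_def)
  then have "ordered_sum F k \<phi> P - (\<Sum>v\<in>?A. F (map \<phi> v)) = (\<Sum>v\<in>?O - ?A. F (map \<phi> v))"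
    using fin A by (simp add: sum_diff)
  also have "norm \<dots> \<le> (\<Sum>v\<in>?O - ?A. C * prod_list (map ?u v))"
    by (rule sum_norm_le) (auto simp: words_def intro: F)
  also have "\<dots> \<le> (\<Sum>v\<in>{v \<in> words k P. \<not> distinct (map id v)}. C * prod_list (map ?u v))"
    using fin \<open>0 \<le> C\<close> by (intro sum_mono2) (auto simp: A intro!: mult_nonneg_nonneg prod_list_map_nonneg)
  also have "\<dots> = C * (\<Sum>v\<in>{v \<in> words k P. \<not> distinct (map id v)}. prod_list (map ?u v))"
    by (simp only: sum_distrib_left)
  also have "(\<Sum>v\<in>{v \<in> words k P. \<not> distinct (map id v)}. prod_list (map ?u v)) \<le> (real k)^2 * \<epsilon> * V ^ k"
  proof (rule sum_colliding_words_le)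
    show "sum ?u P \<le> V"
      using variation_leD[OF V(1) interval_partitions_subset_families[OF P order_refl]] .
    fix J assume J: "J \<in> P"
    then have "{K \<in> P. id K = id J} = {J}" by auto
    moreover have "{J} \<in> interval_families J"
      using interval_partitionsD(3)[OF P J] by (simp add: interval_families_def subintervals_def)
    ultimately show "sum ?u {K \<in> P. id K = id J} \<le> \<epsilon>"
      using variation_leD[of \<phi> J \<epsilon>] fine J by metis
  qed (use fin V \<open>0 \<le> \<epsilon>\<close> in auto)
  finally show ?thesis using \<open>0 \<le> C\<close> by (simp add: mult_left_mono)
qed

text \<open>Pulled back to \<open>Q\<close>, the coarse sum has coefficients that test the order of
  coarse blocks. They agree with the fine ones unless two letters lie in one coarse block, so the
  difference is a sum over colliding words for \<open>\<pi>\<close>.\<close>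

lemma norm_inc_sum_refine_le:
  fixes \<phi> :: "real set \<Rightarrow> 'a::real_normed_algebra_1"
  assumes \<phi>: "is_interval_measure I \<phi>"
    and P: "P \<in> interval_partitions I" and Q: "Q \<in> interval_partitions I" and QP: "refines I Q P"
    and V: "variation_le \<phi> I V" "1 \<le> V" and fine: "\<forall>J\<in>P. variation_le \<phi> J \<epsilon>" and "0 \<le> \<epsilon>"
  shows "norm (inc_sum block_point k \<phi> Q - inc_sum block_point k \<phi> P) \<le> (real k)^2 * \<epsilon> * V ^ k"
proof -
  let ?p = block_point and ?u = "\<lambda>J. norm (\<phi> J)"
  \<comment> \<open>The coarse block around \<open>K\<close>; \<open>\<pi>_eq\<close> shows that the
    choice is forced.\<close>
  define \<pi> where "\<pi> = (\<lambda>K. SOME J. J \<in> P \<and> K \<subseteq> J)"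
  have \<pi>: "\<pi> K \<in> P" "K \<subseteq> \<pi> K" if "K \<in> Q" for K
    using someI_ex[of "\<lambda>J. J \<in> P \<and> K \<subseteq> J"] QP that by (auto simp: \<pi>_def refines_def)
  have \<pi>_eq: "\<pi> K = J \<longleftrightarrow> K \<subseteq> J" if "K \<in> Q" "J \<in> P" for J K
    using \<pi>[OF that(1)] interval_partitionsD(4)[OF Q that(1)] interval_partitionsD(6)[OF P _ that(2)]
    by (metis Int_greatest subset_empty)
  note fin = interval_partitionsD(1)[OF P] interval_partitionsD(1)[OF Q]
  have blocks: "{K \<in> Q. \<pi> K = J} = {K \<in> Q. K \<subseteq> J}" if "J \<in> P" for J
    using \<pi>_eq that by blast
  have blocks_part: "{K \<in> Q. \<pi> K = J} \<in> interval_partitions J" if "J \<in> P" for J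
    unfolding blocks[OF that]
    using refines_obtains_subset[OF QP that] interval_partitionsD(1,3)[OF Q]
    by (auto simp: interval_partitions_def subintervals_def)
  have add: "\<phi> J = (\<Sum>K | K \<in> Q \<and> \<pi> K = J. \<phi> K)" if J: "J \<in> P" for J
  proof -
    have U: "\<Union>{K \<in> Q. \<pi> K = J} = J"
      using interval_partitionsD(2)[OF blocks_part[OF J]] partition_onD1 by blast
    have "\<phi> (\<Union>{K \<in> Q. \<pi> K = J}) = (\<Sum>K | K \<in> Q \<and> \<pi> K = J. \<phi> K)"
    proof (rule interval_measure_finite_additive[OF \<phi>])
      show "disjoint {K \<in> Q. \<pi> K = J}"
        using interval_partitionsD(2)[OF blocks_part[OF J]] partition_onD2 by blast
    qed (use fin interval_partitionsD(3,5)[OF Q] interval_partitionsD(3)[OF P J] U in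
        \<open>auto simp: subintervals_def\<close>)
    then show ?thesis unfolding U .
  qed
  have less: "?p K < ?p K' \<longleftrightarrow> ?p (\<pi> K) < ?p (\<pi> K')" if "K \<in> Q" "K' \<in> Q" "\<pi> K \<noteq> \<pi> K'" for K K'
  proof -
    note K = \<pi>[OF that(1)] and K' = \<pi>[OF that(2)]
    have "?p K \<in> \<pi> K" "?p K' \<in> \<pi> K'"
      using block_point_in interval_partitionsD(4)[OF Q] that K K' by blast+
    then show ?thesis
      using interval_less_cong[OF interval_partitionsD(3)[OF P K(1)] interval_partitionsD(3)[OF P K'(1)]
          interval_partitionsD(6)[OF P K(1) K'(1) that(3)]]
        block_point_in interval_partitionsD(4)[OF P] K(1) K'(1) by blast
  qed
  have asc: "ascending ?p (map \<pi> w) \<longleftrightarrow> ascending ?p w" if "w \<in> words k Q" "distinct (map \<pi> w)" for w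
  proof -
    have "?p (w ! i) < ?p (w ! j) \<longleftrightarrow> ?p (\<pi> (w ! i)) < ?p (\<pi> (w ! j))" if "i < j" "j < length w" for i j
    proof (rule less)
      show "w ! i \<in> Q" "w ! j \<in> Q" using that \<open>w \<in> words k Q\<close> by (auto simp: words_def)
      show "\<pi> (w ! i) \<noteq> \<pi> (w ! j)"
        using that \<open>distinct (map \<pi> w)\<close> nth_eq_iff_index_eq[of "map \<pi> w" i j] by auto
    qed
    then show ?thesis by (auto simp: ascending_def sorted_wrt_map sorted_wrt_iff_nth_less)
  qed
  have sum_P: "inc_sum ?p k \<phi> P = word_sum (\<lambda>w. of_bool (ascending ?p (map \<pi> w))) k \<phi> Q"
    by (rule word_sum_refine[where \<pi> = \<pi> and Q = Q and P = P]) (use fin \<pi>(1) add in auto)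
  have "inc_sum ?p k \<phi> Q - inc_sum ?p k \<phi> P
      = (\<Sum>w\<in>words k Q. (of_bool (ascending ?p w) - of_bool (ascending ?p (map \<pi> w))) *\<^sub>R prod_list (map \<phi> w))"
    unfolding sum_P by (simp add: word_sum_def scaleR_left.diff sum_subtractf)
  also have "norm \<dots> \<le> (\<Sum>w\<in>words k Q. of_bool (\<not> distinct (map \<pi> w)) * prod_list (map ?u w))"
  proof (rule sum_norm_le)
    fix w assume w: "w \<in> words k Q"
    show "norm ((of_bool (ascending ?p w) - of_bool (ascending ?p (map \<pi> w)) :: real) *\<^sub>R prod_list (map \<phi> w))
        \<le> of_bool (\<not> distinct (map \<pi> w)) * prod_list (map ?u w)"
      using asc[OF w] norm_prod_list_map_le[of \<phi> w] prod_list_map_nonneg[of ?u w] by auto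
  qed
  also have "\<dots> = (\<Sum>w\<in>{w \<in> words k Q. \<not> distinct (map \<pi> w)}. prod_list (map ?u w))"
    using fin by (simp add: sum_filter_of_bool)
  also have "\<dots> \<le> (real k)^2 * \<epsilon> * V ^ k"
  proof (rule sum_colliding_words_le)
    show "sum ?u Q \<le> V"
      using variation_leD[OF V(1) interval_partitions_subset_families[OF Q order_refl]] .
    fix K assume K: "K \<in> Q"
    show "sum ?u {K' \<in> Q. \<pi> K' = \<pi> K} \<le> \<epsilon>"
      using fine \<pi>(1)[OF K] interval_partitions_subset_families[OF blocks_part[OF \<pi>(1)[OF K]] order_refl]
      by (auto intro: variation_leD)
  qed (use fin V \<open>0 \<le> \<epsilon>\<close> in auto)
  finally show ?thesis .
qed

text \<open>Completeness for filters: closeness to one value \<open>f P\<close> makes the image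
  filter Cauchy, and no sequence of partitions has to be chosen.\<close>

lemma ex_limit_of_small_oscillation:
  fixes f :: "'p \<Rightarrow> 'a::banach"
  assumes "F \<noteq> bot" and osc: "\<And>e. 0 < e \<Longrightarrow> \<exists>P. eventually (\<lambda>Q. norm (f Q - f P) \<le> e) F"
  shows "\<exists>L. (f \<longlongrightarrow> L) F"
proof -
  have "cauchy_filter (filtermap f F)"
    unfolding cauchy_filter_metric_filtermap
  proof (intro allI impI)
    fix e :: real assume "0 < e"
    then obtain P where P: "eventually (\<lambda>Q. norm (f Q - f P) \<le> e / 3) F"
      using osc[of "e / 3"] by auto
    have "dist (f x) (f y) < e" if "norm (f x - f P) \<le> e / 3" "norm (f y - f P) \<le> e / 3" for x y
      using norm_triangle_ineq4[of "f x - f P" "f y - f P"] that \<open>0 < e\<close> by (simp add: dist_norm)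
    then show "\<exists>R. eventually R F \<and> (\<forall>x y. R x \<and> R y \<longrightarrow> dist (f x) (f y) < e)"
      using P by blast
  qed
  moreover have "filtermap f F \<noteq> bot" using \<open>F \<noteq> bot\<close> by (simp add: filtermap_bot_iff)
  ultimately have "\<exists>L. filtermap f F \<le> nhds L"
    by (intro cauchy_filter_complete_converges[OF _ complete_UNIV]) auto
  then show ?thesis by (simp add: filterlim_def)
qed

section \<open>Convergence of ordered sums\<close>


lemma word_sum_of_bool:
  "finite S \<Longrightarrow> word_sum (\<lambda>w. of_bool (R w)) k f S = (\<Sum>w\<in>{w \<in> words k S. R w}. prod_list (map f w))"
  unfolding word_sum_def by (subst sum.inter_filter) (auto intro: sum.cong)

text \<open>Taylor coefficients of E (1 + (1 - l) E)^{-1} for E = sum of \<open>a k\<close> t^k,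
  read off from M = E - (1 - l) M E. For n \<ge> 1 the constant term \<open>a 0\<close> does not
  occur, and each coefficient is a polynomial in l and finitely many \<open>a k\<close>.\<close>

fun magnus_coeff :: "(nat \<Rightarrow> 'a::real_algebra_1) \<Rightarrow> real \<Rightarrow> nat \<Rightarrow> 'a" where
  "magnus_coeff a l n = a n - (1 - l) *\<^sub>R (\<Sum>i\<in>{1..<n}. magnus_coeff a l i * a (n - i))"

declare magnus_coeff.simps [simp del]

lemma word_sum_descent_weight_eq_magnus_coeff:
  "finite S \<Longrightarrow> 1 \<le> n \<Longrightarrow>
    word_sum (descent_weight p l) n f S = magnus_coeff (\<lambda>k. inc_sum p k f S) l n"
proof (induction n rule: less_induct)
  case (less n)
  then show ?case
    by (subst word_sum_descent_weight, simp, simp, subst magnus_coeff.simps) (auto intro!: sum.cong)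
qed

lemma continuous_on_magnus_coeff:
  fixes a :: "nat \<Rightarrow> 'a::real_normed_algebra_1"
  shows "continuous_on S (\<lambda>l. magnus_coeff a l n)"
proof (induction n rule: less_induct)
  case (less n)
  show ?case
    by (subst magnus_coeff.simps) (intro continuous_intros less, auto)
qed

lemma bounded_magnus_coeff:
  fixes a :: "nat \<Rightarrow> 'a::real_normed_algebra_1"
  shows "bounded ((\<lambda>l. magnus_coeff a l n) ` {0..1})"
  by (intro compact_imp_bounded compact_continuous_image continuous_on_magnus_coeff) auto

lemma uniform_limit_sum:
  fixes f :: "'i \<Rightarrow> 'p \<Rightarrow> 'b \<Rightarrow> 'a::real_normed_vector"
  assumes "\<And>i. i \<in> A \<Longrightarrow> uniform_limit X (f i) (g i) F"
  shows "uniform_limit X (\<lambda>P x. \<Sum>i\<in>A. f i P x) (\<lambda>x. \<Sum>i\<in>A. g i x) F"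
  using assms
  by (induction A rule: infinite_finite_induct) (auto intro!: uniform_limit_intros uniform_limit_const)

lemma uniform_limit_constI:
  "(f \<longlongrightarrow> L) F \<Longrightarrow> uniform_limit X (\<lambda>P x. f P) (\<lambda>x. L) F"
  by (auto simp: uniform_limit_iff tendsto_iff elim!: eventually_mono)

text \<open>Finitely many sums and products preserve uniform limits, given that the limit functions
  are bounded on [0, 1]. Uniformity is what later allows integration over l in the limit.\<close>

lemma uniform_limit_magnus_coeff:
  fixes a :: "'p \<Rightarrow> nat \<Rightarrow> 'a::real_normed_algebra_1"
  assumes "\<And>n. ((\<lambda>P. a P n) \<longlongrightarrow> b n) F"
  shows "uniform_limit {0..1} (\<lambda>P l. magnus_coeff (a P) l n) (\<lambda>l. magnus_coeff b l n) F"
proof (induction n rule: less_induct)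
  case (less n)
  have "uniform_limit {0..1}
      (\<lambda>P l. a P n - (1 - l) *\<^sub>R (\<Sum>i\<in>{1..<n}. magnus_coeff (a P) l i * a P (n - i)))
      (\<lambda>l. b n - (1 - l) *\<^sub>R (\<Sum>i\<in>{1..<n}. magnus_coeff b l i * b (n - i))) F"
  proof (intro uniform_limit_intros uniform_limit_sum uniform_limit_constI assms less bounded_magnus_coeff)
    show "bounded ((\<lambda>l. \<Sum>i\<in>{1..<n}. magnus_coeff b l i * b (n - i)) ` {0..1::real})"
      by (intro compact_imp_bounded compact_continuous_image continuous_intros continuous_on_magnus_coeff) auto
    show "bounded ((\<lambda>l. 1 - l) ` {0..1::real})"
      by (intro compact_imp_bounded compact_continuous_image continuous_intros) auto
  qed (auto simp: image_constant_conv)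
  then show ?case by (subst (1 2) magnus_coeff.simps)
qed

section \<open>Integration over l: the beta integral\<close>

lemma asc_plus_des:
  assumes "\<sigma> permutes {..<k}"
  shows "asc k \<sigma> + des k \<sigma> = k - 1"
proof -
  have fin: "finite {i. Suc i < k}" by (rule finite_subset[of _ "{..<k}"]) auto
  have "\<sigma> i < \<sigma> (Suc i) \<longleftrightarrow> \<not> \<sigma> i > \<sigma> (Suc i)" for i
    using permutes_inj[OF assms] by (auto simp: inj_def not_less order.order_iff_strict) (metis n_not_Suc_n)
  then have eq: "{i. Suc i < k} = {i. Suc i < k \<and> \<sigma> i < \<sigma> (Suc i)} \<union> {i. Suc i < k \<and> \<sigma> i > \<sigma> (Suc i)}"
    by auto
  have "card {i. Suc i < k} = asc k \<sigma> + des k \<sigma>"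
    unfolding asc_def des_def
  proof (subst eq, rule card_Un_disjoint)
    show "finite {i. Suc i < k \<and> \<sigma> i < \<sigma> (Suc i)}" "finite {i. Suc i < k \<and> \<sigma> i > \<sigma> (Suc i)}"
      by (rule finite_subset[OF _ fin]; auto)+
    show "{i. Suc i < k \<and> \<sigma> i < \<sigma> (Suc i)} \<inter> {i. Suc i < k \<and> \<sigma> i > \<sigma> (Suc i)} = {}" by auto
  qed
  moreover have "{i. Suc i < k} = {..<k - 1}" by auto
  ultimately show ?thesis by simp
qed

text \<open>Integration by parts lowers the exponent of l - 1 and raises that of l, hence the
  induction on \<open>d\<close> for all \<open>a\<close>.\<close>

lemma has_integral_beta:
  "((\<lambda>l::real. l ^ a * (l - 1) ^ d) has_integral ((-1) ^ d * (fact a * fact d / fact (a + d + 1)))) {0..1}"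
proof (induction d arbitrary: a)
  case 0
  have "((\<lambda>l::real. l ^ a * (l - 1) ^ 0) has_integral (1 ^ Suc a / Suc a - 0 ^ Suc a / Suc a)) {0..1}"
    by (rule fundamental_theorem_of_calculus)
      (auto intro!: derivative_eq_intros simp flip: has_real_derivative_iff_has_vector_derivative simp del: power_Suc)
  then show ?case by (simp add: divide_simps)
next
  case (Suc d)
  \<comment> \<open>The integrand is the derivative of l^(a + 1) (l - 1)^(d + 1), which vanishes at
    both ends.\<close>
  have "((\<lambda>l::real. (a + 1) * (l ^ a * (l - 1) ^ Suc d) + (d + 1) * (l ^ Suc a * (l - 1) ^ d)) has_integral
      (1 ^ Suc a * (1 - 1) ^ Suc d - 0 ^ Suc a * (0 - 1) ^ Suc d)) {0..1}"
    by (rule fundamental_theorem_of_calculus)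
      (auto intro!: derivative_eq_intros simp: algebra_simps simp flip: has_real_derivative_iff_has_vector_derivative
        simp del: power_Suc)
  from has_integral_diff[OF this has_integral_mult_right[OF Suc[of "Suc a"], of "d + 1"]]
  have "((\<lambda>l::real. (a + 1) * (l ^ a * (l - 1) ^ Suc d)) has_integral
      (0 - (d + 1) * ((-1) ^ d * (fact (Suc a) * fact d / fact (Suc a + d + 1))))) {0..1}"
    by simp
  from has_integral_mult_right[OF this, of "1 / (a + 1)"]
  have "((\<lambda>l::real. l ^ a * (l - 1) ^ Suc d) has_integral
      1 / (a + 1) * (0 - (d + 1) * ((-1) ^ d * (fact (Suc a) * fact d / fact (Suc a + d + 1))))) {0..1}"
    by (rule has_integral_eq[rotated]) simp
  moreover have eq: "1 / real (a + 1) * (0 - (d + 1) * ((-1) ^ d * (fact (Suc a) * fact d / F)))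
      = (-1) ^ Suc d * (fact a * fact (Suc d) / F)" for F :: real
    by (simp add: divide_simps)
  moreover have "Suc a + d + 1 = a + Suc d + 1" by simp
  ultimately show ?case by (simp only: eq)
qed

text \<open>For a nonempty list the exponents satisfy asc + des + 1 = k, so the beta integral of
  each coefficient of \<open>mu_lam\<close> is the coefficient of \<open>mu\<close>.\<close>

lemma has_integral_mu_lam:
  fixes Xs :: "'a::real_normed_algebra_1 list"
  assumes "Xs \<noteq> []"
  shows "((\<lambda>l. mu_lam l Xs) has_integral mu Xs) {0..1}"
  unfolding mu_lam_def mu_def Let_def
proof (intro has_integral_sum has_integral_scaleR_left)
  fix \<sigma> assume "\<sigma> \<in> {\<sigma>. \<sigma> permutes {..<length Xs}}"
  then have "asc (length Xs) \<sigma> + des (length Xs) \<sigma> + 1 = length Xs"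
    using asc_plus_des[of \<sigma> "length Xs"] assms by simp
  from has_integral_beta[of "asc (length Xs) \<sigma>" "des (length Xs) \<sigma>", unfolded this]
  show "((\<lambda>l::real. l ^ asc (length Xs) \<sigma> * (l - 1) ^ des (length Xs) \<sigma>) has_integral
      (- 1) ^ des (length Xs) \<sigma> * (fact (asc (length Xs) \<sigma>) * fact (des (length Xs) \<sigma>) / fact (length Xs))) {0..1}" .
qed (simp add: finite_permutations)

lemma continuous_on_mu_lam: "continuous_on S (\<lambda>l. mu_lam l (Xs :: 'a::real_normed_algebra_1 list))"
  unfolding mu_lam_def Let_def by (intro continuous_intros)

locale continuous_interval_measure =
  fixes I :: "real set" and \<phi> :: "real set \<Rightarrow> 'a::{real_normed_algebra_1, banach}" and V :: real
  assumes interval: "is_interval I" and bounded: "bounded I" and measure: "is_interval_measure I \<phi>"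
    and continuous: "continuous_measure I \<phi>" and V: "variation_le \<phi> I V" "1 \<le> V"
begin

abbreviation "\<F> \<equiv> refinement_filter I"

lemma eventually_fine:
  assumes "0 < \<epsilon>"
  shows "eventually (\<lambda>P. P \<in> interval_partitions I \<and> (\<forall>J\<in>P. variation_le \<phi> J \<epsilon>)) \<F>"
proof -
  obtain P where P: "P \<in> interval_partitions I" "\<forall>J\<in>P. variation_le \<phi> J \<epsilon>"
    using ex_fine_partition[OF interval bounded measure continuous V(1) assms] by blast
  then have "\<forall>J\<in>Q. variation_le \<phi> J \<epsilon>" if "refines I Q P" for Q
    using that unfolding refines_def by (meson variation_le_subset)
  then show ?thesis unfolding eventually_refinement_filter[OF interval] using P by blast
qed

lemma eventually_partition: "eventually (\<lambda>P. P \<in> interval_partitions I) \<F>"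
  using eventually_fine[of 1] by (auto elim: eventually_mono)

lemma tendsto_of_fine:
  fixes f :: "real set set \<Rightarrow> 'b::real_normed_vector"
  assumes "0 \<le> C" "\<And>P \<epsilon>. P \<in> interval_partitions I \<Longrightarrow> \<forall>J\<in>P. variation_le \<phi> J \<epsilon> \<Longrightarrow> 0 < \<epsilon> \<Longrightarrow>
    norm (f P) \<le> C * \<epsilon>"
  shows "(f \<longlongrightarrow> 0) \<F>"
proof (rule tendstoI)
  fix e :: real assume e: "0 < e"
  define \<epsilon> where "\<epsilon> = e / (C + 1)"
  have \<epsilon>: "0 < \<epsilon>" "C * \<epsilon> < e" using e assms(1) by (auto simp: \<epsilon>_def field_simps)
  show "eventually (\<lambda>P. dist (f P) 0 < e) \<F>"
    using eventually_fine[OF \<epsilon>(1)]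
    by (rule eventually_mono) (use assms(2) \<epsilon> in \<open>fastforce simp: dist_norm\<close>)
qed

lemma ex_inc_sum_limit: "\<exists>L. (inc_sum block_point k \<phi> \<longlongrightarrow> L) \<F>"
proof (rule ex_limit_of_small_oscillation[OF refinement_filter_neq_bot[OF interval]])
  fix e :: real assume e: "0 < e"
  \<comment> \<open>Chosen so that k^2 \<epsilon> V^k \<le> e; the added 1 covers k = 0.\<close>
  define \<epsilon> where "\<epsilon> = e / (((real k)^2 + 1) * V ^ k)"
  have Vk: "0 < V ^ k" using V by simp
  then have \<epsilon>: "0 < \<epsilon>" using e by (auto simp: \<epsilon>_def intro!: divide_pos_pos mult_pos_pos add_nonneg_pos)
  have "(real k)^2 * \<epsilon> * V ^ k = e * ((real k)^2 / ((real k)^2 + 1))"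
    using V by (auto simp: \<epsilon>_def)
  also have "\<dots> \<le> e * 1"
    using e by (intro mult_left_mono) (auto simp: divide_simps add_nonneg_pos)
  finally have le: "(real k)^2 * \<epsilon> * V ^ k \<le> e" by simp
  obtain P where P: "P \<in> interval_partitions I" "\<forall>J\<in>P. variation_le \<phi> J \<epsilon>"
    using ex_fine_partition[OF interval bounded measure continuous V(1) \<epsilon>] by blast
  show "\<exists>P. eventually (\<lambda>Q. norm (inc_sum block_point k \<phi> Q - inc_sum block_point k \<phi> P) \<le> e) \<F>"
    unfolding eventually_refinement_filter[OF interval]
    using norm_inc_sum_refine_le[OF measure P(1) _ _ V P(2), of _ k] \<epsilon> le P(1)
    by (intro exI[of _ P] bexI[of _ P]) (auto intro: order_trans)
qed

text \<open>Taken over strictly ascending words because the cutting recursion is stated for them;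
  \<open>ordered_integral_prod_list\<close> identifies the limit with the ordered integral.\<close>

definition iter_int :: "nat \<Rightarrow> 'a" where "iter_int k = Lim \<F> (inc_sum block_point k \<phi>)"

lemma inc_sum_tendsto: "(inc_sum block_point k \<phi> \<longlongrightarrow> iter_int k) \<F>"
  unfolding iter_int_def using ex_inc_sum_limit tendsto_Lim[OF refinement_filter_neq_bot[OF interval]] by metis

lemma uniform_limit_magnus_inc_sum:
  "uniform_limit {0..1} (\<lambda>P l. magnus_coeff (\<lambda>j. inc_sum block_point j \<phi> P) l k)
    (\<lambda>l. magnus_coeff iter_int l k) \<F>"
  by (rule uniform_limit_magnus_coeff) (rule inc_sum_tendsto)

lemma sum_norm_le_V: "P \<in> interval_partitions I \<Longrightarrow> (\<Sum>J\<in>P. norm (\<phi> J)) \<le> V"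
  using variation_leD[OF V(1) interval_partitions_subset_families[OF _ order_refl]] .

lemma norm_iter_int_le: "norm (iter_int k) \<le> V ^ k / fact k"
proof (rule tendsto_upperbound[OF tendsto_norm[OF inc_sum_tendsto] _ refinement_filter_neq_bot[OF interval]])
  show "eventually (\<lambda>P. norm (inc_sum block_point k \<phi> P) \<le> V ^ k / fact k) \<F>"
    using eventually_partition
  proof (rule eventually_mono)
    fix P assume P: "P \<in> interval_partitions I"
    note fin = interval_partitionsD(1)[OF P]
    let ?A = "{w \<in> words k P. ascending block_point w}"
    have "norm (inc_sum block_point k \<phi> P) \<le> (\<Sum>w\<in>?A. prod_list (map (\<lambda>J. norm (\<phi> J)) w))"
      unfolding word_sum_of_bool[OF fin] by (intro sum_norm_le norm_prod_list_map_le)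
    moreover have "fact k * (\<Sum>w\<in>?A. prod_list (map (\<lambda>J. norm (\<phi> J)) w)) \<le> V ^ k"
      using fact_sum_ascending_le[OF fin inj_on_block_point[OF P], of "\<lambda>J. norm (\<phi> J)" k]
        power_mono[OF sum_norm_le_V[OF P], of k] by (force simp: sum_nonneg)
    ultimately show "norm (inc_sum block_point k \<phi> P) \<le> V ^ k / fact k"
      by (simp add: field_simps) (smt (verit) fact_gt_zero mult_left_mono)
  qed
qed

lemma ordered_sum_prod_list_tendsto: "(ordered_sum prod_list k \<phi> \<longlongrightarrow> iter_int k) \<F>"
proof -
  have "((\<lambda>P. ordered_sum prod_list k \<phi> P - inc_sum block_point k \<phi> P) \<longlongrightarrow> 0) \<F>"
  proof (rule tendsto_of_fine[where C = "(real k)^2 * V ^ k"])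
    fix P \<epsilon> assume P: "P \<in> interval_partitions I" "\<forall>J\<in>P. variation_le \<phi> J \<epsilon>" "0 < \<epsilon>"
    then show "norm (ordered_sum prod_list k \<phi> P - inc_sum block_point k \<phi> P) \<le> (real k)^2 * V ^ k * \<epsilon>"
      using norm_ordered_sum_diff_le[OF P(1) V P(2), of 1 k prod_list] norm_prod_list_map_le[of \<phi>]
      by (simp add: word_sum_of_bool interval_partitionsD(1) ac_simps)
  qed (use V in simp)
  from tendsto_add[OF this inc_sum_tendsto[of k]] show ?thesis by simp
qed

lemma ordered_integral_prod_list: "ordered_integral I prod_list k \<phi> = iter_int k"
  unfolding ordered_integral_def
  by (rule tendsto_Lim[OF refinement_filter_neq_bot[OF interval] ordered_sum_prod_list_tendsto])

text \<open>All words, weighted by at most 1 in absolute value, give a total of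
  \<open>V ^ k\<close>. This is too weak at t = 1 but yields, for all l at once, a power series that
  converges near t = 0.\<close>

lemma norm_magnus_coeff_le:
  assumes l: "l \<in> {0..1}" and "1 \<le> k"
  shows "norm (magnus_coeff iter_int l k) \<le> V ^ k"
proof -
  have "((\<lambda>P. magnus_coeff (\<lambda>j. inc_sum block_point j \<phi> P) l k) \<longlongrightarrow> magnus_coeff iter_int l k) \<F>"
    using tendsto_uniform_limitI[OF uniform_limit_magnus_inc_sum l] .
  then show ?thesis
  proof (rule tendsto_upperbound[OF tendsto_norm _ refinement_filter_neq_bot[OF interval]])
    show "eventually (\<lambda>P. norm (magnus_coeff (\<lambda>j. inc_sum block_point j \<phi> P) l k) \<le> V ^ k) \<F>"
      using eventually_partition
    proof (rule eventually_mono)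
      fix P assume P: "P \<in> interval_partitions I"
      have "norm (word_sum (descent_weight block_point l) k \<phi> P)
          \<le> (\<Sum>w\<in>words k P. prod_list (map (\<lambda>J. norm (\<phi> J)) w))"
        unfolding word_sum_def
      proof (rule sum_norm_le)
        fix w
        show "norm (descent_weight block_point l w *\<^sub>R prod_list (map \<phi> w))
            \<le> prod_list (map (\<lambda>J. norm (\<phi> J)) w)"
          using mult_mono[OF abs_descent_weight_le[OF l] norm_prod_list_map_le[of \<phi> w]] by simp
      qed
      also have "\<dots> \<le> V ^ k"
        unfolding sum_words_prod_list using sum_norm_le_V[OF P] by (intro power_mono) (auto simp: sum_nonneg)
      finally show "norm (magnus_coeff (\<lambda>j. inc_sum block_point j \<phi> P) l k) \<le> V ^ k"
        using word_sum_descent_weight_eq_magnus_coeff[OF interval_partitionsD(1)[OF P] \<open>1 \<le> k\<close>] by metis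
    qed
  qed
qed

text \<open>Both sums are compared with the one over words without repetition: the Magnus sum
  differs by weakly ordered tuples with a repeated block (factor \<open>fact k\<close>), the full
  word sum by words with a repeated block (factor 1).\<close>

lemma norm_ordered_sum_mu_lam_diff_le:
  assumes l: "l \<in> {0..1}" and P: "P \<in> interval_partitions I" "\<forall>J\<in>P. variation_le \<phi> J \<epsilon>" "0 < \<epsilon>"
  shows "norm (ordered_sum (mu_lam l) k \<phi> P - word_sum (descent_weight block_point l) k \<phi> P)
    \<le> (fact k + 1) * ((real k)^2 * \<epsilon> * V ^ k)"
proof -
  let ?D = "\<Sum>w\<in>{w \<in> words k P. distinct w}. descent_weight block_point l w *\<^sub>R prod_list (map \<phi> w)"
  let ?u = "\<lambda>J. norm (\<phi> J)"
  note fin = interval_partitionsD(1)[OF P(1)]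
  have "norm (ordered_sum (mu_lam l) k \<phi> P - ?D) \<le> fact k * ((real k)^2 * \<epsilon> * V ^ k)"
    unfolding sum_mu_lam_ascending[OF inj_on_block_point[OF P(1)], symmetric]
    by (rule norm_ordered_sum_diff_le[OF P(1) V P(2)]) (use P(3) norm_mu_lam_le[OF l, of \<phi>] in auto)
  moreover have "norm (word_sum (descent_weight block_point l) k \<phi> P - ?D) \<le> (real k)^2 * \<epsilon> * V ^ k"
  proof -
    let ?B = "{w \<in> words k P. \<not> distinct (map id w)}"
    have "word_sum (descent_weight block_point l) k \<phi> P - ?D
        = (\<Sum>w\<in>words k P - {w \<in> words k P. distinct w}. descent_weight block_point l w *\<^sub>R prod_list (map \<phi> w))"
      unfolding word_sum_def by (rule sum_diff[symmetric]) (use fin in auto)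
    also have "words k P - {w \<in> words k P. distinct w} = ?B" by auto
    also have "norm (\<Sum>w\<in>?B. descent_weight block_point l w *\<^sub>R prod_list (map \<phi> w))
        \<le> (\<Sum>w\<in>?B. prod_list (map ?u w))"
    proof (rule sum_norm_le)
      fix w
      show "norm (descent_weight block_point l w *\<^sub>R prod_list (map \<phi> w)) \<le> prod_list (map ?u w)"
        using mult_mono[OF abs_descent_weight_le[OF l] norm_prod_list_map_le[of \<phi> w]] by simp
    qed
    also have "\<dots> \<le> (real k)^2 * \<epsilon> * V ^ k"
    proof (rule sum_colliding_words_le)
      fix J assume J: "J \<in> P"
      then have "{K \<in> P. id K = id J} = {J}" by auto
      moreover have "{J} \<in> interval_families J"
        using interval_partitionsD(3)[OF P(1) J] by (simp add: interval_families_def subintervals_def)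
      ultimately show "sum ?u {K \<in> P. id K = id J} \<le> \<epsilon>"
        using variation_leD[of \<phi> J \<epsilon>] P(2) J by metis
    qed (use fin V P(3) sum_norm_le_V[OF P(1)] in auto)
    finally show ?thesis .
  qed
  ultimately show ?thesis
    using norm_triangle_ineq4[of "ordered_sum (mu_lam l) k \<phi> P - ?D"
        "word_sum (descent_weight block_point l) k \<phi> P - ?D"] by (simp add: algebra_simps)
qed

lemma uniform_limit_ordered_sum_mu_lam:
  assumes "1 \<le> k"
  shows "uniform_limit {0..1} (\<lambda>P l. ordered_sum (mu_lam l) k \<phi> P) (\<lambda>l. magnus_coeff iter_int l k) \<F>"
proof -
  have *: "uniform_limit {0..1} (\<lambda>P l. ordered_sum (mu_lam l) k \<phi> P
      - magnus_coeff (\<lambda>j. inc_sum block_point j \<phi> P) l k) (\<lambda>l. 0) \<F>"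
    unfolding uniform_limit_iff
  proof (intro allI impI)
    fix e :: real assume e: "0 < e"
    define C where "C = (fact k + 1) * ((real k)^2 * V ^ k)"
    define \<epsilon> where "\<epsilon> = e / (C + 1)"
    have "0 \<le> C" using V by (simp add: C_def)
    then have \<epsilon>: "0 < \<epsilon>" "C * \<epsilon> < e" using e by (auto simp: \<epsilon>_def field_simps)
    show "\<forall>\<^sub>F P in \<F>. \<forall>l\<in>{0..1}. dist (ordered_sum (mu_lam l) k \<phi> P
        - magnus_coeff (\<lambda>j. inc_sum block_point j \<phi> P) l k) 0 < e"
      using eventually_fine[OF \<epsilon>(1)]
    proof (rule eventually_mono, intro ballI)
      fix P and l :: real
      assume P: "P \<in> interval_partitions I \<and> (\<forall>J\<in>P. variation_le \<phi> J \<epsilon>)" and l: "l \<in> {0..1}"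
      show "dist (ordered_sum (mu_lam l) k \<phi> P - magnus_coeff (\<lambda>j. inc_sum block_point j \<phi> P) l k) 0 < e"
        using norm_ordered_sum_mu_lam_diff_le[OF l _ _ \<epsilon>(1), of P k] \<epsilon>(2) P
          word_sum_descent_weight_eq_magnus_coeff[OF interval_partitionsD(1) assms, of P I block_point l \<phi>]
        by (simp add: dist_norm C_def algebra_simps)
    qed
  qed
  from uniform_limit_add[OF * uniform_limit_magnus_inc_sum[of k]]
  show ?thesis by simp
qed

lemma mu_lam_R_eq: "l \<in> {0..1} \<Longrightarrow> 1 \<le> k \<Longrightarrow> mu_lam_R l k I \<phi> = magnus_coeff iter_int l k"
  unfolding mu_lam_R_def ordered_integral_def
  by (intro tendsto_Lim refinement_filter_neq_bot[OF interval]
      tendsto_uniform_limitI[OF uniform_limit_ordered_sum_mu_lam])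

text \<open>On a fixed partition \<open>mu_lam\<close> integrates to \<open>mu\<close>. Uniform
  convergence in l carries this to the limit and yields the convergence behind \<open>mu_R\<close>
  at the same time.\<close>

lemma has_integral_magnus_coeff:
  assumes "1 \<le> k"
  shows "((\<lambda>l. magnus_coeff iter_int l k) has_integral mu_R k I \<phi>) {0..1}"
proof -
  have cont: "continuous_on (cbox 0 1) (\<lambda>l. ordered_sum (mu_lam l) k \<phi> P)" for P
    unfolding ordered_sum_def by (intro continuous_intros continuous_on_mu_lam)
  have unif: "uniform_limit (cbox 0 1) (\<lambda>P l. ordered_sum (mu_lam l) k \<phi> P)
      (\<lambda>l. magnus_coeff iter_int l k) \<F>"
    using uniform_limit_ordered_sum_mu_lam[OF assms] by (simp add: cbox_interval)
  obtain A B where A: "\<And>P. ((\<lambda>l. ordered_sum (mu_lam l) k \<phi> P) has_integral A P) (cbox 0 1)"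
    and B: "((\<lambda>l. magnus_coeff iter_int l k) has_integral B) (cbox 0 1)" "(A \<longlongrightarrow> B) \<F>"
    using uniform_limit_integral_cbox[OF unif cont refinement_filter_neq_bot[OF interval]] by blast
  \<comment> \<open>\<open>A\<close> is identified for finite \<open>P\<close> only, which is enough
    along the filter.\<close>
  have "A P = ordered_sum mu k \<phi> P" if P: "finite P" for P
  proof (rule has_integral_unique[OF A])
    have "finite {Js. set Js \<subseteq> P \<and> length Js = k \<and> sorted_wrt interval_le Js}"
      by (rule finite_subset[OF _ finite_lists_length_eq[OF P, of k]]) auto
    then show "((\<lambda>l. ordered_sum (mu_lam l) k \<phi> P) has_integral ordered_sum mu k \<phi> P) (cbox 0 1)"
      unfolding ordered_sum_def cbox_interval using assms
      by (intro has_integral_sum has_integral_mu_lam) auto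
  qed
  then have "eventually (\<lambda>P. A P = ordered_sum mu k \<phi> P) \<F>"
    using eventually_partition by (auto elim!: eventually_mono dest: interval_partitionsD(1))
  then have "(ordered_sum mu k \<phi> \<longlongrightarrow> B) \<F>"
    using tendsto_cong[of A "ordered_sum mu k \<phi>" \<F> B] B(2) by blast
  then have "mu_R k I \<phi> = B"
    unfolding mu_R_def ordered_integral_def
    by (intro tendsto_Lim refinement_filter_neq_bot[OF interval])
  then show ?thesis using B(1) by (simp add: cbox_interval)
qed

end

section \<open>Calculus in complex Banach algebras\<close>


lemma is_inverse_unique: "is_inverse x y \<Longrightarrow> is_inverse x z \<Longrightarrow> y = z"
  unfolding is_inverse_def by (metis mult.assoc mult.left_neutral mult.right_neutral)

lemma alg_inverse_eq: "is_inverse x y \<Longrightarrow> alg_inverse x = y"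
  unfolding alg_inverse_def by (blast intro: is_inverse_unique)

lemma is_inverse_mult: "is_inverse x y \<Longrightarrow> is_inverse u v \<Longrightarrow> is_inverse (x * u) (v * y)"
  unfolding is_inverse_def by (metis mult.assoc mult.left_neutral)

lemma is_inverse_one_minus:
  fixes u :: "'a::{real_normed_algebra_1, banach}"
  assumes "norm u < 1"
  shows "is_inverse (1 - u) (\<Sum>n. u ^ n)"
proof -
  have s: "summable (\<lambda>n. u ^ n)" by (rule complete_algebra_summable_geometric[OF assms])
  have "(\<Sum>n. u ^ n) = 1 + (\<Sum>n. u ^ Suc n)" using suminf_split_head[OF s] by simp
  moreover have "(\<Sum>n. u ^ Suc n) = u * (\<Sum>n. u ^ n)" using suminf_mult[OF s, of u] by simp
  moreover have "(\<Sum>n. u ^ Suc n) = (\<Sum>n. u ^ n) * u"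
    using suminf_mult2[OF s, of u] by (simp add: power_Suc2 del: power_Suc)
  ultimately show ?thesis unfolding is_inverse_def by (simp add: algebra_simps)
qed

definition invertibles :: "'a::monoid_mult set"
  where "invertibles = {x. \<exists>y. is_inverse x y}"

lemma is_inverse_alg_inverse: "x \<in> invertibles \<Longrightarrow> is_inverse x (alg_inverse x)"
  using alg_inverse_eq by (auto simp: invertibles_def)

text \<open>Factor x + h = (1 + h y) x and invert the first factor by a Neumann series.\<close>

lemma is_inverse_perturb:
  fixes x :: "'a::{real_normed_algebra_1, banach}"
  assumes xy: "is_inverse x y" and h: "norm h * norm y < 1"
  shows "x + h \<in> invertibles"
proof -
  have "norm (- (h * y)) < 1" using h norm_mult_ineq[of h y] by simp
  from is_inverse_mult[OF is_inverse_one_minus[OF this] xy]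
  have "is_inverse ((1 - (- (h * y))) * x) (y * (\<Sum>n. (- (h * y)) ^ n))" .
  moreover have "(1 - (- (h * y))) * x = x + h"
    using xy by (simp add: is_inverse_def algebra_simps)
  ultimately show ?thesis by (auto simp: invertibles_def)
qed

lemma open_invertibles: "open (invertibles :: 'a::{real_normed_algebra_1, banach} set)"
  unfolding open_dist
proof
  fix x :: 'a assume "x \<in> invertibles"
  then obtain y where y: "is_inverse x y" by (auto simp: invertibles_def)
  have "x' \<in> invertibles" if "dist x' x < 1 / (norm y + 1)" for x'
  proof -
    have "norm (x' - x) * norm y \<le> norm (x' - x) * (norm y + 1)" by (intro mult_left_mono) auto
    also have "\<dots> < 1" using that by (simp add: dist_norm pos_less_divide_eq add_nonneg_pos)
    finally show ?thesis using is_inverse_perturb[OF y, of "x' - x"] by simp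
  qed
  moreover have "0 < 1 / (norm y + 1)" by (simp add: add_nonneg_pos)
  ultimately show "\<exists>e>0. \<forall>x'. dist x' x < e \<longrightarrow> x' \<in> invertibles" by blast
qed

text \<open>The resolvent identity, behind both the continuity and the derivative of
  inversion.\<close>

lemma is_inverse_diff:
  fixes x :: "'a::ring_1"
  assumes "is_inverse x y" "is_inverse x' y'"
  shows "y' - y = - (y' * (x' - x) * y)"
proof -
  have "y' * (x' - x) * y = (y' * x') * y - y' * (x * y)"
    by (simp add: algebra_simps)
  then show ?thesis using assms by (simp add: is_inverse_def)
qed

text \<open>The resolvent identity still contains the inverse of x'; smallness of x' - x bounds its
  norm by twice that of the inverse of x.\<close>

lemma norm_alg_inverse_diff_le:
  fixes x :: "'a::{real_normed_algebra_1, banach}"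
  assumes x: "x \<in> invertibles" and x': "x' \<in> invertibles"
    and small: "norm (x' - x) * norm (alg_inverse x) \<le> 1 / 2"
  shows "norm (alg_inverse x' - alg_inverse x) \<le> 2 * norm (alg_inverse x)^2 * norm (x' - x)"
proof -
  let ?y = "alg_inverse x" and ?y' = "alg_inverse x'"
  have diff: "?y' - ?y = - (?y' * (x' - x) * ?y)"
    using is_inverse_diff is_inverse_alg_inverse x x' by blast
  have "norm (?y' * (x' - x) * ?y) \<le> norm ?y' * norm (x' - x) * norm ?y"
    by (meson mult_right_mono norm_ge_zero norm_mult_ineq order_trans)
  then have le: "norm (?y' - ?y) \<le> norm ?y' * (norm (x' - x) * norm ?y)"
    unfolding diff by (simp add: mult.assoc)
  also have "\<dots> \<le> norm ?y' * (1 / 2)" by (intro mult_left_mono small) auto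
  finally have "norm ?y' \<le> 2 * norm ?y"
    using norm_triangle_ineq2[of ?y' ?y] by simp
  then have "norm ?y' * (norm (x' - x) * norm ?y) \<le> (2 * norm ?y) * (norm (x' - x) * norm ?y)"
    by (intro mult_right_mono) auto
  then show ?thesis using le by (simp add: power2_eq_square algebra_simps)
qed

lemma eventually_norm_alg_inverse_diff_le:
  fixes x :: "'a::{real_normed_algebra_1, banach}"
  assumes x: "x \<in> invertibles"
  shows "eventually (\<lambda>x'. x' \<in> invertibles \<and>
    norm (alg_inverse x' - alg_inverse x) \<le> 2 * norm (alg_inverse x)^2 * norm (x' - x)) (nhds x)"
proof -
  have "((\<lambda>x'. norm (x' - x) * norm (alg_inverse x)) \<longlongrightarrow> norm (x - x) * norm (alg_inverse x)) (nhds x)"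
    by (intro tendsto_intros filterlim_ident)
  then have "eventually (\<lambda>x'. norm (x' - x) * norm (alg_inverse x) < 1 / 2) (nhds x)"
    by (rule order_tendstoD) simp
  moreover have "eventually (\<lambda>x'. x' \<in> invertibles) (nhds x)"
    by (rule eventually_nhds_in_open[OF open_invertibles x])
  ultimately show ?thesis
    by eventually_elim (use norm_alg_inverse_diff_le[OF x] in auto)
qed

lemma tendsto_alg_inverse:
  fixes x :: "'a::{real_normed_algebra_1, banach}"
  assumes x: "x \<in> invertibles"
  shows "(alg_inverse \<longlongrightarrow> alg_inverse x) (nhds x)"
proof (rule Lim_null[THEN iffD2], rule Lim_null_comparison)
  show "eventually (\<lambda>x'. norm (alg_inverse x' - alg_inverse x) \<le> 2 * norm (alg_inverse x)^2 * norm (x' - x)) (nhds x)"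
    using eventually_norm_alg_inverse_diff_le[OF x] by (auto elim: eventually_mono)
  have "((\<lambda>x'. 2 * norm (alg_inverse x)^2 * norm (x' - x)) \<longlongrightarrow> 2 * norm (alg_inverse x)^2 * norm (x - x)) (nhds x)"
    by (intro tendsto_intros filterlim_ident)
  then show "((\<lambda>x'. 2 * norm (alg_inverse x)^2 * norm (x' - x)) \<longlongrightarrow> 0) (nhds x)" by simp
qed

lemma continuous_on_alg_inverse:
  fixes f :: "'c::topological_space \<Rightarrow> 'a::{real_normed_algebra_1, banach}"
  assumes "continuous_on S f" "\<And>t. t \<in> S \<Longrightarrow> f t \<in> invertibles"
  shows "continuous_on S (\<lambda>t. alg_inverse (f t))"
  using assms unfolding continuous_on_def by (blast intro: filterlim_compose[OF tendsto_alg_inverse])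

lemma has_derivative_alg_inverse:
  fixes x :: "'a::{real_normed_algebra_1, banach}"
  assumes x: "x \<in> invertibles"
  shows "(alg_inverse has_derivative (\<lambda>h. - (alg_inverse x * h * alg_inverse x))) (at x)"
proof -
  let ?y = "alg_inverse x"
  have lin: "bounded_linear (\<lambda>h. - (?y * h * ?y))"
    by (intro bounded_linear_minus bounded_linear_mult_const bounded_linear_const_mult bounded_linear_ident)
  have "((\<lambda>x'. norm (alg_inverse x' - ?y - - (?y * (x' - x) * ?y)) / norm (x' - x)) \<longlongrightarrow> 0) (at x)"
  proof (rule Lim_null_comparison)
    show "eventually (\<lambda>x'. norm (norm (alg_inverse x' - ?y - - (?y * (x' - x) * ?y)) / norm (x' - x))
        \<le> norm (alg_inverse x' - ?y) * norm ?y) (at x)"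
      using eventually_nhds_in_open[OF open_invertibles x] unfolding eventually_at_filter
    proof (rule eventually_mono, intro impI)
      fix x' assume x': "x' \<in> invertibles" "x' \<noteq> x"
      \<comment> \<open>After the linear term is subtracted, the remainder has the extra factor
        \<open>alg_inverse x' - ?y\<close>, which tends to 0.\<close>
      have "alg_inverse x' - ?y = - (alg_inverse x' * (x' - x) * ?y)"
        using is_inverse_diff is_inverse_alg_inverse x x' by blast
      then have "alg_inverse x' - ?y - - (?y * (x' - x) * ?y) = - ((alg_inverse x' - ?y) * (x' - x) * ?y)"
        by (simp add: algebra_simps)
      also have "norm \<dots> \<le> norm (alg_inverse x' - ?y) * norm (x' - x) * norm ?y"
        unfolding norm_minus_cancel by (meson mult_right_mono norm_ge_zero norm_mult_ineq order_trans)
      finally show "norm (norm (alg_inverse x' - ?y - - (?y * (x' - x) * ?y)) / norm (x' - x))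
          \<le> norm (alg_inverse x' - ?y) * norm ?y"
        using x' by (simp add: field_simps)
    qed
    have "((\<lambda>x'. norm (alg_inverse x' - ?y) * norm ?y) \<longlongrightarrow> norm (?y - ?y) * norm ?y) (at x)"
      by (intro tendsto_intros tendsto_mono[OF at_within_le_nhds tendsto_alg_inverse[OF x]])
    then show "((\<lambda>x'. norm (alg_inverse x' - ?y) * norm ?y) \<longlongrightarrow> 0) (at x)" by simp
  qed
  then show ?thesis using lin by (simp add: has_derivative_iff_norm)
qed

section \<open>Complex scalars and complex derivatives\<close>

lemma bounded_bilinear_scaleC:
  "bounded_bilinear (scaleC :: complex \<Rightarrow> 'b::complex_banach_algebra_1 \<Rightarrow> 'b)"
proof
  fix c d :: complex and x y :: 'b and r :: real
  show "(c + d) *\<^sub>C x = c *\<^sub>C x + d *\<^sub>C x" by (rule scaleC_add_left)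
  show "c *\<^sub>C (x + y) = c *\<^sub>C x + c *\<^sub>C y" by (rule scaleC_add_right)
  show "(r *\<^sub>R c) *\<^sub>C x = r *\<^sub>R (c *\<^sub>C x)"
    by (metis scaleC_of_real scaleC_scaleC scaleR_conv_of_real)
  show "c *\<^sub>C (r *\<^sub>R x) = r *\<^sub>R (c *\<^sub>C x)"
    by (metis mult.commute scaleC_of_real scaleC_scaleC)
  show "\<exists>K. \<forall>c (x :: 'b). norm (c *\<^sub>C x) \<le> norm c * norm x * K"
    by (rule exI[of _ 1]) (simp add: norm_scaleC)
qed

interpretation scaleC: bounded_bilinear "scaleC :: complex \<Rightarrow> 'b::complex_banach_algebra_1 \<Rightarrow> 'b"
  by (rule bounded_bilinear_scaleC)

lemma scaleC_one [simp]: "1 *\<^sub>C (x :: 'b::complex_banach_algebra_1) = x"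
  using scaleC_of_real[of 1 x] by simp

text \<open>Complex differentiability as a real Frechet derivative of a special form, so that the
  rules for real derivatives apply.\<close>

definition has_cderiv :: "(complex \<Rightarrow> 'b::complex_banach_algebra_1) \<Rightarrow> 'b \<Rightarrow> complex \<Rightarrow> bool"
  where "has_cderiv f D z \<longleftrightarrow> (f has_derivative (\<lambda>h. h *\<^sub>C D)) (at z)"

lemma has_cderiv_isCont: "has_cderiv f D z \<Longrightarrow> isCont f z"
  unfolding has_cderiv_def by (rule has_derivative_continuous)

lemma has_cderiv_mult:
  assumes "has_cderiv f D z" "has_cderiv g E z"
  shows "has_cderiv (\<lambda>z. f z * g z) (f z * E + D * g z) z"
  using has_derivative_mult[OF assms[unfolded has_cderiv_def]]
  by (simp add: has_cderiv_def mult_scaleC_left mult_scaleC_right scaleC_add_right)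

lemma has_cderiv_alg_inverse:
  assumes f: "has_cderiv f D z" and inv: "f z \<in> invertibles"
  shows "has_cderiv (\<lambda>z. alg_inverse (f z)) (- (alg_inverse (f z) * D * alg_inverse (f z))) z"
  using has_derivative_compose[OF f[unfolded has_cderiv_def] has_derivative_alg_inverse[OF inv]]
  by (simp add: has_cderiv_def mult_scaleC_left mult_scaleC_right scaleC.minus_right)

lemma has_cderiv_scaleC:
  assumes c: "(c has_field_derivative c') (at z)" and f: "has_cderiv f D z"
  shows "has_cderiv (\<lambda>z. c z *\<^sub>C f z) (c z *\<^sub>C D + c' *\<^sub>C f z) z"
  using scaleC.FDERIV[OF c[unfolded has_field_derivative_def] f[unfolded has_cderiv_def]]
  by (simp add: has_cderiv_def scaleC_add_right scaleC_scaleC mult.commute)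

lemma has_cderiv_compose:
  assumes c: "(c has_field_derivative c') (at z)" and f: "has_cderiv f D (c z)"
  shows "has_cderiv (\<lambda>z. f (c z)) (c' *\<^sub>C D) z"
  using has_derivative_compose[OF c[unfolded has_field_derivative_def] f[unfolded has_cderiv_def]]
  by (simp add: has_cderiv_def scaleC_scaleC mult.commute)

lemma has_cderiv_vector_derivative:
  assumes \<gamma>: "(\<gamma> has_vector_derivative \<gamma>') (at s within S)" and f: "has_cderiv f D (\<gamma> s)"
  shows "((\<lambda>s. f (\<gamma> s)) has_vector_derivative \<gamma>' *\<^sub>C D) (at s within S)"
  using has_derivative_compose[OF \<gamma>[unfolded has_vector_derivative_def] f[unfolded has_cderiv_def]]
  by (simp add: has_vector_derivative_def scaleC.scaleR_left)

text \<open>Cauchy's theorem for concentric circles in the coordinate z = log t. The derivative of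
  the integral in x is the integral of \<open>\<Phi>'\<close>, and up to the factor i this is the
  increment of \<open>\<Phi>\<close> over a period, which is zero.\<close>

lemma integral_vertical_line_const:
  fixes \<Phi> :: "complex \<Rightarrow> 'b::complex_banach_algebra_1"
  assumes deriv: "\<And>z. Re z < b \<Longrightarrow> has_cderiv \<Phi> (\<Phi>' z) z"
    and cont: "continuous_on {z. Re z < b} \<Phi>'" and periodic: "\<And>z. \<Phi> (z + 2 * pi * \<i>) = \<Phi> z"
    and xy: "x < b" "y < b"
  shows "integral (cbox 0 (2 * pi)) (\<lambda>\<theta>. \<Phi> (Complex x \<theta>)) = integral (cbox 0 (2 * pi)) (\<lambda>\<theta>. \<Phi> (Complex y \<theta>))"
proof -
  have dRe: "((\<lambda>x. Complex x \<theta>) has_vector_derivative 1) (at x within S)" for x \<theta> S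
    unfolding Complex_eq has_vector_derivative_def
    by (auto intro!: derivative_eq_intros simp: scaleR_conv_of_real)
  have dIm: "((\<lambda>\<theta>. Complex x \<theta>) has_vector_derivative \<i>) (at \<theta> within S)" for x \<theta> S
    unfolding Complex_eq has_vector_derivative_def
    by (auto intro!: derivative_eq_intros simp: scaleR_conv_of_real)
  have contC: "continuous_on S (\<lambda>p. Complex (fst p) (snd p))" for S
    unfolding Complex_eq by (intro continuous_intros)
  have contC2: "continuous_on S (\<lambda>\<theta>. Complex x \<theta>)" for S x
    unfolding Complex_eq by (intro continuous_intros)
  have zero: "integral (cbox 0 (2 * pi)) (\<lambda>\<theta>. \<Phi>' (Complex x \<theta>)) = 0" if "x < b" for x
  proof -
    have int: "(\<lambda>\<theta>. \<Phi>' (Complex x \<theta>)) integrable_on cbox 0 (2 * pi)"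
      by (intro integrable_continuous continuous_on_compose2[OF cont contC2]) (use that in auto)
    have ftc: "((\<lambda>\<theta>. \<i> *\<^sub>C \<Phi>' (Complex x \<theta>)) has_integral (\<Phi> (Complex x (2 * pi)) - \<Phi> (Complex x 0))) {0..2 * pi}"
      by (rule fundamental_theorem_of_calculus)
        (use that in \<open>auto intro!: has_cderiv_vector_derivative[OF dIm] deriv\<close>)
    have per: "\<Phi> (Complex x (2 * pi)) = \<Phi> (Complex x 0)"
      using periodic[of "Complex x 0"] by (simp add: Complex_eq mult.commute)
    have "((\<lambda>\<theta>. \<i> *\<^sub>C \<Phi>' (Complex x \<theta>)) has_integral
        \<i> *\<^sub>C integral (cbox 0 (2 * pi)) (\<lambda>\<theta>. \<Phi>' (Complex x \<theta>))) (cbox 0 (2 * pi))"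
      using has_integral_linear[OF integrable_integral[OF int] scaleC.bounded_linear_right[of \<i>]] by (simp add: o_def)
    from has_integral_unique[OF this] ftc have "\<i> *\<^sub>C integral (cbox 0 (2 * pi)) (\<lambda>\<theta>. \<Phi>' (Complex x \<theta>)) = 0"
      by (simp add: cbox_interval per)
    then show ?thesis using norm_scaleC[of \<i> "integral (cbox 0 (2 * pi)) (\<lambda>\<theta>. \<Phi>' (Complex x \<theta>))"] by simp
  qed
  have "((\<lambda>x. integral (cbox 0 (2 * pi)) (\<lambda>\<theta>. \<Phi> (Complex x \<theta>))) has_vector_derivative 0) (at x within {..<b})"
    if "x \<in> {..<b}" for x
  proof -
    have "((\<lambda>x. integral (cbox 0 (2 * pi)) (\<lambda>\<theta>. \<Phi> (Complex x \<theta>))) has_vector_derivative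
        integral (cbox 0 (2 * pi)) (\<lambda>\<theta>. \<Phi>' (Complex x \<theta>))) (at x within {..<b})"
    proof (rule leibniz_rule_vector_derivative)
      show "((\<lambda>x. \<Phi> (Complex x \<theta>)) has_vector_derivative \<Phi>' (Complex x \<theta>)) (at x within {..<b})"
        if "x \<in> {..<b}" for x \<theta>
        using has_cderiv_vector_derivative[OF dRe deriv] that by simp
      show "(\<lambda>\<theta>. \<Phi> (Complex x \<theta>)) integrable_on cbox 0 (2 * pi)" if "x \<in> {..<b}" for x
      proof (rule integrable_continuous, rule continuous_on_compose2[OF _ contC2])
        show "continuous_on {z. Re z < b} \<Phi>"
          using deriv by (auto intro!: continuous_at_imp_continuous_on has_cderiv_isCont)
      qed (use that in auto)
      have "continuous_on ({..<b} \<times> cbox 0 (2 * pi)) (\<lambda>p. \<Phi>' (Complex (fst p) (snd p)))"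
        by (rule continuous_on_compose2[OF cont contC]) auto
      then show "continuous_on ({..<b} \<times> cbox 0 (2 * pi)) (\<lambda>(x, \<theta>). \<Phi>' (Complex x \<theta>))"
        by (simp add: case_prod_unfold)
    qed (use that in auto)
    then show ?thesis using zero that by simp
  qed
  from has_vector_derivative_zero_constant[OF convex_real_interval(4) this]
  obtain c where "\<And>x. x \<in> {..<b} \<Longrightarrow> integral (cbox 0 (2 * pi)) (\<lambda>\<theta>. \<Phi> (Complex x \<theta>)) = c" by blast
  then show ?thesis using xy by simp
qed

section \<open>Cauchy estimates\<close>


text \<open>Orthogonality of the characters, which isolates one coefficient of a power
  series.\<close>

lemma has_integral_exp_vertical:
  "((\<lambda>\<theta>. exp (of_int n * Complex x \<theta>)) has_integral (if n = 0 then of_real (2 * pi) else 0)) (cbox 0 (2 * pi))"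
proof (cases "n = 0")
  case True
  then show ?thesis
    using has_integral_const_real[of "1 :: complex" 0 "2 * pi"] by (simp add: cbox_interval scaleR_conv_of_real)
next
  case False
  define f where "f = (\<lambda>w::complex. exp (of_int n * (of_real x + \<i> * w)) / (of_int n * \<i>))"
  have "((\<lambda>\<theta>. f (of_real \<theta>)) has_vector_derivative exp (of_int n * Complex x \<theta>)) (at \<theta> within S)" for \<theta> S
    unfolding f_def Complex_eq using False
    by (intro has_vector_derivative_real_field) (auto intro!: derivative_eq_intros simp: field_simps)
  then have "((\<lambda>\<theta>. exp (of_int n * Complex x \<theta>)) has_integral (f (of_real (2 * pi)) - f (of_real 0))) {0..2 * pi}"
    by (intro fundamental_theorem_of_calculus) auto
  moreover have "f (of_real (2 * pi)) = f (of_real 0)"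
  proof -
    have "exp (of_int n * (of_real x + \<i> * of_real (2 * pi))) = exp (of_int n * of_real x + 2 * of_int n * of_real pi * \<i>)"
      by (simp add: algebra_simps)
    also have "\<dots> = exp (of_int n * of_real x)"
      using exp_integer_2pi[of "of_int n"] by (simp add: exp_add)
    finally show ?thesis by (simp add: f_def)
  qed
  ultimately show ?thesis using False by (simp add: cbox_interval)
qed

text \<open>The expansion of \<open>G\<close> is given only for |t| \<le> s, the bound only for |t|
  = r. The coefficient is the mean of exp(- k z) \<open>G (exp z)\<close> over a small circle, and
  this mean can be moved to radius r.\<close>

lemma cauchy_estimate:
  fixes G :: "complex \<Rightarrow> 'b::complex_banach_algebra_1"
  assumes deriv: "\<And>t. t \<in> ball 0 R \<Longrightarrow> has_cderiv G (G' t) t" and cont: "continuous_on (ball 0 R) G'"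
    and r: "0 < r" "r < R" and bound: "\<And>t. cmod t = r \<Longrightarrow> norm (G t) \<le> M"
    and s: "0 < s" "summable (\<lambda>j. norm (m j) * s ^ j)" "\<And>t. cmod t \<le> s \<Longrightarrow> (\<lambda>j. t ^ j *\<^sub>C m j) sums G t"
  shows "norm (m k) \<le> M / r ^ k"
proof -
  let ?C = "cbox 0 (2 * pi)"
  define \<Phi> where "\<Phi> = (\<lambda>z. exp (- of_nat k * z) *\<^sub>C G (exp z))"
  define \<Phi>' where "\<Phi>' = (\<lambda>z. exp (- of_nat k * z) *\<^sub>C (exp z *\<^sub>C G' (exp z))
      + (- of_nat k * exp (- of_nat k * z)) *\<^sub>C G (exp z))"
  \<comment> \<open>At most \<open>ln s\<close>, where the expansion holds, and at most
    \<open>ln r\<close>, hence below \<open>ln R\<close>.\<close>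
  define y where "y = min (ln s) (ln r)"
  have b: "ln r < ln R" using r by simp
  then have b': "y < ln R" by (simp add: y_def)
  have ball: "exp z \<in> ball 0 R" if "Re z < ln R" for z
  proof -
    have "exp (Re z) < exp (ln R)" using that by (simp only: exp_less_mono)
    then show ?thesis using r by simp
  qed
  have contG: "continuous_on (ball 0 R) G"
    by (intro continuous_at_imp_continuous_on ballI has_cderiv_isCont[OF deriv])
  have eq: "integral ?C (\<lambda>\<theta>. \<Phi> (Complex (ln r) \<theta>)) = integral ?C (\<lambda>\<theta>. \<Phi> (Complex y \<theta>))"
  proof (rule integral_vertical_line_const[OF _ _ _ b b'])
    show "has_cderiv \<Phi> (\<Phi>' z) z" if "Re z < ln R" for z
      unfolding \<Phi>_def \<Phi>'_def
      by (intro has_cderiv_scaleC has_cderiv_compose[where c = exp] deriv ball that)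
        (auto intro!: derivative_eq_intros)
    show "continuous_on {z. Re z < ln R} \<Phi>'"
      unfolding \<Phi>'_def
      by (intro continuous_intros scaleC.continuous_on continuous_on_compose2[OF cont]
          continuous_on_compose2[OF contG]) (use ball in auto)
    have "exp (- of_nat k * w) = inverse (exp w ^ k)" for w :: complex
      by (simp add: exp_minus exp_of_nat_mult)
    moreover have "exp (z + 2 * pi * \<i>) = exp z" for z by (simp add: exp_add)
    ultimately show "\<Phi> (z + 2 * pi * \<i>) = \<Phi> z" for z by (simp only: \<Phi>_def)
  qed
  have upper: "norm (integral ?C (\<lambda>\<theta>. \<Phi> (Complex (ln r) \<theta>))) \<le> M / r ^ k * (2 * pi)"
  proof -
    have c1: "continuous_on ?C (\<lambda>\<theta>. Complex (ln r) \<theta>)" unfolding Complex_eq by (intro continuous_intros)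
    have c2: "continuous_on {z. Re z < ln R} \<Phi>"
      unfolding \<Phi>_def
      by (intro continuous_intros scaleC.continuous_on continuous_on_compose2[OF contG]) (use ball in auto)
    have "continuous_on ?C (\<lambda>\<theta>. \<Phi> (Complex (ln r) \<theta>))"
      by (rule continuous_on_compose2[OF c2 c1]) (use b in auto)
    then have int: "((\<lambda>\<theta>. \<Phi> (Complex (ln r) \<theta>)) has_integral integral ?C (\<lambda>\<theta>. \<Phi> (Complex (ln r) \<theta>))) ?C"
      by (intro integrable_integral integrable_continuous)
    have le: "norm (\<Phi> (Complex (ln r) \<theta>)) \<le> M / r ^ k" for \<theta>
    proof -
      have "norm (\<Phi> (Complex (ln r) \<theta>)) = exp (- (real k * ln r)) * norm (G (exp (Complex (ln r) \<theta>)))"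
        by (simp add: \<Phi>_def norm_scaleC)
      also have "exp (- (real k * ln r)) = 1 / r ^ k"
        using r by (simp add: exp_minus exp_of_nat_mult inverse_eq_divide)
      also have "1 / r ^ k * norm (G (exp (Complex (ln r) \<theta>))) \<le> 1 / r ^ k * M"
        using r by (intro mult_left_mono bound) auto
      finally show ?thesis by simp
    qed
    have "0 \<le> M / r ^ k"
      using bound[of "of_real r"] r by (auto intro!: divide_nonneg_nonneg intro: order_trans[OF norm_ge_zero])
    from has_integral_bound[OF this int le] show ?thesis by (simp add: cbox_interval)
  qed
  have coeff_int: "integral ?C (\<lambda>\<theta>. \<Phi> (Complex y \<theta>)) = of_real (2 * pi) *\<^sub>C m k"
  proof -
    let ?f = "\<lambda>j \<theta>. exp (of_int (int j - int k) * Complex y \<theta>) *\<^sub>C m j"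
    have y: "exp y \<le> s" using s(1) by (auto simp: y_def min_def) (metis exp_le_cancel_iff exp_ln linear)
    have term_eq: "?f j \<theta> = exp (- of_nat k * Complex y \<theta>) *\<^sub>C (exp (Complex y \<theta>) ^ j *\<^sub>C m j)" for j \<theta>
      by (simp add: scaleC_scaleC exp_of_nat_mult[symmetric] exp_add[symmetric] algebra_simps)
    \<comment> \<open>Comparison with the series at s gives uniform convergence in \<theta>, hence
      integration term by term.\<close>
    have lim: "uniform_limit ?C (\<lambda>n \<theta>. \<Sum>j<n. ?f j \<theta>) (\<lambda>\<theta>. \<Sum>j. ?f j \<theta>) sequentially"
    proof (rule Weierstrass_m_test)
      show "norm (?f j \<theta>) \<le> exp (- real k * y) * (norm (m j) * s ^ j)" for j \<theta>
        unfolding term_eq using power_mono[OF y, of j]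
        by (simp add: norm_scaleC norm_power mult_left_mono mult.commute[of "norm (m j)"] mult_right_mono)
      show "summable (\<lambda>j. exp (- real k * y) * (norm (m j) * s ^ j))" by (rule summable_mult[OF s(2)])
    qed
    have sum: "(\<Sum>j. ?f j \<theta>) = \<Phi> (Complex y \<theta>)" for \<theta>
    proof (rule sums_unique[symmetric])
      show "(\<lambda>j. ?f j \<theta>) sums \<Phi> (Complex y \<theta>)"
        unfolding term_eq \<Phi>_def
        by (intro bounded_linear.sums[OF scaleC.bounded_linear_right] s(3)) (use y in simp)
    qed
    have cont: "continuous_on ?C (\<lambda>\<theta>. \<Sum>j<n. ?f j \<theta>)" for n
      unfolding Complex_eq by (intro continuous_intros scaleC.continuous_on)
    obtain A J where A: "\<And>n. ((\<lambda>\<theta>. \<Sum>j<n. ?f j \<theta>) has_integral A n) ?C"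
      and J: "((\<lambda>\<theta>. \<Sum>j. ?f j \<theta>) has_integral J) ?C" "A \<longlonglongrightarrow> J"
      using uniform_limit_integral_cbox[OF lim cont] by auto
    have "((\<lambda>\<theta>. \<Sum>j<n. ?f j \<theta>) has_integral
        (\<Sum>j<n. (if int j - int k = 0 then of_real (2 * pi) else 0) *\<^sub>C m j)) ?C" for n
    proof (intro has_integral_sum)
      show "(?f j has_integral (if int j - int k = 0 then of_real (2 * pi) else 0) *\<^sub>C m j) ?C" for j
        using has_integral_linear[OF has_integral_exp_vertical[of "int j - int k" y]
            scaleC.bounded_linear_left[of "m j"]]
        by (simp only: o_def)
    qed auto
    from has_integral_unique[OF A this]
    have A_eq: "A n = (\<Sum>j<n. (if j = k then of_real (2 * pi) else 0) *\<^sub>C m j)" for n by simp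
    have "A n = of_real (2 * pi) *\<^sub>C m k" if "k < n" for n
    proof -
      have "A n = (\<Sum>j<n. if j = k then of_real (2 * pi) *\<^sub>C m j else 0)"
        unfolding A_eq by (intro sum.cong) (auto simp: scaleC.zero_left)
      then show ?thesis using that by simp
    qed
    then have "A \<longlonglongrightarrow> of_real (2 * pi) *\<^sub>C m k"
      by (intro tendsto_eventually eventually_sequentiallyI[of "Suc k"]) auto
    then have "J = of_real (2 * pi) *\<^sub>C m k" using J(2) LIMSEQ_unique by blast
    then show ?thesis using J(1)[unfolded sum] integral_unique by blast
  qed
  have "norm (m k) * (2 * pi) \<le> M / r ^ k * (2 * pi)"
    using upper unfolding eq coeff_int by (simp add: norm_scaleC mult.commute)
  then show ?thesis by (rule mult_right_le_imp_le) simp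
qed

section \<open>Entire power series\<close>

definition entire_coeffs :: "(nat \<Rightarrow> 'b::complex_banach_algebra_1) \<Rightarrow> bool"
  where "entire_coeffs c \<longleftrightarrow> (\<forall>r\<ge>0. summable (\<lambda>k. norm (c k) * r ^ k))"

definition power_series :: "(nat \<Rightarrow> 'b::complex_banach_algebra_1) \<Rightarrow> complex \<Rightarrow> 'b"
  where "power_series c t = (\<Sum>k. t ^ k *\<^sub>C c k)"

lemma entire_coeffs_summable_norm: "entire_coeffs c \<Longrightarrow> summable (\<lambda>k. norm (t ^ k *\<^sub>C c k))"
  by (simp add: entire_coeffs_def norm_scaleC norm_power mult.commute[of "_ ^ _"])

text \<open>For r \<ge> 1 the factor k |t|^(k - 1) is at most (2 r)^k on the ball of radius r, so
  the differentiated series converges uniformly there. Continuity of \<open>D\<close> is what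
  \<open>cauchy_estimate\<close> asks for.\<close>

lemma power_series_has_cderiv:
  assumes c: "entire_coeffs c"
  shows "\<exists>D. continuous_on UNIV D \<and> (\<forall>t. has_cderiv (power_series c) (D t) t)"
proof -
  let ?d = "\<lambda>k t. (of_nat k * t ^ (k - 1)) *\<^sub>C c k"
  define D where "D = (\<lambda>t. \<Sum>k. ?d k t)"
  have lim: "uniform_limit (ball 0 r) (\<lambda>n t. \<Sum>k<n. ?d k t) D sequentially" if r: "1 \<le> r" for r
    unfolding D_def
  proof (rule Weierstrass_m_test)
    fix k and t :: complex assume t: "t \<in> ball 0 r"
    have "real k \<le> 2 ^ k" using of_nat_less_two_power[of k] by (simp add: less_imp_le)
    moreover have "cmod t ^ (k - 1) \<le> r ^ k"
      using power_mono[of "cmod t" r "k - 1"] power_increasing[of "k - 1" k r] t r by auto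
    ultimately have "real k * cmod t ^ (k - 1) \<le> 2 ^ k * r ^ k" by (intro mult_mono) auto
    then have "real k * cmod t ^ (k - 1) * norm (c k) \<le> (2 * r) ^ k * norm (c k)"
      by (intro mult_right_mono) (auto simp: power_mult_distrib)
    then show "norm (?d k t) \<le> norm (c k) * (2 * r) ^ k"
      by (simp add: norm_scaleC norm_mult norm_power mult.commute)
  next
    show "summable (\<lambda>k. norm (c k) * (2 * r) ^ k)" using c[unfolded entire_coeffs_def, rule_format, of "2 * r"] r by simp
  qed
  have cont: "isCont D t" for t
  proof -
    have "continuous_on (ball 0 (cmod t + 1)) D"
      by (rule uniform_limit_theorem[OF _ lim])
        (auto intro!: always_eventually continuous_intros scaleC.continuous_on)
    then show ?thesis by (rule continuous_on_interior) simp
  qed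
  have "has_cderiv (power_series c) (D t) t" for t
  proof -
    let ?B = "ball 0 (cmod t + 1) :: complex set"
    have "\<exists>g. \<forall>x\<in>?B. (\<lambda>k. x ^ k *\<^sub>C c k) sums g x \<and> (g has_derivative (\<lambda>h. h *\<^sub>C D x)) (at x within ?B)"
    proof (rule has_derivative_series[where f = "\<lambda>k x. x ^ k *\<^sub>C c k" and x = t
          and f' = "\<lambda>k x h. h *\<^sub>C ?d k x" and l = "power_series c t"])
      show "((\<lambda>x. x ^ k *\<^sub>C c k) has_derivative (\<lambda>h. h *\<^sub>C ?d k x)) (at x within ?B)" for k x
      proof -
        have "((\<lambda>x. x ^ k) has_field_derivative of_nat k * x ^ (k - 1)) (at x within ?B)"
          by (auto intro!: derivative_eq_intros)
        from bounded_linear.has_derivative[OF scaleC.bounded_linear_left this[unfolded has_field_derivative_def]]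
        show ?thesis by (simp add: scaleC_scaleC mult.commute)
      qed
      show "\<forall>\<^sub>F n in sequentially. \<forall>x\<in>?B. \<forall>h. norm ((\<Sum>k<n. h *\<^sub>C ?d k x) - h *\<^sub>C D x) \<le> e * norm h"
        if e: "0 < e" for e
      proof -
        have "eventually (\<lambda>n. \<forall>x\<in>?B. dist (\<Sum>k<n. ?d k x) (D x) < e) sequentially"
          using lim[of "cmod t + 1"] e by (simp add: uniform_limit_iff)
        then show ?thesis
        proof (rule eventually_mono, intro ballI allI)
          fix n :: nat and x h :: complex assume *: "\<forall>x\<in>?B. dist (\<Sum>k<n. ?d k x) (D x) < e" "x \<in> ?B"
          have "(\<Sum>k<n. h *\<^sub>C ?d k x) - h *\<^sub>C D x = h *\<^sub>C ((\<Sum>k<n. ?d k x) - D x)"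
            by (simp add: scaleC.sum_right scaleC.diff_right)
          moreover have "norm ((\<Sum>k<n. ?d k x) - D x) * norm h \<le> e * norm h"
            using * by (intro mult_right_mono) (auto simp: dist_norm less_imp_le)
          ultimately show "norm ((\<Sum>k<n. h *\<^sub>C ?d k x) - h *\<^sub>C D x) \<le> e * norm h"
            by (simp add: norm_scaleC mult.commute)
        qed
      qed
      show "(\<lambda>k. t ^ k *\<^sub>C c k) sums power_series c t"
        unfolding power_series_def
        by (rule summable_sums[OF summable_norm_cancel[OF entire_coeffs_summable_norm[OF c]]])
      show "t \<in> ?B" by simp
    qed (rule convex_ball)
    then obtain g where g: "\<And>x. x \<in> ?B \<Longrightarrow> (\<lambda>k. x ^ k *\<^sub>C c k) sums g x"
      "\<And>x. x \<in> ?B \<Longrightarrow> (g has_derivative (\<lambda>h. h *\<^sub>C D x)) (at x within ?B)" by blast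
    have d: "(g has_derivative (\<lambda>h. h *\<^sub>C D t)) (at t)"
      using g(2)[of t] by (simp add: at_within_open[of t ?B])
    have "g x = power_series c x" if "x \<in> ?B" for x
      using g(1)[OF that] by (simp add: power_series_def sums_iff)
    then show ?thesis
      unfolding has_cderiv_def by (intro has_derivative_transform_within_open[OF d, of ?B]) auto
  qed
  then show ?thesis using cont by (intro exI[of _ D]) (auto intro: continuous_at_imp_continuous_on)
qed

section \<open>Generating functions and the geometric bound\<close>


lemma mult_alg_inverse_eq:
  assumes "x * y = z" "y \<in> invertibles"
  shows "z * alg_inverse y = x"
proof -
  have "z * alg_inverse y = x * (y * alg_inverse y)" using assms(1) mult.assoc by metis
  then show ?thesis using is_inverse_alg_inverse[OF assms(2)] by (simp add: is_inverse_def)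
qed

text \<open>From n \<ge> 1 the recursion never reaches index 0, so the constant term may be changed
  to 0.\<close>

lemma magnus_coeff_cong:
  assumes "\<And>k. 1 \<le> k \<Longrightarrow> a k = b k"
  shows "1 \<le> n \<Longrightarrow> magnus_coeff a l n = magnus_coeff b l n"
proof (induction n rule: less_induct)
  case (less n)
  then show ?case
    by (subst (1 2) magnus_coeff.simps) (auto intro!: arg_cong2[where f = minus] arg_cong2[where f = scaleR] sum.cong simp: assms)
qed

lemma magnus_coeff_0: "magnus_coeff a l 0 = a 0"
  by (subst magnus_coeff.simps) simp

text \<open>The recursion is the Cauchy product form of M (1 + (1 - l) E) = E, and absolute
  convergence of both series allows summation.\<close>

lemma magnus_coeff_suminf:
  fixes a :: "nat \<Rightarrow> 'a::{real_normed_algebra_1, banach}"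
  assumes a: "a 0 = 0" "summable (\<lambda>k. norm (a k))" and m: "summable (\<lambda>k. norm (magnus_coeff a l k))"
  shows "suminf (magnus_coeff a l) * (1 + (1 - l) *\<^sub>R suminf a) = suminf a"
proof -
  let ?m = "magnus_coeff a l"
  have conv: "?m n + (1 - l) *\<^sub>R (\<Sum>i\<le>n. ?m i * a (n - i)) = a n" for n
  proof -
    \<comment> \<open>The Cauchy product has the extra terms i = 0 and i = n; both vanish because
      \<open>a 0 = 0\<close>.\<close>
    have "(\<Sum>i\<le>n. ?m i * a (n - i)) = (\<Sum>i\<in>{1..<n}. ?m i * a (n - i))"
      by (rule sum.mono_neutral_right) (auto simp: a magnus_coeff_0 not_less Suc_le_eq le_less)
    then show ?thesis by (subst magnus_coeff.simps) simp
  qed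
  have "(\<lambda>n. ?m n + (1 - l) *\<^sub>R (\<Sum>i\<le>n. ?m i * a (n - i))) sums (suminf ?m + (1 - l) *\<^sub>R (suminf ?m * suminf a))"
    by (intro sums_add sums_scaleR_right summable_sums[OF summable_norm_cancel[OF m]] Cauchy_product_sums m a(2))
  then have "a sums (suminf ?m + (1 - l) *\<^sub>R (suminf ?m * suminf a))" by (simp only: conv)
  then have "suminf a = suminf ?m + (1 - l) *\<^sub>R (suminf ?m * suminf a)" by (simp add: sums_iff)
  then show ?thesis by (simp add: algebra_simps)
qed

lemma magnus_coeff_scaleC:
  fixes a :: "nat \<Rightarrow> 'b::complex_banach_algebra_1"
  shows "magnus_coeff (\<lambda>k. t ^ k *\<^sub>C a k) l n = t ^ n *\<^sub>C magnus_coeff a l n"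
proof (induction n rule: less_induct)
  case (less n)
  have "(\<Sum>i\<in>{1..<n}. magnus_coeff (\<lambda>k. t ^ k *\<^sub>C a k) l i * (t ^ (n - i) *\<^sub>C a (n - i)))
      = (\<Sum>i\<in>{1..<n}. t ^ n *\<^sub>C (magnus_coeff a l i * a (n - i)))"
    using less
    by (intro sum.cong) (auto simp: mult_scaleC_left mult_scaleC_right scaleC_scaleC simp flip: power_add)
  then show ?case
    by (subst (1 2) magnus_coeff.simps) (simp add: scaleC.diff_right scaleC.scaleR_right scaleC.sum_right)
qed

text \<open>For l < 1 the element is (1 - l) (A - z) with z = - l / (1 - l), a point of the
  half-line that the spectrum avoids.\<close>

lemma log_exists_imp_invertible:
  fixes A :: "'b::complex_banach_algebra_1"
  assumes A: "log_exists A" and l: "l \<in> {0..1}"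
  shows "l *\<^sub>R 1 + (1 - l) *\<^sub>R A \<in> invertibles"
proof (cases "l = 1")
  case True
  then show ?thesis by (auto simp: invertibles_def is_inverse_def intro!: exI[of _ 1])
next
  case False
  define z :: complex where "z = of_real (- l / (1 - l))"
  have "z \<in> \<real>\<^sub>\<le>\<^sub>0" unfolding z_def nonpos_Reals_of_real_iff using l False by (simp add: divide_nonneg_pos)
  then have "z \<notin> spectrum A" using A by (auto simp: log_exists_def)
  then obtain B where "is_inverse (A - z *\<^sub>C 1) B" by (auto simp: spectrum_def)
  moreover have "A - z *\<^sub>C 1 = A + (l / (1 - l)) *\<^sub>R 1"
    unfolding z_def scaleC_of_real by simp
  ultimately have B: "is_inverse (A + (l / (1 - l)) *\<^sub>R 1) B" by simp
  have "l *\<^sub>R 1 + (1 - l) *\<^sub>R A = (1 - l) *\<^sub>R (A + (l / (1 - l)) *\<^sub>R 1)"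
    using False by (simp add: scaleR_add_right)
  moreover have "is_inverse ((1 - l) *\<^sub>R (A + (l / (1 - l)) *\<^sub>R 1)) (inverse (1 - l) *\<^sub>R B)"
    using B False by (simp add: is_inverse_def)
  ultimately show ?thesis unfolding invertibles_def by auto
qed

context continuous_interval_measure
begin

text \<open>The power series of A(t) - 1 has no constant term, whereas \<open>iter_int 0\<close> is
  1.\<close>

definition iter_coeff :: "nat \<Rightarrow> 'a" where "iter_coeff k = (if k = 0 then 0 else iter_int k)"

lemma iter_coeff_0 [simp]: "iter_coeff 0 = 0" by (simp add: iter_coeff_def)

lemma norm_iter_coeff_le: "norm (iter_coeff k) \<le> V ^ k / fact k"
  using norm_iter_int_le[of k] V by (auto simp: iter_coeff_def)

lemma summable_norm_iter_coeff:
  assumes "0 \<le> r"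
  shows "summable (\<lambda>k. norm (iter_coeff k) * r ^ k)"
proof (rule summable_comparison_test')
  show "summable (\<lambda>k. inverse (fact k) * (V * r) ^ k)" by (rule summable_exp)
  show "norm (norm (iter_coeff k) * r ^ k) \<le> inverse (fact k) * (V * r) ^ k" for k
    using mult_right_mono[OF norm_iter_coeff_le, of "r ^ k" k] assms
    by (simp add: power_mult_distrib divide_inverse mult.commute mult.left_commute)
qed

lemma exp_R_eq: "exp_R I \<phi> = 1 + suminf iter_coeff"
proof -
  have "summable iter_coeff" using summable_norm_iter_coeff[of 1] by (auto intro: summable_norm_cancel)
  from suminf_split_head[OF this] have "suminf iter_coeff = (\<Sum>k. iter_int (Suc k))" by (simp add: iter_coeff_def)
  then show ?thesis by (simp add: exp_R_def ordered_integral_prod_list)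
qed

lemma mu_lam_R_eq_magnus_coeff: "l \<in> {0..1} \<Longrightarrow> 1 \<le> k \<Longrightarrow> mu_lam_R l k I \<phi> = magnus_coeff iter_coeff l k"
  using magnus_coeff_cong[of iter_int iter_coeff k l] by (simp add: mu_lam_R_eq iter_coeff_def)

lemma norm_magnus_iter_coeff_le: "l \<in> {0..1} \<Longrightarrow> norm (magnus_coeff iter_coeff l k) \<le> V ^ k"
  using norm_magnus_coeff_le[of l k] V mu_lam_R_eq_magnus_coeff[of l k] mu_lam_R_eq[of l k]
  by (cases "k = 0") (simp_all add: magnus_coeff_0)

text \<open>Kept free of complex scalars: invertibility and the geometric bound are hypotheses, so
  only these two have to be brought back from the complexification.\<close>

lemma magnus_expansion_of_geometric_bound:
  assumes inv: "\<And>l. l \<in> {0..1} \<Longrightarrow> l *\<^sub>R 1 + (1 - l) *\<^sub>R exp_R I \<phi> \<in> invertibles"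
    and \<rho>: "0 \<le> \<rho>" "\<rho> < 1"
    and bound: "\<And>l k. l \<in> {0..1} \<Longrightarrow> 1 \<le> k \<Longrightarrow> norm (mu_lam_R l k I \<phi>) \<le> C * \<rho> ^ k"
  shows "summable (\<lambda>n. norm (mu_R (Suc n) I \<phi>))"
    and "\<forall>n\<ge>1. \<exists>l0\<in>{0..1}. \<forall>l\<in>{0..1}. norm (mu_lam_R l n I \<phi>) \<le> norm (mu_lam_R l0 n I \<phi>)"
    and "summable (\<lambda>n. SUP l\<in>{0..1}. norm (mu_lam_R l (Suc n) I \<phi>))"
    and "((\<lambda>l. \<Sum>k. mu_lam_R l (Suc k) I \<phi>) has_integral alg_log (exp_R I \<phi>)) {0..1}"
    and "(\<lambda>k. mu_R (Suc k) I \<phi>) sums alg_log (exp_R I \<phi>)"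
proof -
  let ?m = "\<lambda>l k. magnus_coeff iter_coeff l k"
  let ?A = "exp_R I \<phi>"
  have m: "mu_lam_R l (Suc k) I \<phi> = ?m l (Suc k)" if "l \<in> {0..1}" for l k
    by (rule mu_lam_R_eq_magnus_coeff[OF that]) simp
  have norm_m: "norm (?m l (Suc k)) \<le> C * \<rho> ^ Suc k" if "l \<in> {0..1}" for l k
    using bound[OF that, of "Suc k"] m[OF that] by simp
  have geo: "summable (\<lambda>k. C * \<rho> ^ Suc k)"
    using \<rho> by (intro summable_mult) (simp add: summable_geometric summable_Suc_iff)
  have int: "((\<lambda>l. ?m l (Suc k)) has_integral mu_R (Suc k) I \<phi>) (cbox 0 1)" for k
  proof (rule has_integral_eq)
    show "((\<lambda>l. magnus_coeff iter_int l (Suc k)) has_integral mu_R (Suc k) I \<phi>) (cbox 0 1)"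
      using has_integral_magnus_coeff[of "Suc k"] by (simp add: cbox_interval)
    show "magnus_coeff iter_int l (Suc k) = ?m l (Suc k)" if "l \<in> cbox 0 1" for l
      using mu_lam_R_eq[of l "Suc k"] m[of l] that by (simp add: cbox_interval)
  qed
  \<comment> \<open>The sign of \<open>C\<close> is not given; it comes from the bound at l =
    0.\<close>
  have C: "0 \<le> C * \<rho> ^ Suc k" for k
    by (rule order_trans[OF norm_ge_zero norm_m[of 0]]) simp
  have "norm (mu_R (Suc k) I \<phi>) \<le> C * \<rho> ^ Suc k" for k
    using has_integral_bound[OF C int, of k] norm_m by (simp add: cbox_interval)
  then show "summable (\<lambda>n. norm (mu_R (Suc n) I \<phi>))"
    by (intro summable_comparison_test'[OF geo]) auto
  show "\<forall>n\<ge>1. \<exists>l0\<in>{0..1}. \<forall>l\<in>{0..1}. norm (mu_lam_R l n I \<phi>) \<le> norm (mu_lam_R l0 n I \<phi>)"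
  proof (intro allI impI)
    fix n :: nat assume n: "1 \<le> n"
    have "\<exists>l0\<in>{0..1}. \<forall>l\<in>{0..1}. norm (?m l n) \<le> norm (?m l0 n)"
      by (rule continuous_attains_sup) (auto intro: continuous_intros continuous_on_magnus_coeff)
    then show "\<exists>l0\<in>{0..1}. \<forall>l\<in>{0..1}. norm (mu_lam_R l n I \<phi>) \<le> norm (mu_lam_R l0 n I \<phi>)"
      using mu_lam_R_eq_magnus_coeff[OF _ n] by simp
  qed
  show "summable (\<lambda>n. SUP l\<in>{0..1}. norm (mu_lam_R l (Suc n) I \<phi>))"
  proof (rule summable_comparison_test'[OF geo])
    fix n
    have le: "norm (mu_lam_R l (Suc n) I \<phi>) \<le> C * \<rho> ^ Suc n" if "l \<in> {0..1}" for l
      using bound[OF that, of "Suc n"] by simp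
    then have "(SUP l\<in>{0..1}. norm (mu_lam_R l (Suc n) I \<phi>)) \<le> C * \<rho> ^ Suc n"
      by (intro cSUP_least) auto
    moreover have "0 \<le> (SUP l\<in>{0..1}. norm (mu_lam_R l (Suc n) I \<phi>))"
      using le by (intro cSUP_upper2[of _ _ 0] bdd_aboveI2) auto
    ultimately show "norm (SUP l\<in>{0..1}. norm (mu_lam_R l (Suc n) I \<phi>)) \<le> C * \<rho> ^ Suc n" by simp
  qed
  have sum_eq: "(\<Sum>k. ?m l (Suc k)) = (?A - 1) * alg_inverse (l *\<^sub>R 1 + (1 - l) *\<^sub>R ?A)" if l: "l \<in> {0..1}" for l
  proof -
    have "summable (\<lambda>k. norm (?m l (Suc k)))"
      using norm_m[OF l] by (intro summable_comparison_test'[OF geo]) auto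
    then have sm: "summable (\<lambda>k. norm (?m l k))" by (simp add: summable_Suc_iff[of "\<lambda>k. norm (?m l k)"])
    have sc: "summable (\<lambda>k. norm (iter_coeff k))" using summable_norm_iter_coeff[of 1] by simp
    have D: "1 + (1 - l) *\<^sub>R suminf iter_coeff = l *\<^sub>R 1 + (1 - l) *\<^sub>R ?A"
      by (simp add: exp_R_eq scaleR_add_right flip: scaleR_add_left add.assoc)
    have "suminf (?m l) * (l *\<^sub>R 1 + (1 - l) *\<^sub>R ?A) = ?A - 1"
      using magnus_coeff_suminf[OF iter_coeff_0 sc sm] unfolding D by (simp add: exp_R_eq)
    then have "(?A - 1) * alg_inverse (l *\<^sub>R 1 + (1 - l) *\<^sub>R ?A) = suminf (?m l)"
      by (rule mult_alg_inverse_eq[OF _ inv[OF l]])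
    moreover have "suminf (?m l) = (\<Sum>k. ?m l (Suc k))"
      using suminf_split_head[OF summable_norm_cancel[OF sm]] by (simp add: magnus_coeff_0)
    ultimately show ?thesis by simp
  qed
  \<comment> \<open>The majorant does not depend on l, so the series may be integrated term by
    term.\<close>
  have lim: "uniform_limit (cbox 0 1) (\<lambda>n l. \<Sum>k<n. ?m l (Suc k)) (\<lambda>l. \<Sum>k. ?m l (Suc k)) sequentially"
    by (rule Weierstrass_m_test[OF _ geo]) (use norm_m in \<open>simp add: cbox_interval\<close>)
  have cont: "continuous_on (cbox 0 1) (\<lambda>l. \<Sum>k<n. ?m l (Suc k))" for n
    by (intro continuous_intros continuous_on_magnus_coeff)
  obtain A J where A: "\<And>n. ((\<lambda>l. \<Sum>k<n. ?m l (Suc k)) has_integral A n) (cbox 0 1)"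
    and J: "((\<lambda>l. \<Sum>k. ?m l (Suc k)) has_integral J) (cbox 0 1)" "A \<longlonglongrightarrow> J"
    using uniform_limit_integral_cbox[OF lim cont] by auto
  have "A = (\<lambda>n. \<Sum>k<n. mu_R (Suc k) I \<phi>)"
    by (rule ext, rule has_integral_unique[OF A]) (intro has_integral_sum int, simp)
  then have sums: "(\<lambda>k. mu_R (Suc k) I \<phi>) sums J" using J(2) by (simp add: sums_def)
  have "((\<lambda>l. (?A - 1) * alg_inverse (l *\<^sub>R 1 + (1 - l) *\<^sub>R ?A)) has_integral J) {0..1}"
    by (rule has_integral_eq[OF _ J(1)[unfolded cbox_interval]]) (use sum_eq in auto)
  then have J_eq: "J = alg_log ?A" unfolding alg_log_def by (simp add: integral_unique)
  show "((\<lambda>l. \<Sum>k. mu_lam_R l (Suc k) I \<phi>) has_integral alg_log ?A) {0..1}"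
    unfolding J_eq[symmetric]
    by (rule has_integral_eq[OF _ J(1)[unfolded cbox_interval]]) (use m in auto)
  show "(\<lambda>k. mu_R (Suc k) I \<phi>) sums alg_log ?A" using sums by (simp add: J_eq)
qed

end

locale complex_interval_measure = continuous_interval_measure I \<psi> V
  for I :: "real set" and \<psi> :: "real set \<Rightarrow> 'b::complex_banach_algebra_1" and V :: real
begin

lemma entire_iter_coeff: "entire_coeffs iter_coeff"
  using summable_norm_iter_coeff by (simp add: entire_coeffs_def)

text \<open>A word of length k contributes the factor t^k, hence so does the ordered integral of
  degree k.\<close>

lemma exp_R_scaleC: "exp_R I (\<lambda>J. t *\<^sub>C \<psi> J) = 1 + power_series iter_coeff t"
proof -
  have prod: "prod_list (map (\<lambda>J. t *\<^sub>C \<psi> J) v) = t ^ length v *\<^sub>C prod_list (map \<psi> v)" for v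
    by (induction v) (simp_all add: mult_scaleC_left mult_scaleC_right scaleC_scaleC mult.commute[of "_ ^ _" t])
  have "ordered_sum prod_list k (\<lambda>J. t *\<^sub>C \<psi> J) = (\<lambda>P. t ^ k *\<^sub>C ordered_sum prod_list k \<psi> P)" for k
    unfolding ordered_sum_def scaleC.sum_right by (auto intro!: sum.cong simp: prod)
  moreover have "((\<lambda>P. t ^ k *\<^sub>C ordered_sum prod_list k \<psi> P) \<longlongrightarrow> t ^ k *\<^sub>C iter_int k) \<F>" for k
    by (intro bounded_linear.tendsto[OF scaleC.bounded_linear_right] ordered_sum_prod_list_tendsto)
  ultimately have "ordered_integral I prod_list k (\<lambda>J. t *\<^sub>C \<psi> J) = t ^ k *\<^sub>C iter_int k" for k
    unfolding ordered_integral_def by (simp add: tendsto_Lim[OF refinement_filter_neq_bot[OF interval]])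
  moreover have "power_series iter_coeff t = (\<Sum>k. t ^ Suc k *\<^sub>C iter_int (Suc k))"
    using suminf_split_head[OF summable_norm_cancel[OF entire_coeffs_summable_norm[OF entire_iter_coeff]], of t]
    by (simp add: power_series_def iter_coeff_def scaleC.zero_right del: power_Suc)
  ultimately show ?thesis by (simp add: exp_R_def)
qed

lemma mu_lam_R_geometric_bound:
  assumes M: "M_controlled I \<psi>"
  shows "\<exists>C \<rho>. 0 \<le> \<rho> \<and> \<rho> < 1 \<and> (\<forall>l\<in>{0..1}. \<forall>k\<ge>1. norm (mu_lam_R l k I \<psi>) \<le> C * \<rho> ^ k)"
proof -
  let ?S = "power_series iter_coeff"
  define F where "F = (\<lambda>p. 1 + (1 - fst p) *\<^sub>R ?S (snd p) :: 'b)"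
  obtain S' where S': "continuous_on UNIV S'" "\<And>t. has_cderiv ?S (S' t) t"
    using power_series_has_cderiv[OF entire_iter_coeff] by blast
  have contS: "continuous_on X ?S" for X
    by (intro continuous_at_imp_continuous_on ballI has_cderiv_isCont[OF S'(2)])
  have contF: "continuous_on X F" for X
    unfolding F_def by (intro continuous_intros continuous_on_compose2[OF contS[of UNIV]]) auto
  have inv1: "F (l, t) \<in> invertibles" if "l \<in> {0..1}" "cmod t \<le> 1" for l t
  proof -
    have "log_exists (1 + ?S t)" using M that by (simp add: M_controlled_def exp_R_scaleC)
    from log_exists_imp_invertible[OF this that(1)] show ?thesis
      by (simp add: F_def scaleR_add_right flip: scaleR_add_left add.assoc)
  qed
  have "compact ({0..1::real} \<times> cball 0 1 :: (real \<times> complex) set)" by (intro compact_Times) auto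
  moreover have "open (F -` invertibles)" by (rule open_vimage[OF open_invertibles contF])
  moreover have "{0..1} \<times> cball 0 1 \<subseteq> F -` invertibles" using inv1 by auto
  ultimately obtain e where e: "0 < e" "(\<Union>p\<in>{0..1} \<times> cball 0 1. ball p e) \<subseteq> F -` invertibles"
    by (rule compact_subset_open_imp_ball_epsilon_subset)
  \<comment> \<open>With e / 2 the closed disc of radius \<open>R\<close> stays in the
    e-neighbourhood of the unit disc; \<open>r\<close> in between leaves room for the Cauchy
    estimate.\<close>
  define R where "R = 1 + e / 2"
  define r where "r = 1 + e / 4"
  have r: "1 < r" "r < R" using e by (auto simp: r_def R_def)
  have inv: "F (l, t) \<in> invertibles" if l: "l \<in> {0..1}" and t: "cmod t \<le> R" for l t
  proof (cases "cmod t \<le> 1")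
    case True
    then show ?thesis using inv1 l by blast
  next
    case False
    then have c: "1 < cmod t" "t \<noteq> 0" by auto
    \<comment> \<open>Radial projection to the unit circle; its distance from t is |t| - 1 \<le> e /
      2.\<close>
    define t0 where "t0 = t / of_real (cmod t)"
    have "t - t0 = of_real (1 - 1 / cmod t) * t" by (simp add: t0_def algebra_simps)
    then have "cmod (t - t0) = \<bar>1 - 1 / cmod t\<bar> * cmod t" by (simp only: norm_mult norm_of_real)
    also have "\<bar>1 - 1 / cmod t\<bar> = 1 - 1 / cmod t" using c by (intro abs_of_nonneg) simp
    also have "(1 - 1 / cmod t) * cmod t = cmod t - 1" using c by (simp add: left_diff_distrib)
    finally have "dist (l, t0) (l, t) < e"
      using t e(1) by (simp add: dist_Pair_Pair dist_norm norm_minus_commute R_def)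
    moreover have "cmod t0 \<le> 1" by (simp add: t0_def norm_divide)
    ultimately have "(l, t) \<in> (\<Union>p\<in>{0..1} \<times> cball 0 1. ball p e)"
      using l by (intro UN_I[of "(l, t0)"]) auto
    from subsetD[OF e(2) this] show ?thesis by simp
  qed
  \<comment> \<open>With l as a second variable, one bound on a compact set serves all l.\<close>
  define G where "G = (\<lambda>p. ?S (snd p) * alg_inverse (F p))"
  have "continuous_on ({0..1} \<times> cball 0 R) G"
    unfolding G_def
    by (intro continuous_intros continuous_on_alg_inverse contF continuous_on_compose2[OF contS[of UNIV]])
      (use inv in auto)
  then have "bounded (G ` ({0..1} \<times> cball 0 R))"
    by (intro compact_imp_bounded compact_continuous_image compact_Times) auto
  then obtain B where "\<forall>p\<in>{0..1} \<times> cball 0 R. norm (G p) \<le> B"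
    by (auto simp: bounded_iff)
  then have B: "norm (G (l, t)) \<le> B" if "l \<in> {0..1}" "cmod t \<le> R" for l t using that by simp
  have est: "norm (magnus_coeff iter_coeff l k) \<le> B / r ^ k" if l: "l \<in> {0..1}" for l k
  proof (rule cauchy_estimate)
    let ?Y = "\<lambda>t. alg_inverse (F (l, t))"
    let ?G' = "\<lambda>t. ?S t * - (?Y t * ((1 - l) *\<^sub>R S' t) * ?Y t) + S' t * ?Y t"
    have dF: "has_cderiv (\<lambda>t. F (l, t)) ((1 - l) *\<^sub>R S' t) t" for t
      using has_derivative_add[OF has_derivative_const
          has_derivative_scaleR_right[OF S'(2)[of t, unfolded has_cderiv_def], of "1 - l"], of 1]
      by (simp add: has_cderiv_def F_def scaleC.scaleR_right)
    show "has_cderiv (\<lambda>t. G (l, t)) (?G' t) t" if "t \<in> ball 0 R" for t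
    proof -
      have "F (l, t) \<in> invertibles" using that l by (intro inv) auto
      from has_cderiv_mult[OF S'(2) has_cderiv_alg_inverse[OF dF this]]
      show ?thesis by (simp add: G_def)
    qed
    show "continuous_on (ball 0 R) ?G'"
      by (intro continuous_intros contS continuous_on_subset[OF S'(1)] continuous_on_alg_inverse
          continuous_on_compose2[OF contF[of UNIV]]) (use inv l in auto)
    show "0 < r" "r < R" using r by auto
    show "norm (G (l, t)) \<le> B" if "cmod t = r" for t using B[OF l, of t] that r by simp
    \<comment> \<open>On |t| \<le> s the crude bound \<open>V ^ j\<close> leaves a series dominated
      by (1 / 2)^j. Also s \<le> 1, so the control hypothesis gives invertibility there.\<close>
    define s where "s = 1 / (2 * V)"
    have s: "0 < s" "s \<le> 1" using V by (auto simp: s_def field_simps)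
    show "0 < s" by fact
    have geo: "norm (magnus_coeff iter_coeff l j) * s ^ j \<le> (1 / 2) ^ j" for j
    proof -
      have "norm (magnus_coeff iter_coeff l j) * s ^ j \<le> V ^ j * s ^ j"
        using s by (intro mult_right_mono norm_magnus_iter_coeff_le l) auto
      also have "\<dots> = (1 / 2) ^ j" using V by (simp add: s_def flip: power_mult_distrib)
      finally show ?thesis .
    qed
    show sm: "summable (\<lambda>j. norm (magnus_coeff iter_coeff l j) * s ^ j)"
      by (rule summable_comparison_test'[OF summable_geometric[of "1 / 2 :: real"]])
        (use geo s in \<open>auto simp: abs_mult\<close>)
    fix t :: complex assume t: "cmod t \<le> s"
    let ?a = "\<lambda>k. t ^ k *\<^sub>C iter_coeff k"
    have sumn: "summable (\<lambda>j. norm (t ^ j *\<^sub>C magnus_coeff iter_coeff l j))"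
    proof (rule summable_comparison_test'[OF sm])
      show "norm (norm (t ^ j *\<^sub>C magnus_coeff iter_coeff l j)) \<le> norm (magnus_coeff iter_coeff l j) * s ^ j" for j
        using mult_left_mono[OF power_mono[OF t norm_ge_zero, of j], of "norm (magnus_coeff iter_coeff l j)"]
        by (simp add: norm_scaleC norm_power mult.commute)
    qed
    have Y: "F (l, t) \<in> invertibles" using inv1[OF l, of t] t s by simp
    have "suminf (magnus_coeff ?a l) * (1 + (1 - l) *\<^sub>R suminf ?a) = suminf ?a"
      by (rule magnus_coeff_suminf)
        (use sumn entire_coeffs_summable_norm[OF entire_iter_coeff] in
          \<open>simp_all add: magnus_coeff_scaleC scaleC.zero_right\<close>)
    then have "suminf (magnus_coeff ?a l) * F (l, t) = ?S t" by (simp add: F_def power_series_def)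
    from mult_alg_inverse_eq[OF this Y] have "G (l, t) = suminf (magnus_coeff ?a l)" by (simp add: G_def)
    then show "(\<lambda>j. t ^ j *\<^sub>C magnus_coeff iter_coeff l j) sums G (l, t)"
      using summable_sums[OF summable_norm_cancel[OF sumn]] magnus_coeff_scaleC[of t iter_coeff l, abs_def]
      by simp
  qed
  show ?thesis
  proof (intro exI conjI ballI allI impI)
    show "0 \<le> 1 / r" "1 / r < 1" using r by auto
    show "norm (mu_lam_R l k I \<psi>) \<le> B * (1 / r) ^ k" if "l \<in> {0..1}" "1 \<le> k" for l k
      using est[OF that(1), of k] mu_lam_R_eq_magnus_coeff[OF that] by (simp add: power_divide)
  qed
qed

end

section \<open>Complexification\<close>


lemma bounded_linear_complexify:
  "bounded_linear (complexify :: 'a::real_normed_vector \<Rightarrow> 'a complexification)"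
proof
  show "\<exists>K. \<forall>x :: 'a. norm (complexify x) \<le> norm x * K"
    by (rule exI[of _ 1]) (simp add: norm_complexification_def)
qed (simp_all add: complexification_eq_iff)

lemma norm_complexify [simp]: "norm (complexify x) = norm x"
  by (simp add: norm_complexification_def)

lemma complexify_mult: "complexify (x * y) = complexify x * complexify (y :: 'a::real_algebra_1)"
  and complexify_one: "complexify (1 :: 'a) = 1"
  by (simp_all add: complexification_eq_iff)

lemma complexify_prod_list:
  "complexify (prod_list (xs :: 'a::real_algebra_1 list)) = prod_list (map complexify xs)"
  by (induction xs) (simp_all add: complexify_mult complexify_one)

text \<open>The real part of an inverse in the complexification is already an inverse, as
  \<open>complexify x\<close> has no imaginary part.\<close>

lemma invertible_of_complexify:
  fixes x :: "'a::{real_normed_algebra_1, banach}"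
  assumes "complexify x \<in> invertibles"
  shows "x \<in> invertibles"
proof -
  obtain z where "complexify x * z = 1" "z * complexify x = 1"
    using assms by (auto simp: invertibles_def is_inverse_def)
  then have "is_inverse x (cRe z)" by (simp add: complexification_eq_iff is_inverse_def)
  then show ?thesis by (auto simp: invertibles_def)
qed

lemma complexify_magnus_coeff:
  fixes a :: "nat \<Rightarrow> 'a::real_normed_algebra_1"
  shows "complexify (magnus_coeff a l n) = magnus_coeff (\<lambda>k. complexify (a k)) l n"
proof (induction n rule: less_induct)
  case (less n)
  interpret bounded_linear "complexify :: 'a \<Rightarrow> 'a complexification" by (rule bounded_linear_complexify)
  have "(\<Sum>i\<in>{1..<n}. complexify (magnus_coeff a l i * a (n - i)))
      = (\<Sum>i\<in>{1..<n}. magnus_coeff (\<lambda>k. complexify (a k)) l i * complexify (a (n - i)))"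
    using less by (intro sum.cong) (simp_all add: complexify_mult)
  then show ?case by (subst (1 2) magnus_coeff.simps) (simp add: diff scaleR sum)
qed

lemma (in continuous_interval_measure) complexified_measure:
  "complex_interval_measure I (\<lambda>J. complexify (\<phi> J)) V"
proof
  show "is_interval_measure I (\<lambda>J. complexify (\<phi> J))"
    unfolding is_interval_measure_def
  proof (intro allI impI)
    fix J :: "nat \<Rightarrow> real set"
    assume "range J \<subseteq> subintervals I \<and> disjoint_family J \<and> is_interval (\<Union>n. J n)"
    from bounded_linear.sums[OF bounded_linear_complexify measure[unfolded is_interval_measure_def, rule_format, OF this]]
    show "(\<lambda>n. complexify (\<phi> (J n))) sums complexify (\<phi> (\<Union>n. J n))" .
  qed
  show "continuous_measure I (\<lambda>J. complexify (\<phi> J))"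
    using continuous by (simp add: continuous_measure_def complexification_eq_iff)
  show "variation_le (\<lambda>J. complexify (\<phi> J)) I V"
    using V by (simp add: variation_le_def)
qed (use interval bounded V in auto)

text \<open>Everything is built from the iterated integrals, with which the isometric homomorphism
  \<open>complexify\<close> commutes. \<open>mu_R\<close> does not occur: it is recovered in the
  real algebra by integration over l.\<close>

lemma (in continuous_interval_measure) complexified_magnus:
  shows "exp_R I (\<lambda>J. complexify (\<phi> J)) = complexify (exp_R I \<phi>)"
    and "l \<in> {0..1} \<Longrightarrow> 1 \<le> k \<Longrightarrow> mu_lam_R l k I (\<lambda>J. complexify (\<phi> J)) = complexify (mu_lam_R l k I \<phi>)"
proof -
  interpret cpl: complex_interval_measure I "\<lambda>J. complexify (\<phi> J)" V by (rule complexified_measure)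
  interpret bl: bounded_linear "complexify :: 'a \<Rightarrow> 'a complexification" by (rule bounded_linear_complexify)
  have "inc_sum block_point k (\<lambda>J. complexify (\<phi> J)) = (\<lambda>P. complexify (inc_sum block_point k \<phi> P))" for k
    by (simp add: word_sum_def bl.sum bl.scaleR complexify_prod_list o_def fun_eq_iff)
  then have "cpl.iter_int k = complexify (iter_int k)" for k
    unfolding cpl.iter_int_def
    using tendsto_Lim[OF refinement_filter_neq_bot[OF interval] bl.tendsto[OF inc_sum_tendsto[of k]]] by simp
  then have coeff: "cpl.iter_coeff k = complexify (iter_coeff k)" for k
    by (simp add: cpl.iter_coeff_def iter_coeff_def bl.zero)
  have "summable iter_coeff"
    using summable_norm_iter_coeff[of 1] by (auto intro: summable_norm_cancel)
  then have "suminf cpl.iter_coeff = complexify (suminf iter_coeff)"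
    by (simp add: coeff[abs_def] bl.suminf)
  then show "exp_R I (\<lambda>J. complexify (\<phi> J)) = complexify (exp_R I \<phi>)"
    by (simp add: cpl.exp_R_eq exp_R_eq bl.add complexify_one)
  show "mu_lam_R l k I (\<lambda>J. complexify (\<phi> J)) = complexify (mu_lam_R l k I \<phi>)" if "l \<in> {0..1}" "1 \<le> k"
    by (simp add: cpl.mu_lam_R_eq_magnus_coeff[OF that] mu_lam_R_eq_magnus_coeff[OF that]
        complexify_magnus_coeff coeff[abs_def])
qed

lemma (in complex_interval_measure) M_controlled_log_exists:
  "M_controlled I \<psi> \<Longrightarrow> log_exists (exp_R I \<psi>)"
  unfolding M_controlled_def by (elim allE[of _ 1]) simp

theorem theorem2p20:
  fixes I :: "real set"
    and \<phi> :: "real set \<Rightarrow> 'a::{real_normed_algebra_1, banach}"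
    and \<psi> :: "real set \<Rightarrow> 'b::complex_banach_algebra_1"
  assumes "is_interval I" and "bounded I"
  shows
    "(is_interval_measure I \<phi> \<and> continuous_measure I \<phi> \<and> variation I \<phi> < \<infinity>
        \<and> M_controlled I (\<lambda>J. complexify (\<phi> J)) \<longrightarrow>
      log_exists (complexify (exp_R I \<phi>))
      \<and> summable (\<lambda>n. norm (mu_R (Suc n) I \<phi>))
      \<and> (\<forall>n\<ge>1. \<exists>l0\<in>{0..1}. \<forall>l\<in>{0..1}. norm (mu_lam_R l n I \<phi>) \<le> norm (mu_lam_R l0 n I \<phi>))
      \<and> summable (\<lambda>n. SUP l\<in>{0..1}. norm (mu_lam_R l (Suc n) I \<phi>))
      \<and> ((\<lambda>l. \<Sum>k. mu_lam_R l (Suc k) I \<phi>) has_integral alg_log (exp_R I \<phi>)) {0..1}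
      \<and> (\<lambda>k. mu_R (Suc k) I \<phi>) sums alg_log (exp_R I \<phi>))
    \<and>
     (is_interval_measure I \<psi> \<and> continuous_measure I \<psi> \<and> variation I \<psi> < \<infinity>
        \<and> M_controlled I \<psi> \<longrightarrow>
      log_exists (exp_R I \<psi>)
      \<and> summable (\<lambda>n. norm (mu_R (Suc n) I \<psi>))
      \<and> (\<forall>n\<ge>1. \<exists>l0\<in>{0..1}. \<forall>l\<in>{0..1}. norm (mu_lam_R l n I \<psi>) \<le> norm (mu_lam_R l0 n I \<psi>))
      \<and> summable (\<lambda>n. SUP l\<in>{0..1}. norm (mu_lam_R l (Suc n) I \<psi>))
      \<and> ((\<lambda>l. \<Sum>k. mu_lam_R l (Suc k) I \<psi>) has_integral alg_log (exp_R I \<psi>)) {0..1}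
      \<and> (\<lambda>k. mu_R (Suc k) I \<psi>) sums alg_log (exp_R I \<psi>))"
proof (intro conjI[of "_ \<longrightarrow> _"] impI; elim conjE)
  assume \<phi>: "is_interval_measure I \<phi>" "continuous_measure I \<phi>" "variation I \<phi> < \<infinity>"
    and M: "M_controlled I (\<lambda>J. complexify (\<phi> J))"
  obtain V where V: "1 \<le> V" "variation_le \<phi> I V" using finite_variationE[OF \<phi>(3)] .
  interpret continuous_interval_measure I \<phi> V by unfold_locales fact+
  interpret cpl: complex_interval_measure I "\<lambda>J. complexify (\<phi> J)" V by (rule complexified_measure)
  have log: "log_exists (complexify (exp_R I \<phi>))"
    using cpl.M_controlled_log_exists[OF M] by (simp add: complexified_magnus)
  \<comment> \<open>\<open>alg_log\<close> is formed in the real algebra, so the inverses must exist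
    there.\<close>
  have inv: "l *\<^sub>R 1 + (1 - l) *\<^sub>R exp_R I \<phi> \<in> invertibles" if "l \<in> {0..1}" for l
  proof (rule invertible_of_complexify)
    show "complexify (l *\<^sub>R 1 + (1 - l) *\<^sub>R exp_R I \<phi>) \<in> invertibles"
      using log_exists_imp_invertible[OF log that] bounded_linear_complexify[where 'a = 'a]
      by (simp add: linear_simps complexify_one)
  qed
  obtain C \<rho> where \<rho>: "0 \<le> \<rho>" "\<rho> < 1"
    and bound: "\<And>l k. l \<in> {0..1} \<Longrightarrow> 1 \<le> k \<Longrightarrow> norm (mu_lam_R l k I (\<lambda>J. complexify (\<phi> J))) \<le> C * \<rho> ^ k"
    using cpl.mu_lam_R_geometric_bound[OF M] by blast
  \<comment> \<open>\<open>complexify\<close> is an isometry, so the bound holds with the same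
    constants.\<close>
  have "norm (mu_lam_R l k I \<phi>) \<le> C * \<rho> ^ k" if "l \<in> {0..1}" "1 \<le> k" for l k
    using bound[OF that] by (simp only: complexified_magnus(2)[OF that] norm_complexify)
  note magnus_expansion_of_geometric_bound[OF inv \<rho> this]
  with log show "log_exists (complexify (exp_R I \<phi>))
      \<and> summable (\<lambda>n. norm (mu_R (Suc n) I \<phi>))
      \<and> (\<forall>n\<ge>1. \<exists>l0\<in>{0..1}. \<forall>l\<in>{0..1}. norm (mu_lam_R l n I \<phi>) \<le> norm (mu_lam_R l0 n I \<phi>))
      \<and> summable (\<lambda>n. SUP l\<in>{0..1}. norm (mu_lam_R l (Suc n) I \<phi>))
      \<and> ((\<lambda>l. \<Sum>k. mu_lam_R l (Suc k) I \<phi>) has_integral alg_log (exp_R I \<phi>)) {0..1}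
      \<and> (\<lambda>k. mu_R (Suc k) I \<phi>) sums alg_log (exp_R I \<phi>)"
    by blast
next
  assume \<psi>: "is_interval_measure I \<psi>" "continuous_measure I \<psi>" "variation I \<psi> < \<infinity>"
    and M: "M_controlled I \<psi>"
  obtain V where V: "1 \<le> V" "variation_le \<psi> I V" using finite_variationE[OF \<psi>(3)] .
  interpret complex_interval_measure I \<psi> V by unfold_locales fact+
  have log: "log_exists (exp_R I \<psi>)" by (rule M_controlled_log_exists[OF M])
  obtain C \<rho> where \<rho>: "0 \<le> \<rho>" "\<rho> < 1"
    and bound: "\<And>l k. l \<in> {0..1} \<Longrightarrow> 1 \<le> k \<Longrightarrow> norm (mu_lam_R l k I \<psi>) \<le> C * \<rho> ^ k"
    using mu_lam_R_geometric_bound[OF M] by blast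
  note magnus_expansion_of_geometric_bound[OF log_exists_imp_invertible[OF log] \<rho> bound]
  with log show "log_exists (exp_R I \<psi>)
      \<and> summable (\<lambda>n. norm (mu_R (Suc n) I \<psi>))
      \<and> (\<forall>n\<ge>1. \<exists>l0\<in>{0..1}. \<forall>l\<in>{0..1}. norm (mu_lam_R l n I \<psi>) \<le> norm (mu_lam_R l0 n I \<psi>))
      \<and> summable (\<lambda>n. SUP l\<in>{0..1}. norm (mu_lam_R l (Suc n) I \<psi>))
      \<and> ((\<lambda>l. \<Sum>k. mu_lam_R l (Suc k) I \<psi>) has_integral alg_log (exp_R I \<psi>)) {0..1}
      \<and> (\<lambda>k. mu_R (Suc k) I \<psi>) sums alg_log (exp_R I \<psi>)"
    by blast
qed

end
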